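(* Let $G$ be a compact abelian group with dual group $\Gamma$, let $\Sigma\subset\Gamma$ be a Sidon set and let $\Omega:\ell_2^0(\Sigma)\to\ell_2(\Sigma)$ be a nontrivial $\ell_\infty(\Sigma)$-centralizer. Given $p\in(1,\infty]$ and $q\in[1,\infty)$, the map $\mho_\Sigma^{pq}:L_p^0(G)\to L_q(G)$ defined by $\mho_\Sigma^{pq}(f)=S\,\Omega(\widehat f|_\Sigma)$ is a nontrivial $L_1(G)$-centralizer.
   Context: $G$ carries its normalized Haar measure; function spaces are complex. $\widehat f(\gamma)=\int_G f(x)\overline\gamma(x)\,dx$. $L_p^0(G)$ is the space $P(G)$ of polynomials (finite linear combinations of characters) with the norm of $L_p(G)$. $L_1(G)$ is a Banach algebra under convolution, and $L_p(G)$, $L_p^0(G)$ are $L_1(G)$-modules under convolution. $\ell_2(\Sigma)$ is an $\ell_\infty(\Sigma)$-module under the pointwise product and $\ell_2^0(\Sigma)$ is its submodule of finitely supported elements. $\Sigma\subset\Gamma$ is a *Sidon set* if every $c\in c_0(\Sigma)$ has the form $\widehat f|_\Sigma$ for some $f\in L_1(G)$. For such $\Sigma$ and $q<\infty$, $S:\ell_2(\Sigma)\to L_q(G)$ denotes the (bounded) summation operator $S(c)=\sum_{\gamma\in\Sigma}c(\gamma)\gamma$. Let $A$ be a Banach algebra and $X,Y$ quasinormed $A$-modules. A homogeneous map $\Phi:X\to Y$ is an *$A$-centralizer* if there are constants $Q,C$ such that $\|\Phi(x+x')-\Phi(x)-\Phi(x')\|\le Q(\|x\|+\|x'\|)$ and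 $\|\Phi(ax)-a\Phi(x)\|\le C\|a\|\|x\|$ for all $x,x'\in X$, $a\in A$. It is *trivial* if there are a (not necessarily continuous) morphism of $A$-modules $\phi:X\to Y$ and a constant $K$ with $\|\Phi(x)-\phi(x)\|\le K\|x\|$ for all $x\in X$; otherwise it is nontrivial. *)

theory Defs
  imports "HOL-Probability.Essential_Supremum"
begin

section \<open>Centralizers between quasinormed modules\<close>

text \<open>
  A quasinormed complex space, given by its carrier and operations, with an action of an algebra
  whose elements have type \<open>'a\<close>. The algebra is itself encoded as such a structure, namely as a
  module over itself, so that its \<open>act\<close> is its multiplication.
\<close>

record ('a, 'x) qmodule =
  carrier :: "'x set"
  vadd :: "'x \<Rightarrow> 'x \<Rightarrow> 'x"
  vscale :: "complex \<Rightarrow> 'x \<Rightarrow> 'x"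
  qnorm :: "'x \<Rightarrow> real"
  act :: "'a \<Rightarrow> 'x \<Rightarrow> 'x"

definition vsub :: "('a, 'x) qmodule \<Rightarrow> 'x \<Rightarrow> 'x \<Rightarrow> 'x" where
  "vsub X x y = vadd X x (vscale X (-1) y)"

definition homogeneous_map :: "('a, 'x) qmodule \<Rightarrow> ('a, 'y) qmodule \<Rightarrow> ('x \<Rightarrow> 'y) \<Rightarrow> bool" where
  "homogeneous_map X Y \<Phi> \<longleftrightarrow>
     \<Phi> \<in> carrier X \<rightarrow> carrier Y \<and>
     (\<forall>x\<in>carrier X. \<forall>t. \<Phi> (vscale X t x) = vscale Y t (\<Phi> x))"

definition centralizer ::
  "('a, 'a) qmodule \<Rightarrow> ('a, 'x) qmodule \<Rightarrow> ('a, 'y) qmodule \<Rightarrow> ('x \<Rightarrow> 'y) \<Rightarrow> bool" where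
  "centralizer A X Y \<Phi> \<longleftrightarrow>
     homogeneous_map X Y \<Phi> \<and>
     (\<exists>Q C :: real.
        (\<forall>x\<in>carrier X. \<forall>x'\<in>carrier X.
           qnorm Y (vsub Y (vsub Y (\<Phi> (vadd X x x')) (\<Phi> x)) (\<Phi> x')) \<le> Q * (qnorm X x + qnorm X x')) \<and>
        (\<forall>a\<in>carrier A. \<forall>x\<in>carrier X.
           qnorm Y (vsub Y (\<Phi> (act X a x)) (act Y a (\<Phi> x))) \<le> C * qnorm A a * qnorm X x))"

definition module_morphism ::
  "('a, 'a) qmodule \<Rightarrow> ('a, 'x) qmodule \<Rightarrow> ('a, 'y) qmodule \<Rightarrow> ('x \<Rightarrow> 'y) \<Rightarrow> bool" where
  "module_morphism A X Y \<phi> \<longleftrightarrow>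
     homogeneous_map X Y \<phi> \<and>
     (\<forall>x\<in>carrier X. \<forall>x'\<in>carrier X. \<phi> (vadd X x x') = vadd Y (\<phi> x) (\<phi> x')) \<and>
     (\<forall>a\<in>carrier A. \<forall>x\<in>carrier X. \<phi> (act X a x) = act Y a (\<phi> x))"

definition trivial_map ::
  "('a, 'a) qmodule \<Rightarrow> ('a, 'x) qmodule \<Rightarrow> ('a, 'y) qmodule \<Rightarrow> ('x \<Rightarrow> 'y) \<Rightarrow> bool" where
  "trivial_map A X Y \<Phi> \<longleftrightarrow>
     (\<exists>\<phi>. \<exists>K :: real. module_morphism A X Y \<phi> \<and>
        (\<forall>x\<in>carrier X. qnorm Y (vsub Y (\<Phi> x) (\<phi> x)) \<le> K * qnorm X x))"

definition nontrivial_centralizer ::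
  "('a, 'a) qmodule \<Rightarrow> ('a, 'x) qmodule \<Rightarrow> ('a, 'y) qmodule \<Rightarrow> ('x \<Rightarrow> 'y) \<Rightarrow> bool" where
  "nontrivial_centralizer A X Y \<Phi> \<longleftrightarrow> centralizer A X Y \<Phi> \<and> \<not> trivial_map A X Y \<Phi>"


section \<open>Haar measure, characters, Lebesgue spaces\<close>

text \<open>
  Compact abelian groups are written additively. They need not be metrizable, hence the explicit
  regularity requirement.
\<close>

definition normalized_haar :: "'g::{topological_ab_group_add, t2_space} measure \<Rightarrow> bool" where
  "normalized_haar \<mu> \<longleftrightarrow>
     sets \<mu> = sets borel \<and>
     emeasure \<mu> UNIV = 1 \<and>
     (\<forall>a. distr \<mu> borel (\<lambda>x. a + x) = \<mu>) \<and>
     (\<forall>B\<in>sets borel. emeasure \<mu> B = (SUP K\<in>{K. compact K \<and> K \<subseteq> B}. emeasure \<mu> K)) \<and>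
     (\<forall>B\<in>sets borel. emeasure \<mu> B = (INF U\<in>{U. open U \<and> B \<subseteq> U}. emeasure \<mu> U))"

definition dual_group :: "('g::topological_ab_group_add \<Rightarrow> complex) set" where
  "dual_group = {\<gamma>. continuous_on UNIV \<gamma> \<and> (\<forall>x. cmod (\<gamma> x) = 1) \<and> (\<forall>x y. \<gamma> (x + y) = \<gamma> x * \<gamma> y)}"

definition fourier :: "'g measure \<Rightarrow> ('g \<Rightarrow> complex) \<Rightarrow> ('g \<Rightarrow> complex) \<Rightarrow> complex" where
  "fourier \<mu> f \<gamma> = (LINT x|\<mu>. f x * cnj (\<gamma> x))"

definition convolution ::
  "'g::ab_group_add measure \<Rightarrow> ('g \<Rightarrow> complex) \<Rightarrow> ('g \<Rightarrow> complex) \<Rightarrow> 'g \<Rightarrow> complex" where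
  "convolution \<mu> f g x = (LINT y|\<mu>. f y * g (x - y))"

text \<open>The exponent \<open>p\<close> ranges over \<open>[1, \<infinity>]\<close>.\<close>

definition Lp_functions :: "'g measure \<Rightarrow> ennreal \<Rightarrow> ('g \<Rightarrow> complex) set" where
  "Lp_functions \<mu> p = {f \<in> borel_measurable \<mu>.
     if p = \<infinity> then esssup \<mu> (\<lambda>x. ennreal (cmod (f x))) < \<infinity>
     else integrable \<mu> (\<lambda>x. cmod (f x) powr enn2real p)}"

definition Lp_norm :: "'g measure \<Rightarrow> ennreal \<Rightarrow> ('g \<Rightarrow> complex) \<Rightarrow> real" where
  "Lp_norm \<mu> p f =
     (if p = \<infinity> then enn2real (esssup \<mu> (\<lambda>x. ennreal (cmod (f x))))
      else (LINT x|\<mu>. cmod (f x) powr enn2real p) powr (1 / enn2real p))"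

definition ae_class :: "'g measure \<Rightarrow> ('g \<Rightarrow> complex) \<Rightarrow> ('g \<Rightarrow> complex) set" where
  "ae_class \<mu> f = {g \<in> borel_measurable \<mu>. AE x in \<mu>. g x = f x}"

definition rep :: "('g \<Rightarrow> complex) set \<Rightarrow> 'g \<Rightarrow> complex" where
  "rep F = (SOME f. f \<in> F)"

text \<open>
  \<open>L\<^sub>p(G)\<close>, as a space of almost-everywhere classes of functions, with \<open>L\<^sub>1(G)\<close> acting by convolution.
  In particular \<open>Lp \<mu> 1\<close> is the convolution algebra.
\<close>

definition Lp ::
  "'g::topological_ab_group_add measure \<Rightarrow> ennreal \<Rightarrow> (('g \<Rightarrow> complex) set, ('g \<Rightarrow> complex) set) qmodule"
  where
  "Lp \<mu> p =
    \<lparr> carrier = ae_class \<mu> ` Lp_functions \<mu> p,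
      vadd = (\<lambda>F H. ae_class \<mu> (\<lambda>x. rep F x + rep H x)),
      vscale = (\<lambda>t F. ae_class \<mu> (\<lambda>x. t * rep F x)),
      qnorm = (\<lambda>F. Lp_norm \<mu> p (rep F)),
      act = (\<lambda>a F. ae_class \<mu> (convolution \<mu> (rep a) (rep F))) \<rparr>"

definition polynomials :: "('g::topological_ab_group_add \<Rightarrow> complex) set" where
  "polynomials = {f. \<exists>J c. finite J \<and> J \<subseteq> dual_group \<and> f = (\<lambda>x. \<Sum>\<gamma>\<in>J. c \<gamma> * \<gamma> x)}"

text \<open>
  Polynomials are kept as genuine functions; the convolution below does not depend on the
  representative of \<open>a\<close>.
\<close>

definition Lp0 ::
  "'g::topological_ab_group_add measure \<Rightarrow> ennreal \<Rightarrow> (('g \<Rightarrow> complex) set, 'g \<Rightarrow> complex) qmodule"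
  where
  "Lp0 \<mu> p =
    \<lparr> carrier = polynomials,
      vadd = (\<lambda>f h x. f x + h x),
      vscale = (\<lambda>t f x. t * f x),
      qnorm = Lp_norm \<mu> p,
      act = (\<lambda>a f. convolution \<mu> (rep a) f) \<rparr>"


section \<open>Sequence spaces on a set of characters\<close>

text \<open>
  Functions on \<open>\<Sigma>\<close> are encoded as functions on the ambient type that vanish off \<open>\<Sigma>\<close>.
  In \<open>linf\<close> the supremum over the whole type thus equals the one over \<open>\<Sigma>\<close>, and is \<open>0\<close> for empty \<open>\<Sigma>\<close>.
\<close>

definition functions_on :: "'s set \<Rightarrow> ('s \<Rightarrow> complex) set" where
  "functions_on \<Sigma> = {c. \<forall>\<gamma>. \<gamma> \<notin> \<Sigma> \<longrightarrow> c \<gamma> = 0}"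

definition restrict_to :: "'s set \<Rightarrow> ('s \<Rightarrow> complex) \<Rightarrow> 's \<Rightarrow> complex" where
  "restrict_to \<Sigma> c = (\<lambda>\<gamma>. if \<gamma> \<in> \<Sigma> then c \<gamma> else 0)"

definition linf :: "'s set \<Rightarrow> ('s \<Rightarrow> complex, 's \<Rightarrow> complex) qmodule" where
  "linf \<Sigma> =
    \<lparr> carrier = {c \<in> functions_on \<Sigma>. bounded (range c)},
      vadd = (\<lambda>c d \<gamma>. c \<gamma> + d \<gamma>),
      vscale = (\<lambda>t c \<gamma>. t * c \<gamma>),
      qnorm = (\<lambda>c. SUP \<gamma>. cmod (c \<gamma>)),
      act = (\<lambda>a c \<gamma>. a \<gamma> * c \<gamma>) \<rparr>"

definition l2 :: "'s set \<Rightarrow> ('s \<Rightarrow> complex, 's \<Rightarrow> complex) qmodule" where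
  "l2 \<Sigma> =
    \<lparr> carrier = {c \<in> functions_on \<Sigma>. (\<lambda>\<gamma>. (cmod (c \<gamma>))\<^sup>2) summable_on \<Sigma>},
      vadd = (\<lambda>c d \<gamma>. c \<gamma> + d \<gamma>),
      vscale = (\<lambda>t c \<gamma>. t * c \<gamma>),
      qnorm = (\<lambda>c. sqrt (\<Sum>\<^sub>\<infinity>\<gamma>\<in>\<Sigma>. (cmod (c \<gamma>))\<^sup>2)),
      act = (\<lambda>a c \<gamma>. a \<gamma> * c \<gamma>) \<rparr>"

definition l2_0 :: "'s set \<Rightarrow> ('s \<Rightarrow> complex, 's \<Rightarrow> complex) qmodule" where
  "l2_0 \<Sigma> = (l2 \<Sigma>) \<lparr> carrier := {c \<in> functions_on \<Sigma>. finite {\<gamma>. c \<gamma> \<noteq> 0}} \<rparr>"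

definition c0 :: "'s set \<Rightarrow> ('s \<Rightarrow> complex) set" where
  "c0 \<Sigma> = {c \<in> functions_on \<Sigma>. \<forall>\<epsilon>>0. finite {\<gamma>. \<epsilon> \<le> cmod (c \<gamma>)}}"


section \<open>Sidon sets and the map induced by a centralizer\<close>

definition sidon_set ::
  "'g::topological_ab_group_add measure \<Rightarrow> ('g \<Rightarrow> complex) set \<Rightarrow> bool" where
  "sidon_set \<mu> \<Sigma> \<longleftrightarrow>
     \<Sigma> \<subseteq> dual_group \<and>
     (\<forall>c\<in>c0 \<Sigma>. \<exists>f\<in>Lp_functions \<mu> 1. c = restrict_to \<Sigma> (fourier \<mu> f))"

text \<open>
  The unordered sum of \<open>c(\<gamma>) \<gamma>\<close> in \<open>L\<^sub>q(G)\<close>: the set of all functions that are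
  \<open>L\<^sub>q\<close>-limits of the net of finite partial sums. If the sum converges this is its
  almost-everywhere class; otherwise it is empty, which is not an element of \<open>L\<^sub>q(G)\<close>.
\<close>

definition summation ::
  "'g measure \<Rightarrow> ennreal \<Rightarrow> ('g \<Rightarrow> complex) set \<Rightarrow> (('g \<Rightarrow> complex) \<Rightarrow> complex) \<Rightarrow> ('g \<Rightarrow> complex) set"
  where
  "summation \<mu> q \<Sigma> c =
     {f \<in> Lp_functions \<mu> q.
        ((\<lambda>J. Lp_norm \<mu> q (\<lambda>x. f x - (\<Sum>\<gamma>\<in>J. c \<gamma> * \<gamma> x))) \<longlongrightarrow> 0) (finite_subsets_at_top \<Sigma>)}"

definition mho ::
  "'g measure \<Rightarrow> ennreal \<Rightarrow> ('g \<Rightarrow> complex) set \<Rightarrow>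
   ((('g \<Rightarrow> complex) \<Rightarrow> complex) \<Rightarrow> (('g \<Rightarrow> complex) \<Rightarrow> complex)) \<Rightarrow>
   ('g \<Rightarrow> complex) \<Rightarrow> ('g \<Rightarrow> complex) set" where
  "mho \<mu> q \<Sigma> \<Omega> f = summation \<mu> q \<Sigma> (\<Omega> (restrict_to \<Sigma> (fourier \<mu> f)))"

end

theory Submission
  imports Defs "HOL-Probability.Probability_Measure"
begin

text \<open>
  A Sidon set is a \<open>\<Lambda>(q)\<close>-set for all \<open>q < \<infinity>\<close> (Rudin), so \<open>S\<close> is bounded from \<open>\<ell>\<^sub>2(\<Sigma>)\<close> to \<open>L\<^sub>q\<close> and bounded
  below even for the \<open>L\<^sub>1\<close>-norm, and by duality taking Fourier coefficients on \<open>\<Sigma>\<close> is bounded from \<open>L\<^sub>p\<close> to \<open>\<ell>\<^sub>2(\<Sigma>)\<close>;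
  as \<open>S\<close> intertwines convolution with multiplication by Fourier coefficients, the centralizer
  estimates carry over from \<open>\<Omega>\<close>.

  If a morphism \<open>\<phi>\<close> is close to the induced map, it is a Fourier multiplier with some symbol \<open>m\<close>.
  Testing on single characters bounds \<open>m\<close> off \<open>\<Sigma>\<close>, where the induced map vanishes, so on a polynomial \<open>f\<close> with
  \<open>|f| \<le> L\<close> the part of \<open>\<phi> f\<close> off \<open>\<Sigma>\<close> has \<open>L\<^sub>2\<close>-norm \<open>O(L)\<close>. Hence \<open>\<Omega> c - m c = O(L)\<close> in \<open>\<ell>\<^sub>2\<close> for the
  coefficients \<open>c\<close> of \<open>f\<close> on \<open>\<Sigma>\<close>. Every finitely supported \<open>c\<close> agrees, up to \<open>\<ell>\<^sub>2\<close>-error \<open>\<parallel>c\<parallel>/2\<close>, with the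
  coefficients of a polynomial bounded by a multiple of \<open>\<parallel>c\<parallel>\<close>, and iterating this shows that \<open>\<Omega>\<close> is within bounded
  distance of the morphism \<open>c \<mapsto> m c\<close>. This covers even the extreme case \<open>p = \<infinity>\<close>, \<open>q = 1\<close>.
\<close>

section \<open>Invariance of Haar measure under reflection\<close>

text \<open>Two obstacles shape the proof. First, G is only compact Hausdorff, and addition need not
  be measurable for the product of the Borel sigma-algebras. Fubini is therefore used only for
  functions F with F(x - y) known to be jointly measurable: polynomials, because characters separate
  the variables, and one well-chosen representative of each sum S(c). Passing to other
  representatives requires that y -> x - y preserve null sets, while the measure is only given as
  regular and translation invariant; this is why reflection invariance has to be proved.

  Second, \<Omega> carries no continuity assumption, so nothing can be gained from limits in its
  argument. The distance from \<Omega> to the multiplier is bounded on each finite support by a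
  constant that may grow with the support. Truncation replaces such a constant b by W + b/2, where W
  does not see the support, and iteration drives the bound to the fixed point 2W.\<close>

lemma compact_add_nbhd:
  fixes K U :: "'g::topological_ab_group_add set"
  assumes K: "compact K" and U: "open U" and KU: "K \<subseteq> U"
  shows "\<exists>W. open W \<and> 0 \<in> W \<and> (\<forall>k\<in>K. \<forall>w\<in>W. k + w \<in> U)"
proof -
  have "\<exists>V W. open V \<and> k \<in> V \<and> open W \<and> 0 \<in> W \<and> (\<forall>v\<in>V. \<forall>w\<in>W. v + w \<in> U)" if "k \<in> K" for k
  proof -
    have "(\<forall>\<^sub>F z in nhds k \<times>\<^sub>F nhds 0. fst z + snd z \<in> U)"
      using tendsto_add_Pair[of k "0::'g"] U KU that
      by (auto simp: filterlim_def le_filter_def tendsto_def eventually_filtermap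
          intro: eventually_nhds_in_open)
    then obtain P Q where "eventually P (nhds k)" "eventually Q (nhds 0)"
      "\<And>x y. P x \<Longrightarrow> Q y \<Longrightarrow> x + y \<in> U"
      unfolding eventually_prod_filter by auto
    then show ?thesis unfolding eventually_nhds by meson
  qed
  then obtain V W where VW: "\<And>k. k \<in> K \<Longrightarrow> open (V k) \<and> k \<in> V k \<and> open (W k) \<and> (0::'g) \<in> W k \<and>
     (\<forall>v\<in>V k. \<forall>w\<in>W k. v + w \<in> U)"
    by metis
  obtain D where D: "D \<subseteq> K" "finite D" "K \<subseteq> (\<Union>k\<in>D. V k)"
    using compactE_image[OF K, of K V] VW by blast
  have "open (\<Inter>k\<in>D. W k)" using D VW by (intro open_INT) auto
  moreover have "0 \<in> (\<Inter>k\<in>D. W k)" using D VW by auto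
  moreover have "\<forall>k\<in>K. \<forall>w\<in>(\<Inter>k\<in>D. W k). k + w \<in> U" using D VW by blast
  ultimately show ?thesis by blast
qed

locale compact_haar =
  fixes \<mu> :: "'g::{topological_ab_group_add, t2_space} measure"
  assumes compact_UNIV: "compact (UNIV :: 'g set)" and haar: "normalized_haar \<mu>"
begin

lemma sets_haar [measurable_cong, simp]: "sets \<mu> = sets borel"
  using haar by (simp add: normalized_haar_def)

lemma space_haar [simp]: "space \<mu> = UNIV"
  using sets_eq_imp_space_eq[OF sets_haar] by simp

sublocale prob_space \<mu>
  using haar by (intro prob_spaceI) (simp add: normalized_haar_def)

lemma measurable_translation [measurable]: "(\<lambda>x. a + x) \<in> borel_measurable (borel :: 'g measure)"
  by (intro borel_measurable_continuous_onI continuous_intros)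

lemma measurable_reflection [measurable]: "uminus \<in> borel_measurable (borel :: 'g measure)"
  by (intro borel_measurable_continuous_onI continuous_intros)

lemma measurable_reflection_translation [measurable]:
  "(\<lambda>x. a - x) \<in> borel_measurable (borel :: 'g measure)"
  by (intro borel_measurable_continuous_onI continuous_intros)

lemma distr_translation: "distr \<mu> borel (\<lambda>x. a + x) = \<mu>"
  using haar by (simp add: normalized_haar_def)

lemma emeasure_translation:
  assumes "B \<in> sets borel" shows "emeasure \<mu> ((\<lambda>x. a + x) -` B) = emeasure \<mu> B"
proof -
  have "emeasure \<mu> B = emeasure (distr \<mu> borel (\<lambda>x. a + x)) B" by (simp add: distr_translation)
  also have "\<dots> = emeasure \<mu> ((\<lambda>x. a + x) -` B)" using assms by (subst emeasure_distr) auto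
  finally show ?thesis by simp
qed

text \<open>Fubini's theorem for the indicator of \<open>K\<close> would give this directly, but addition need not be
  measurable for the product of the Borel \<open>\<sigma>\<close>-algebras; averaging over the finitely many pieces of a
  fine partition replaces it.\<close>

lemma emeasure_compact_le_reflected_open:
  assumes K: "compact K" and U: "open U" and KU: "K \<subseteq> U"
  shows "emeasure \<mu> K \<le> emeasure \<mu> (uminus -` U)"
proof -
  define N where "N = distr \<mu> borel uminus"
  have [simp]: "sets N = sets borel" "space N = UNIV" by (auto simp: N_def)
  interpret N: prob_space N unfolding N_def by (intro prob_space_distr) simp
  have N: "emeasure N B = emeasure \<mu> (uminus -` B)" if "B \<in> sets borel" for B
    unfolding N_def using that by (subst emeasure_distr) auto
  obtain W where W: "open W" "0 \<in> W" "\<And>k w. k \<in> K \<Longrightarrow> w \<in> W \<Longrightarrow> k + w \<in> U"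
    using compact_add_nbhd[OF K U KU] by metis
  \<comment> \<open>V x is the translate x + W. Finitely many translates cover the compact group,
    and \<open>disjointed\<close> turns the cover into a Borel partition.\<close>
  define V where "V x = (\<lambda>z. z - x) -` W" for x
  have oV: "open (V x)" for x
    unfolding V_def by (intro open_vimage W continuous_intros)
  have cov: "UNIV \<subseteq> (\<Union>x\<in>UNIV. V x)" using W(2) by (auto simp: V_def)
  obtain D where D: "finite D" "UNIV \<subseteq> (\<Union>x\<in>D. V x)"
    by (rule compactE_image[OF compact_UNIV oV cov]) auto
  obtain xs where xs: "set xs = D" using D(1) finite_list by blast
  define n where "n = length xs"
  define A where "A i = (if i < n then V (xs ! i) else {})" for i
  define B where "B = disjointed A"
  have "UNIV = (\<Union>i. A i)"
  proof (intro equalityI subsetI)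
    fix z :: 'g
    obtain x where "x \<in> D" "z \<in> V x" using D by auto
    then obtain i where "i < n" "xs ! i = x" using xs by (metis in_set_conv_nth n_def)
    then show "z \<in> (\<Union>i. A i)" using \<open>z \<in> V x\<close> by (auto simp: A_def intro!: exI[of _ i])
  qed auto
  then have UNB: "(\<Union>i. B i) = UNIV" by (simp add: B_def UN_disjointed_eq)
  have BA: "B i \<subseteq> A i" for i unfolding B_def by (rule disjointed_subset)
  have B0: "B i = {}" if "i \<ge> n" for i using BA[of i] that by (auto simp: A_def)
  have A_sets: "A i \<in> sets borel" for i using oV by (auto simp: A_def)
  have B_sets [measurable]: "B i \<in> sets borel" for i
    unfolding B_def disjointed_def using A_sets by auto
  have disj: "disjoint_family B" unfolding B_def by (rule disjoint_family_disjointed)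
  have K_sets [measurable]: "K \<in> sets borel" by (intro borel_closed compact_imp_closed K)
  have U_sets [measurable]: "U \<in> sets borel" using U by auto
  have UB: "(\<Union>i<n. B i) = UNIV"
  proof -
    have "(\<Union>i. B i) \<subseteq> (\<Union>i<n. B i)"
    proof
      fix z assume "z \<in> (\<Union>i. B i)"
      then obtain i where i: "z \<in> B i" by auto
      then have "i < n" using B0[of i] by (cases "i < n") auto
      then show "z \<in> (\<Union>i<n. B i)" using i by auto
    qed
    then show ?thesis using UNB by auto
  qed
  have "(\<Sum>i<n. emeasure N (B i)) = emeasure N (\<Union>i<n. B i)"
    by (intro sum_emeasure disjoint_family_on_mono[OF _ disj]) auto
  then have sum1: "(\<Sum>i<n. emeasure N (B i)) = 1"
    using N.emeasure_space_1 UB by simp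
  have trans: "emeasure \<mu> K = (\<integral>\<^sup>+y. indicator K (xs ! i + y) \<partial>\<mu>)" for i
  proof -
    have "(\<integral>\<^sup>+y. indicator K (xs ! i + y) \<partial>\<mu>) = (\<integral>\<^sup>+y. indicator ((\<lambda>y. xs ! i + y) -` K) y \<partial>\<mu>)"
      by (intro nn_integral_cong) (auto simp: indicator_def)
    also have "\<dots> = emeasure \<mu> ((\<lambda>y. xs ! i + y) -` K)"
      by (subst nn_integral_indicator)
         (use measurable_sets[OF measurable_translation[of "xs ! i"] K_sets] in auto)
    finally show ?thesis by (simp add: emeasure_translation)
  qed
  have meas: "(\<lambda>y. indicator K (a + y) :: ennreal) \<in> borel_measurable \<mu>" for a
    using measurable_compose[OF measurable_translation[of a] borel_measurable_indicator[OF K_sets]]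
    by simp
  \<comment> \<open>If x_i + y lies in K and z in B i, then z - x_i lies in W, so y + z lies in U.
    The pieces that count for y therefore all sit in the translate of U by -y, and they are
    disjoint. For the reflected measure N this translate weighs as much as U.\<close>
  have pt: "(\<Sum>i<n. emeasure N (B i) * indicator K (xs ! i + y)) \<le> emeasure N U" for y
  proof -
    define I where "I = {i. i < n \<and> xs ! i + y \<in> K}"
    have "(\<Sum>i<n. emeasure N (B i) * indicator K (xs ! i + y)) = (\<Sum>i\<in>I. emeasure N (B i))"
      unfolding I_def by (intro sum.mono_neutral_cong_right) (auto simp: indicator_def)
    also have "\<dots> = emeasure N (\<Union>i\<in>I. B i)"
      by (intro sum_emeasure disjoint_family_on_mono[OF _ disj]) (auto simp: I_def)
    also have "\<dots> \<le> emeasure N ((\<lambda>z. y + z) -` U)"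
    proof (rule emeasure_mono)
      show "(\<Union>i\<in>I. B i) \<subseteq> (\<lambda>z. y + z) -` U"
      proof safe
        fix i z assume i: "i \<in> I" and z: "z \<in> B i"
        then have "z - xs ! i \<in> W" using BA[of i] by (auto simp: I_def A_def V_def)
        then have "(xs ! i + y) + (z - xs ! i) \<in> U" using i by (intro W(3)) (auto simp: I_def)
        then show "z \<in> (\<lambda>z. y + z) -` U" by (simp add: algebra_simps)
      qed
      show "(\<lambda>z. y + z) -` U \<in> sets N"
        using measurable_sets[OF measurable_translation[of y] U_sets] by simp
    qed
    also have "\<dots> = emeasure \<mu> (uminus -` ((\<lambda>z. y + z) -` U))"
      using measurable_sets[OF measurable_translation[of y] U_sets] by (subst N) auto
    also have "uminus -` ((\<lambda>z. y + z) -` U) = (\<lambda>z. - y + z) -` (uminus -` U)"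
      by (auto simp: algebra_simps)
    also have "emeasure \<mu> \<dots> = emeasure \<mu> (uminus -` U)"
      using measurable_sets[OF measurable_reflection U_sets] by (intro emeasure_translation) auto
    finally show ?thesis by (simp add: N)
  qed
  \<comment> \<open>The weights N(B i) sum to 1, so \<mu>(K) is the weighted average of the measures
    of its translates. Exchanging the finite sum with the integral allows the bound
    \<open>pt\<close> to be applied for each y.\<close>
  have "emeasure \<mu> K = (\<Sum>i<n. emeasure N (B i)) * emeasure \<mu> K" using sum1 by simp
  also have "\<dots> = (\<Sum>i<n. emeasure N (B i) * emeasure \<mu> K)" by (simp add: sum_distrib_right)
  also have "\<dots> = (\<Sum>i<n. \<integral>\<^sup>+y. emeasure N (B i) * indicator K (xs ! i + y) \<partial>\<mu>)"
  proof (intro sum.cong refl)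
    fix i
    show "emeasure N (B i) * emeasure \<mu> K = (\<integral>\<^sup>+y. emeasure N (B i) * indicator K (xs ! i + y) \<partial>\<mu>)"
      unfolding trans[of i] by (rule nn_integral_cmult[OF meas, symmetric])
  qed
  also have "\<dots> = (\<integral>\<^sup>+y. (\<Sum>i<n. emeasure N (B i) * indicator K (xs ! i + y)) \<partial>\<mu>)"
    by (intro nn_integral_sum[symmetric] borel_measurable_times meas) auto
  also have "\<dots> \<le> (\<integral>\<^sup>+y. emeasure N U \<partial>\<mu>)"
    by (intro nn_integral_mono pt)
  also have "\<dots> = emeasure N U" using emeasure_space_1 by simp
  finally show ?thesis by (simp add: N)
qed

text \<open>Inner regularity reduces B to a compact K, and outer regularity computes the measure of
  -K from open U containing -K. For such U the set -U is open and contains K, so the preceding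
  estimate compares K with -(-U) = U.\<close>

lemma emeasure_le_reflected:
  assumes B: "B \<in> sets borel" shows "emeasure \<mu> B \<le> emeasure \<mu> (uminus -` B)"
proof -
  have "\<forall>B\<in>sets borel. emeasure \<mu> B = (SUP K\<in>{K. compact K \<and> K \<subseteq> B}. emeasure \<mu> K)"
    using haar[unfolded normalized_haar_def] by (elim conjE)
  then have inner: "emeasure \<mu> B = (SUP K\<in>{K. compact K \<and> K \<subseteq> B}. emeasure \<mu> K)"
    using B by (rule bspec)
  have "\<forall>B\<in>sets borel. emeasure \<mu> B = (INF U\<in>{U. open U \<and> B \<subseteq> U}. emeasure \<mu> U)"
    using haar[unfolded normalized_haar_def] by (elim conjE)
  note outer = bspec[OF this]
  have refl_sets: "uminus -` C \<in> sets borel" if "C \<in> sets borel" for C :: "'g set"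
    using measurable_sets[OF measurable_reflection that] by simp
  have "emeasure \<mu> K \<le> emeasure \<mu> (uminus -` B)" if K: "compact K" "K \<subseteq> B" for K
  proof -
    have Ks: "K \<in> sets borel" by (intro borel_closed compact_imp_closed K(1))
    have "emeasure \<mu> K \<le> (INF U\<in>{U. open U \<and> uminus -` K \<subseteq> U}. emeasure \<mu> U)"
    proof (rule INF_greatest)
      fix U assume U: "U \<in> {U. open U \<and> uminus -` K \<subseteq> U}"
      have "open (uminus -` U)" using U by (intro open_vimage continuous_intros) auto
      moreover have "- k \<in> U" if "k \<in> K" for k using U that subsetD[of "uminus -` K" U "- k"] by simp
      then have "K \<subseteq> uminus -` U" by auto
      moreover have "uminus -` (uminus -` U) = U" by auto
      ultimately show "emeasure \<mu> K \<le> emeasure \<mu> U"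
        using emeasure_compact_le_reflected_open[OF K(1), of "uminus -` U"] by simp
    qed
    also have "\<dots> = emeasure \<mu> (uminus -` K)" using outer[OF refl_sets[OF Ks]] by simp
    also have "\<dots> \<le> emeasure \<mu> (uminus -` B)" using K B refl_sets by (intro emeasure_mono) auto
    finally show ?thesis .
  qed
  then show ?thesis unfolding inner by (intro SUP_least) auto
qed

text \<open>The inequality applied to both B and -B is an equality.\<close>

lemma distr_reflection: "distr \<mu> borel uminus = \<mu>"
proof (rule measure_eqI)
  fix B assume "B \<in> sets (distr \<mu> borel uminus)"
  then have B: "B \<in> sets borel" by simp
  have B': "uminus -` B \<in> sets borel"
    using measurable_sets[OF measurable_reflection B] by simp
  have "uminus -` (uminus -` B) = B" by auto
  then have "emeasure \<mu> (uminus -` B) = emeasure \<mu> B"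
    using emeasure_le_reflected[OF B] emeasure_le_reflected[OF B'] by (simp add: antisym)
  then show "emeasure (distr \<mu> borel uminus) B = emeasure \<mu> B"
    using B by (subst emeasure_distr) auto
qed simp

lemma distr_reflection_translation: "distr \<mu> borel (\<lambda>x. a - x) = \<mu>"
proof -
  have "distr \<mu> borel (\<lambda>x. a - x) = distr (distr \<mu> borel uminus) borel (\<lambda>x. a + x)"
    by (subst distr_distr) (auto simp: comp_def)
  then show ?thesis by (simp add: distr_reflection distr_translation)
qed

lemma nn_integral_translation:
  assumes [measurable]: "f \<in> borel_measurable borel"
  shows "(\<integral>\<^sup>+x. f (a + x) \<partial>\<mu>) = (\<integral>\<^sup>+x. f x \<partial>\<mu>)"
proof -
  have "(\<integral>\<^sup>+x. f x \<partial>\<mu>) = (\<integral>\<^sup>+x. f x \<partial>distr \<mu> borel (\<lambda>x. a + x))" by (simp add: distr_translation)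
  also have "\<dots> = (\<integral>\<^sup>+x. f (a + x) \<partial>\<mu>)" by (subst nn_integral_distr) auto
  finally show ?thesis by simp
qed

lemma integral_translation:
  fixes f :: "'g \<Rightarrow> complex" assumes [measurable]: "f \<in> borel_measurable borel"
  shows "(LINT x|\<mu>. f (a + x)) = (LINT x|\<mu>. f x)"
proof -
  have "(LINT x|\<mu>. f x) = (LINT x|distr \<mu> borel (\<lambda>x. a + x). f x)" by (simp add: distr_translation)
  also have "\<dots> = (LINT x|\<mu>. f (a + x))" by (subst integral_distr) auto
  finally show ?thesis by simp
qed

lemma integral_reflection_translation:
  fixes f :: "'g \<Rightarrow> complex" assumes [measurable]: "f \<in> borel_measurable borel"
  shows "(LINT x|\<mu>. f (a - x)) = (LINT x|\<mu>. f x)"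
proof -
  have "(LINT x|\<mu>. f x) = (LINT x|distr \<mu> borel (\<lambda>x. a - x). f x)"
    by (simp add: distr_reflection_translation)
  also have "\<dots> = (LINT x|\<mu>. f (a - x))" by (subst integral_distr) auto
  finally show ?thesis by simp
qed

text \<open>Makes convolution independent of the representative of its second factor.\<close>

lemma AE_reflection_translation:
  assumes "AE x in \<mu>. P x" and [measurable]: "Measurable.pred borel P"
  shows "AE x in \<mu>. P (a - x)"
proof -
  have "AE x in distr \<mu> borel (\<lambda>x. a - x). P x" unfolding distr_reflection_translation by (rule assms(1))
  then show ?thesis by (subst (asm) AE_distr_iff) auto
qed

end

section \<open>Characters and trigonometric polynomials\<close>

definition trig_poly :: "('g \<Rightarrow> complex) set \<Rightarrow> (('g \<Rightarrow> complex) \<Rightarrow> complex) \<Rightarrow> 'g \<Rightarrow> complex" where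
  "trig_poly J c x = (\<Sum>\<gamma>\<in>J. c \<gamma> * \<gamma> x)"

lemma character_norm: "\<gamma> \<in> dual_group \<Longrightarrow> cmod (\<gamma> x) = 1"
  by (simp add: dual_group_def)

lemma character_add: "\<gamma> \<in> dual_group \<Longrightarrow> \<gamma> (x + y) = \<gamma> x * \<gamma> y"
  by (simp add: dual_group_def)

lemma character_mult_cnj: "\<gamma> \<in> dual_group \<Longrightarrow> \<gamma> x * cnj (\<gamma> x) = 1"
  using complex_norm_square[of "\<gamma> x"] by (simp add: character_norm)

lemma character_diff:
  assumes "\<gamma> \<in> dual_group" shows "\<gamma> (x - y) = \<gamma> x * cnj (\<gamma> y)"
proof -
  have "\<gamma> (x - y + y) = \<gamma> (x - y) * \<gamma> y"
    by (rule character_add[OF assms])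
  then have "\<gamma> (x - y) * \<gamma> y = \<gamma> x" by simp
  then have "\<gamma> x * cnj (\<gamma> y) = \<gamma> (x - y) * (\<gamma> y * cnj (\<gamma> y))" by (simp add: mult.assoc)
  then show ?thesis using character_mult_cnj[OF assms] by simp
qed

lemma character_measurable:
  "\<gamma> \<in> dual_group \<Longrightarrow> \<gamma> \<in> borel_measurable borel"
  by (intro borel_measurable_continuous_onI) (simp add: dual_group_def)

lemma character_one: "(\<lambda>x. 1) \<in> dual_group"
  by (auto simp: dual_group_def)

lemma character_mult:
  "\<gamma> \<in> dual_group \<Longrightarrow> \<delta> \<in> dual_group \<Longrightarrow> (\<lambda>x. \<gamma> x * \<delta> x) \<in> dual_group"
  by (auto simp: dual_group_def norm_mult intro!: continuous_intros)

lemma character_cnj: "\<gamma> \<in> dual_group \<Longrightarrow> (\<lambda>x. cnj (\<gamma> x)) \<in> dual_group"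
  by (auto simp: dual_group_def intro!: continuous_intros)

lemma trig_poly_measurable:
  assumes "J \<subseteq> dual_group" shows "trig_poly J c \<in> borel_measurable borel"
  unfolding trig_poly_def[abs_def]
  by (intro borel_measurable_sum borel_measurable_times borel_measurable_const character_measurable)
     (use assms in auto)

lemma trig_poly_bound:
  assumes "J \<subseteq> dual_group" shows "cmod (trig_poly J c x) \<le> (\<Sum>\<gamma>\<in>J. cmod (c \<gamma>))"
proof -
  have "cmod (trig_poly J c x) \<le> (\<Sum>\<gamma>\<in>J. cmod (c \<gamma> * \<gamma> x))"
    unfolding trig_poly_def by (rule norm_sum)
  also have "\<dots> = (\<Sum>\<gamma>\<in>J. cmod (c \<gamma>))"
    using assms by (intro sum.cong) (auto simp: norm_mult character_norm)
  finally show ?thesis .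
qed

lemma trig_poly_diff_translation:
  assumes "J \<subseteq> dual_group" shows "trig_poly J c (x - y) = (\<Sum>\<gamma>\<in>J. c \<gamma> * \<gamma> x * cnj (\<gamma> y))"
  unfolding trig_poly_def using assms by (intro sum.cong) (auto simp: character_diff mult.assoc)

lemma trig_poly_add: "trig_poly J c x + trig_poly J d x = trig_poly J (\<lambda>\<gamma>. c \<gamma> + d \<gamma>) x"
  by (simp add: trig_poly_def sum.distrib algebra_simps)

lemma trig_poly_scale: "t * trig_poly J c x = trig_poly J (\<lambda>\<gamma>. t * c \<gamma>) x"
  by (simp add: trig_poly_def sum_distrib_left algebra_simps)

lemma trig_poly_mono:
  assumes "finite K" "J \<subseteq> K" "\<And>\<gamma>. \<gamma> \<in> K - J \<Longrightarrow> c \<gamma> = 0"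
  shows "trig_poly J c = trig_poly K c"
  unfolding trig_poly_def by (intro ext sum.mono_neutral_left) (use assms in auto)

lemma trig_poly_cong:
  assumes "\<And>\<gamma>. \<gamma> \<in> J \<Longrightarrow> c \<gamma> = d \<gamma>"
  shows "trig_poly J c = trig_poly J d"
  unfolding trig_poly_def by (intro ext sum.cong) (use assms in auto)

lemma polynomials_eq: "polynomials = {f. \<exists>J c. finite J \<and> J \<subseteq> dual_group \<and> f = trig_poly J c}"
  by (auto simp: polynomials_def trig_poly_def[abs_def])

lemma polynomials_trig_poly: "finite J \<Longrightarrow> J \<subseteq> dual_group \<Longrightarrow> trig_poly J c \<in> polynomials"
  by (auto simp: polynomials_eq)

lemma polynomials_add:
  assumes "f \<in> polynomials" "g \<in> polynomials" shows "(\<lambda>x. f x + g x) \<in> polynomials"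
proof -
  obtain J c K d where *: "finite J" "J \<subseteq> dual_group" "f = trig_poly J c"
    "finite K" "K \<subseteq> dual_group" "g = trig_poly K d"
    using assms by (auto simp: polynomials_eq)
  let ?c = "\<lambda>\<gamma>. (if \<gamma> \<in> J then c \<gamma> else 0)" and ?d = "\<lambda>\<gamma>. (if \<gamma> \<in> K then d \<gamma> else 0)"
  have "f = trig_poly (J \<union> K) ?c"
    using * trig_poly_mono[of "J \<union> K" J ?c] trig_poly_cong[of J c ?c] by auto
  moreover have "g = trig_poly (J \<union> K) ?d"
    using * trig_poly_mono[of "J \<union> K" K ?d] trig_poly_cong[of K d ?d] by auto
  ultimately have "(\<lambda>x. f x + g x) = trig_poly (J \<union> K) (\<lambda>\<gamma>. ?c \<gamma> + ?d \<gamma>)"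
    by (auto simp: trig_poly_add)
  then show ?thesis using * by (simp add: polynomials_trig_poly)
qed

lemma polynomials_scale:
  assumes "f \<in> polynomials" shows "(\<lambda>x. t * f x) \<in> polynomials"
proof -
  obtain J c where "finite J" "J \<subseteq> dual_group" "f = trig_poly J c"
    using assms by (auto simp: polynomials_eq)
  then show ?thesis by (simp add: trig_poly_scale polynomials_trig_poly)
qed

lemma polynomials_character: "\<gamma> \<in> dual_group \<Longrightarrow> \<gamma> \<in> polynomials"
  using polynomials_trig_poly[of "{\<gamma>}" "\<lambda>_. 1"] by (simp add: trig_poly_def[abs_def])

lemma polynomials_const: "(\<lambda>x. t) \<in> polynomials"
  using polynomials_scale[OF polynomials_character[OF character_one], of t] by simp

lemma polynomials_sum:
  assumes "finite I" "\<And>i. i \<in> I \<Longrightarrow> f i \<in> polynomials"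
  shows "(\<lambda>x. \<Sum>i\<in>I. f i x) \<in> polynomials"
  using assms by (induction I rule: finite_induct) (auto intro: polynomials_add polynomials_const)

lemma polynomials_mult:
  assumes "f \<in> polynomials" "g \<in> polynomials" shows "(\<lambda>x. f x * g x) \<in> polynomials"
proof -
  obtain J c K d where *: "finite J" "J \<subseteq> dual_group" "f = trig_poly J c"
    "finite K" "K \<subseteq> dual_group" "g = trig_poly K d"
    using assms by (auto simp: polynomials_eq)
  have "(\<lambda>x. f x * g x) = (\<lambda>x. \<Sum>\<gamma>\<in>J. \<Sum>\<delta>\<in>K. (c \<gamma> * d \<delta>) * (\<gamma> x * \<delta> x))"
    by (auto simp: * trig_poly_def sum_product algebra_simps)
  also have "\<dots> \<in> polynomials"
    using * by (intro polynomials_sum polynomials_scale polynomials_character character_mult) auto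
  finally show ?thesis .
qed

lemma polynomials_cnj:
  assumes "f \<in> polynomials" shows "(\<lambda>x. cnj (f x)) \<in> polynomials"
proof -
  obtain J c where *: "finite J" "J \<subseteq> dual_group" "f = trig_poly J c"
    using assms by (auto simp: polynomials_eq)
  have "(\<lambda>x. cnj (f x)) = (\<lambda>x. \<Sum>\<gamma>\<in>J. cnj (c \<gamma>) * cnj (\<gamma> x))"
    by (auto simp: * trig_poly_def)
  also have "\<dots> \<in> polynomials"
    using * by (intro polynomials_sum polynomials_scale polynomials_character character_cnj) auto
  finally show ?thesis .
qed

lemma polynomials_power:
  assumes "f \<in> polynomials" shows "(\<lambda>x. f x ^ n) \<in> polynomials"
  by (induction n) (auto intro: polynomials_const polynomials_mult assms)

lemma polynomials_measurable: "f \<in> polynomials \<Longrightarrow> f \<in> borel_measurable borel"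
  by (auto simp: polynomials_eq trig_poly_measurable)

lemma polynomials_bounded: "f \<in> polynomials \<Longrightarrow> \<exists>B>0. \<forall>x. cmod (f x) \<le> B"
proof -
  assume "f \<in> polynomials"
  then obtain J c where *: "finite J" "J \<subseteq> dual_group" "f = trig_poly J c"
    by (auto simp: polynomials_eq)
  then have "cmod (f x) \<le> (\<Sum>\<gamma>\<in>J. cmod (c \<gamma>)) + 1" for x
    using trig_poly_bound[OF *(2), of c x] by simp
  moreover have "(\<Sum>\<gamma>\<in>J. cmod (c \<gamma>)) + 1 > 0" by (simp add: add_nonneg_pos sum_nonneg)
  ultimately show ?thesis by blast
qed

context compact_haar begin

lemma integrable_bounded:
  fixes f :: "'g \<Rightarrow> 'b::{banach, second_countable_topology}"
  assumes "f \<in> borel_measurable borel" "\<And>x. norm (f x) \<le> B" shows "integrable \<mu> f"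
  by (rule integrable_const_bound[of _ B]) (use assms in auto)

lemma polynomials_integrable: "f \<in> polynomials \<Longrightarrow> integrable \<mu> f"
  using polynomials_bounded[of f] polynomials_measurable[of f] integrable_bounded[of f] by blast

lemma polynomials_power_integrable:
  assumes "f \<in> polynomials" shows "integrable \<mu> (\<lambda>x. cmod (f x) ^ n)"
proof -
  obtain M where M: "\<And>x. cmod (f x) \<le> M" using polynomials_bounded[OF assms(1)] by blast
  show ?thesis
    by (rule integrable_bounded[of _ "M ^ n"])
       (use polynomials_measurable[OF assms(1)] power_mono[OF M, of _ n] in auto)
qed

lemma integrable_mult_bounded:
  fixes f :: "'g \<Rightarrow> 'b::{real_normed_field, banach, second_countable_topology}"
  assumes [measurable]: "integrable \<mu> f" "g \<in> borel_measurable borel" and g: "\<And>x. norm (g x) \<le> B"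
  shows "integrable \<mu> (\<lambda>x. f x * g x)"
proof (rule Bochner_Integration.integrable_bound[of \<mu> "\<lambda>x. B * norm (f x)"])
  show "integrable \<mu> (\<lambda>x. B * norm (f x))" using assms by auto
  show "(\<lambda>x. f x * g x) \<in> borel_measurable \<mu>" by measurable
  have "0 \<le> B" using order_trans[OF norm_ge_zero g] .
  then have "norm (f x * g x) \<le> norm (B * norm (f x))" for x
    using mult_right_mono[OF g, of "norm (f x)" x] by (simp add: norm_mult mult.commute)
  then show "AE x in \<mu>. norm (f x * g x) \<le> norm (B * norm (f x))" by simp
qed

lemma integrable_mult_character:
  "integrable \<mu> f \<Longrightarrow> \<gamma> \<in> dual_group \<Longrightarrow> integrable \<mu> (\<lambda>x. f x * \<gamma> x)"
  by (rule integrable_mult_bounded[of _ _ 1]) (auto simp: character_norm character_measurable)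

text \<open>Translating by a point a with \<gamma>(a) different from 1 multiplies the integral by
  \<gamma>(a) without changing it, so it vanishes.\<close>

lemma integral_character:
  assumes "\<gamma> \<in> dual_group" shows "(LINT x|\<mu>. \<gamma> x) = (if \<gamma> = (\<lambda>x. 1) then 1 else 0)"
proof (cases "\<gamma> = (\<lambda>x. 1)")
  case True then show ?thesis using prob_space by simp
next
  case False
  then obtain a where a: "\<gamma> a \<noteq> 1" by auto
  have "(LINT x|\<mu>. \<gamma> x) = (LINT x|\<mu>. \<gamma> (a + x))"
    using integral_translation[OF character_measurable[OF assms]] by simp
  also have "\<dots> = (LINT x|\<mu>. \<gamma> a * \<gamma> x)" using assms by (simp add: dual_group_def)
  also have "\<dots> = \<gamma> a * (LINT x|\<mu>. \<gamma> x)" by simp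
  finally have "(1 - \<gamma> a) * (LINT x|\<mu>. \<gamma> x) = 0" by (simp add: algebra_simps)
  then show ?thesis using a False by simp
qed

lemma character_orthogonality:
  assumes "\<gamma> \<in> dual_group" "\<delta> \<in> dual_group"
  shows "(LINT x|\<mu>. \<gamma> x * cnj (\<delta> x)) = (if \<gamma> = \<delta> then 1 else 0)"
proof -
  have "(\<lambda>x. \<gamma> x * cnj (\<delta> x)) = (\<lambda>x. 1) \<longleftrightarrow> \<gamma> = \<delta>"
  proof
    assume *: "(\<lambda>x. \<gamma> x * cnj (\<delta> x)) = (\<lambda>x. 1)"
    show "\<gamma> = \<delta>"
    proof
      fix x
      have "\<gamma> x * (\<delta> x * cnj (\<delta> x)) = \<delta> x * (\<gamma> x * cnj (\<delta> x))" by (simp add: mult_ac)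
      then show "\<gamma> x = \<delta> x" using fun_cong[OF *, of x] character_mult_cnj[OF assms(2)] by simp
    qed
  qed (auto simp: character_mult_cnj assms)
  then show ?thesis
    using integral_character[OF character_mult[OF assms(1) character_cnj[OF assms(2)]]] by simp
qed

lemma integral_mult_cnj_trig_poly:
  assumes "J \<subseteq> dual_group" "integrable \<mu> f"
  shows "(LINT x|\<mu>. f x * cnj (trig_poly J c x)) = (\<Sum>\<gamma>\<in>J. fourier \<mu> f \<gamma> * cnj (c \<gamma>))"
proof -
  have "(LINT x|\<mu>. f x * cnj (trig_poly J c x)) = (LINT x|\<mu>. (\<Sum>\<gamma>\<in>J. cnj (c \<gamma>) * (f x * cnj (\<gamma> x))))"
    by (simp add: trig_poly_def sum_distrib_left mult_ac)
  also have "\<dots> = (\<Sum>\<gamma>\<in>J. LINT x|\<mu>. cnj (c \<gamma>) * (f x * cnj (\<gamma> x)))"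
    using assms by (intro Bochner_Integration.integral_sum Bochner_Integration.integrable_mult_right integrable_mult_character character_cnj) auto
  finally show ?thesis by (simp add: fourier_def mult.commute)
qed

lemma fourier_trig_poly:
  assumes "finite J" "J \<subseteq> dual_group" "\<gamma> \<in> dual_group"
  shows "fourier \<mu> (trig_poly J c) \<gamma> = (if \<gamma> \<in> J then c \<gamma> else 0)"
proof -
  have "fourier \<mu> (trig_poly J c) \<gamma> = (LINT x|\<mu>. (\<Sum>\<delta>\<in>J. c \<delta> * (\<delta> x * cnj (\<gamma> x))))"
    by (simp add: fourier_def trig_poly_def sum_distrib_right mult.assoc)
  also have "\<dots> = (\<Sum>\<delta>\<in>J. LINT x|\<mu>. c \<delta> * (\<delta> x * cnj (\<gamma> x)))"
    using assms by (intro Bochner_Integration.integral_sum Bochner_Integration.integrable_mult_right integrable_mult_character character_cnj polynomials_integrable polynomials_character) auto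
  also have "\<dots> = (\<Sum>\<delta>\<in>J. c \<delta> * (if \<delta> = \<gamma> then 1 else 0))"
    using assms by (intro sum.cong) (auto simp: character_orthogonality)
  also have "\<dots> = (if \<gamma> \<in> J then c \<gamma> else 0)"
    using assms by (simp add: sum.delta if_distrib cong: if_cong)
  finally show ?thesis .
qed

lemma parseval_trig_poly:
  assumes "finite J" "J \<subseteq> dual_group"
  shows "(LINT x|\<mu>. (cmod (trig_poly J c x))\<^sup>2) = (\<Sum>\<gamma>\<in>J. (cmod (c \<gamma>))\<^sup>2)"
proof -
  have "complex_of_real (LINT x|\<mu>. (cmod (trig_poly J c x))\<^sup>2) =
        (LINT x|\<mu>. trig_poly J c x * cnj (trig_poly J c x))"
    by (subst integral_complex_of_real[symmetric]) (simp only: complex_norm_square)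
  also have "\<dots> = (\<Sum>\<gamma>\<in>J. c \<gamma> * cnj (c \<gamma>))"
    using assms by (subst integral_mult_cnj_trig_poly)
      (auto intro!: sum.cong polynomials_integrable polynomials_trig_poly simp: fourier_trig_poly subset_iff)
  also have "\<dots> = complex_of_real (\<Sum>\<gamma>\<in>J. (cmod (c \<gamma>))\<^sup>2)"
    by (simp only: of_real_sum complex_norm_square)
  finally show ?thesis using of_real_eq_iff by blast
qed

lemma norm_fourier_le:
  assumes "\<gamma> \<in> dual_group"
  shows "cmod (fourier \<mu> f \<gamma>) \<le> (LINT x|\<mu>. cmod (f x))"
proof -
  have "cmod (fourier \<mu> f \<gamma>) \<le> (LINT x|\<mu>. cmod (f x * cnj (\<gamma> x)))"
    unfolding fourier_def by (rule integral_norm_bound)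
  then show ?thesis using assms by (simp add: norm_mult character_norm)
qed

lemma fourier_add:
  assumes "integrable \<mu> f" "integrable \<mu> g" "\<gamma> \<in> dual_group"
  shows "fourier \<mu> (\<lambda>x. f x + g x) \<gamma> = fourier \<mu> f \<gamma> + fourier \<mu> g \<gamma>"
  using assms integrable_mult_character[OF _ character_cnj]
  by (simp add: fourier_def distrib_right)

lemma fourier_scale: "fourier \<mu> (\<lambda>x. t * f x) \<gamma> = t * fourier \<mu> f \<gamma>"
  by (simp add: fourier_def mult.assoc)

lemma polynomial_expansion:
  assumes "f \<in> polynomials"
  obtains J where "finite J" "J \<subseteq> dual_group" "f = trig_poly J (fourier \<mu> f)"
    "\<And>\<gamma>. \<gamma> \<in> dual_group - J \<Longrightarrow> fourier \<mu> f \<gamma> = 0"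
proof -
  obtain J c where *: "finite J" "J \<subseteq> dual_group" "f = trig_poly J c"
    using assms by (auto simp: polynomials_eq)
  have "f = trig_poly J (fourier \<mu> f)"
    unfolding *(3) by (rule trig_poly_cong) (use * in \<open>auto simp: fourier_trig_poly subset_iff\<close>)
  then show ?thesis using that[of J] * by (auto simp: fourier_trig_poly)
qed

lemma convolution_trig_poly:
  assumes "J \<subseteq> dual_group" "integrable \<mu> a"
  shows "convolution \<mu> a (trig_poly J c) = trig_poly J (\<lambda>\<gamma>. fourier \<mu> a \<gamma> * c \<gamma>)"
proof
  fix x
  have "convolution \<mu> a (trig_poly J c) x = (LINT y|\<mu>. (\<Sum>\<gamma>\<in>J. (c \<gamma> * \<gamma> x) * (a y * cnj (\<gamma> y))))"
    unfolding convolution_def using assms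
    by (simp add: trig_poly_diff_translation sum_distrib_left mult_ac)
  also have "\<dots> = (\<Sum>\<gamma>\<in>J. LINT y|\<mu>. (c \<gamma> * \<gamma> x) * (a y * cnj (\<gamma> y)))"
    using assms by (intro Bochner_Integration.integral_sum Bochner_Integration.integrable_mult_right integrable_mult_character character_cnj) auto
  also have "\<dots> = (\<Sum>\<gamma>\<in>J. (c \<gamma> * \<gamma> x) * fourier \<mu> a \<gamma>)" by (simp add: fourier_def)
  finally show "convolution \<mu> a (trig_poly J c) x = trig_poly J (\<lambda>\<gamma>. fourier \<mu> a \<gamma> * c \<gamma>) x"
    by (simp add: trig_poly_def mult_ac)
qed

lemma bessel_polynomial:
  assumes f: "f \<in> polynomials" and "finite J" "J \<subseteq> dual_group"
  shows "(\<Sum>\<gamma>\<in>J. (cmod (fourier \<mu> f \<gamma>))\<^sup>2) \<le> (LINT x|\<mu>. (cmod (f x))\<^sup>2)"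
proof -
  obtain E where E: "finite E" "E \<subseteq> dual_group" "f = trig_poly E (fourier \<mu> f)"
    "\<And>\<gamma>. \<gamma> \<in> dual_group - E \<Longrightarrow> fourier \<mu> f \<gamma> = 0"
    using polynomial_expansion[OF f] by blast
  have "(\<Sum>\<gamma>\<in>J. (cmod (fourier \<mu> f \<gamma>))\<^sup>2) = (\<Sum>\<gamma>\<in>J \<inter> E. (cmod (fourier \<mu> f \<gamma>))\<^sup>2)"
    using assms E(4) by (intro sum.mono_neutral_right) auto
  also have "\<dots> \<le> (\<Sum>\<gamma>\<in>E. (cmod (fourier \<mu> f \<gamma>))\<^sup>2)"
    using E by (intro sum_mono2) auto
  also have "\<dots> = (LINT x|\<mu>. (cmod (trig_poly E (fourier \<mu> f) x))\<^sup>2)"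
    using parseval_trig_poly[OF E(1,2)] by simp
  finally show ?thesis using E(3) by simp
qed

end

section \<open>Khintchine's inequality\<close>

text \<open>The subgaussian bound for a random sign. The function t cosh t - sinh t has derivative t
  sinh t, hence is nonnegative for t >= 0, and this makes exp(-t^2/2) cosh t decreasing
  there.\<close>

lemma cosh_le_exp_square: "cosh x \<le> exp (x\<^sup>2 / 2)" for x :: real
proof -
  have 1: "sinh t \<le> t * cosh t" if "0 \<le> t" for t :: real
  proof -
    have "((\<lambda>t. t * cosh t - sinh t) has_real_derivative s * sinh s) (at s)" for s :: real
      by (auto intro!: derivative_eq_intros)
    moreover have "0 \<le> s * sinh s" if "0 \<le> s" for s :: real using that by simp
    ultimately have "(\<lambda>t. t * cosh t - sinh t) 0 \<le> (\<lambda>t. t * cosh t - sinh t) t"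
      by (intro DERIV_nonneg_imp_nondecreasing[OF that]) blast
    then show ?thesis by simp
  qed
  have 2: "cosh t \<le> exp (t\<^sup>2 / 2)" if "0 \<le> t" for t :: real
  proof -
    have "((\<lambda>t. exp (- (t\<^sup>2 / 2)) * cosh t) has_real_derivative
        exp (- (s\<^sup>2 / 2)) * (sinh s - s * cosh s)) (at s)" for s :: real
      by (auto intro!: derivative_eq_intros simp: algebra_simps)
    moreover have "exp (- (s\<^sup>2 / 2)) * (sinh s - s * cosh s) \<le> 0" if "0 \<le> s" for s :: real
      using 1[OF that] by (simp add: mult_nonneg_nonpos)
    ultimately have "(\<lambda>t. exp (- (t\<^sup>2 / 2)) * cosh t) t \<le> (\<lambda>t. exp (- (t\<^sup>2 / 2)) * cosh t) 0"
      by (intro DERIV_nonpos_imp_nonincreasing[OF that]) blast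
    then show ?thesis by (simp add: exp_minus field_simps)
  qed
  show ?thesis using 2[of "\<bar>x\<bar>"] by simp
qed

text \<open>A single term of the exponential series; it reduces moments to exponential
  moments.\<close>

lemma power_le_fact_mult_exp:
  fixes t :: real
  assumes "0 \<le> t" shows "t ^ n \<le> fact n * exp t"
proof -
  have "(\<Sum>k\<in>{n}. t ^ k /\<^sub>R fact k) \<le> (\<Sum>k. t ^ k /\<^sub>R fact k)"
    using assms summable_exp_generic[of t] by (intro sum_le_suminf) auto
  then show ?thesis by (simp add: exp_def field_simps)
qed

text \<open>A choice of signs on J is encoded by the subset A where the sign is +1, so that
  averaging over all signs is a sum over \<open>Pow J\<close>.\<close>

definition sgn_of :: "'a set \<Rightarrow> 'a \<Rightarrow> real" where
  "sgn_of A j = (if j \<in> A then 1 else - 1)"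

text \<open>Independence of the signs: the sum over all subsets factors into a product of the terms
  2 cosh(a_j).\<close>

lemma sum_Pow_exp_sgn_of_le:
  fixes a :: "'a \<Rightarrow> real"
  assumes "finite J"
  shows "(\<Sum>A\<in>Pow J. exp (\<Sum>j\<in>J. sgn_of A j * a j)) \<le> 2 ^ card J * exp ((\<Sum>j\<in>J. (a j)\<^sup>2) / 2)"
proof -
  have "exp (\<Sum>j\<in>J. sgn_of A j * a j) = (\<Prod>j\<in>A. exp (a j)) * (\<Prod>j\<in>J - A. exp (- a j))"
    if "A \<subseteq> J" for A
  proof -
    have "exp (\<Sum>j\<in>J. sgn_of A j * a j) = (\<Prod>j\<in>J. exp (sgn_of A j * a j))"
      using assms by (rule exp_sum)
    also have "\<dots> = (\<Prod>j\<in>J - A. exp (sgn_of A j * a j)) * (\<Prod>j\<in>A. exp (sgn_of A j * a j))"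
      using assms that by (intro prod.subset_diff)
    also have "(\<Prod>j\<in>A. exp (sgn_of A j * a j)) = (\<Prod>j\<in>A. exp (a j))"
      by (intro prod.cong) (auto simp: sgn_of_def)
    also have "(\<Prod>j\<in>J - A. exp (sgn_of A j * a j)) = (\<Prod>j\<in>J - A. exp (- a j))"
      by (intro prod.cong) (auto simp: sgn_of_def)
    finally show ?thesis by (simp add: mult.commute)
  qed
  then have "(\<Sum>A\<in>Pow J. exp (\<Sum>j\<in>J. sgn_of A j * a j)) =
      (\<Sum>A\<in>Pow J. (\<Prod>j\<in>A. exp (a j)) * (\<Prod>j\<in>J - A. exp (- a j)))"
    by (intro sum.cong) auto
  also have "\<dots> = (\<Prod>j\<in>J. exp (a j) + exp (- a j))"
    using prod_add[OF assms, of "\<lambda>j. exp (a j)" "\<lambda>j. exp (- a j)"] by simp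
  also have "\<dots> \<le> (\<Prod>j\<in>J. 2 * exp ((a j)\<^sup>2 / 2))"
  proof (intro prod_mono conjI)
    fix j
    show "0 \<le> exp (a j) + exp (- a j)" by (simp add: add_nonneg_nonneg)
    show "exp (a j) + exp (- a j) \<le> 2 * exp ((a j)\<^sup>2 / 2)"
      using cosh_le_exp_square[of "a j"] by (simp add: cosh_field_def)
  qed
  also have "\<dots> = 2 ^ card J * exp ((\<Sum>j\<in>J. (a j)\<^sup>2) / 2)"
    using assms by (simp add: prod.distrib exp_sum sum_divide_distrib)
  finally show ?thesis .
qed

text \<open>The upper half of Khintchine's inequality for complex coefficients. Only some constant
  independent of J and a is required, so real and imaginary parts are separated crudely inside the
  exponential.\<close>

lemma sum_Pow_sgn_of_power_le:
  fixes a :: "'a \<Rightarrow> complex"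
  assumes J: "finite J" and a: "(\<Sum>j\<in>J. (cmod (a j))\<^sup>2) \<le> 1"
  shows "(\<Sum>A\<in>Pow J. cmod (\<Sum>j\<in>J. of_real (sgn_of A j) * a j) ^ n) \<le> 2 ^ card J * (2 * fact n * exp 2)"
proof -
  define S where "S A = (\<Sum>j\<in>J. of_real (sgn_of A j) * a j)" for A
  \<comment> \<open>The product of exp |Re z| and exp |Im z| is split by the arithmetic-geometric
    mean inequality, which doubles the exponents; exp |u| is then bounded by exp u + exp (-u) to
    make the exponents linear in z.\<close>
  have pt: "cmod z ^ n \<le> fact n / 2 * (exp (2 * Re z) + exp (- (2 * Re z)) + exp (2 * Im z) + exp (- (2 * Im z)))" for z
  proof -
    have "cmod z ^ n \<le> (\<bar>Re z\<bar> + \<bar>Im z\<bar>) ^ n" by (intro power_mono cmod_le) auto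
    also have "\<dots> \<le> fact n * exp (\<bar>Re z\<bar> + \<bar>Im z\<bar>)" by (intro power_le_fact_mult_exp) auto
    also have "exp (\<bar>Re z\<bar> + \<bar>Im z\<bar>) \<le> (exp (2 * \<bar>Re z\<bar>) + exp (2 * \<bar>Im z\<bar>)) / 2"
      using sum_squares_bound[of "exp \<bar>Re z\<bar>" "exp \<bar>Im z\<bar>"]
      by (simp add: exp_add exp_double)
    also have "exp (2 * \<bar>Re z\<bar>) \<le> exp (2 * Re z) + exp (- (2 * Re z))"
      by (cases "Re z \<ge> 0") auto
    also have "exp (2 * \<bar>Im z\<bar>) \<le> exp (2 * Im z) + exp (- (2 * Im z))"
      by (cases "Im z \<ge> 0") auto
    finally show ?thesis by (simp add: field_simps)
  qed
  \<comment> \<open>The doubled coefficients have square sum at most 4, and half of it gives the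
    exponent 2.\<close>
  have bnd: "(\<Sum>A\<in>Pow J. exp (\<Sum>j\<in>J. sgn_of A j * b j)) \<le> 2 ^ card J * exp 2"
    if "\<And>j. \<bar>b j\<bar> \<le> 2 * cmod (a j)" for b
  proof -
    have "(\<Sum>j\<in>J. (b j)\<^sup>2) \<le> (\<Sum>j\<in>J. (2 * cmod (a j))\<^sup>2)"
      by (intro sum_mono abs_le_square_iff[THEN iffD1]) (use that in auto)
    also have "\<dots> = 4 * (\<Sum>j\<in>J. (cmod (a j))\<^sup>2)" by (simp add: power_mult_distrib sum_distrib_left)
    finally have "(\<Sum>j\<in>J. (b j)\<^sup>2) / 2 \<le> 2" using a by simp
    then have "2 ^ card J * exp ((\<Sum>j\<in>J. (b j)\<^sup>2) / 2) \<le> 2 ^ card J * exp (2::real)" by simp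
    then show ?thesis using sum_Pow_exp_sgn_of_le[OF J, of b] by linarith
  qed
  have sums: "2 * Re (S A) = (\<Sum>j\<in>J. sgn_of A j * (2 * Re (a j)))"
    "- (2 * Re (S A)) = (\<Sum>j\<in>J. sgn_of A j * (- 2 * Re (a j)))"
    "2 * Im (S A) = (\<Sum>j\<in>J. sgn_of A j * (2 * Im (a j)))"
    "- (2 * Im (S A)) = (\<Sum>j\<in>J. sgn_of A j * (- 2 * Im (a j)))" for A
    by (simp_all add: S_def sum_distrib_left sum_negf mult_ac)
  have "(\<Sum>A\<in>Pow J. cmod (S A) ^ n) \<le>
    (\<Sum>A\<in>Pow J. fact n / 2 * (exp (2 * Re (S A)) + exp (- (2 * Re (S A))) + exp (2 * Im (S A)) + exp (- (2 * Im (S A)))))"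
    by (intro sum_mono pt)
  also have "\<dots> = fact n / 2 * ((\<Sum>A\<in>Pow J. exp (2 * Re (S A))) + (\<Sum>A\<in>Pow J. exp (- (2 * Re (S A))))
     + (\<Sum>A\<in>Pow J. exp (2 * Im (S A))) + (\<Sum>A\<in>Pow J. exp (- (2 * Im (S A)))))"
    by (simp only: sum_distrib_left[symmetric] sum.distrib)
  also have "\<dots> \<le> fact n / 2 * (2 ^ card J * exp 2 + 2 ^ card J * exp 2 + 2 ^ card J * exp 2 + 2 ^ card J * exp 2)"
    unfolding sums(2,4) unfolding sums(1,3) by (intro mult_left_mono add_mono bnd) (auto simp: abs_mult abs_Re_le_cmod abs_Im_le_cmod)
  finally show ?thesis by (simp add: S_def mult_ac)
qed

section \<open>Sidon sets are \<open>\<Lambda>(q)\<close>\<close>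

text \<open>Convexity in tangent-line form. It stands in for Jensen's inequality in
  \<open>young_trig_poly\<close>, where the weight |a| is not a probability density. Multiplying the
  case n by s leaves a surplus that is a multiple of (s - t)^2.\<close>

lemma power_Suc_tangent_le:
  fixes s t :: real
  assumes "0 \<le> s" "0 \<le> t"
  shows "t ^ Suc n + real (Suc n) * t ^ n * (s - t) \<le> s ^ Suc n"
proof (induction n)
  case 0 then show ?case by simp
next
  case (Suc n)
  have "s * (t ^ Suc n + real (Suc n) * t ^ n * (s - t)) \<le> s * s ^ Suc n"
    using Suc assms by (intro mult_left_mono) auto
  moreover have "s * (t ^ Suc n + real (Suc n) * t ^ n * (s - t))
     - (t ^ Suc (Suc n) + real (Suc (Suc n)) * t ^ Suc n * (s - t)) = real (Suc n) * t ^ n * (s - t)\<^sup>2"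
    by (simp add: algebra_simps power2_eq_square)
  moreover have "0 \<le> real (Suc n) * t ^ n * (s - t)\<^sup>2" using assms by simp
  ultimately show ?case by simp
qed

abbreviation l2_fin :: "('s \<Rightarrow> complex) \<Rightarrow> 's set \<Rightarrow> real" where
  "l2_fin c J \<equiv> L2_set (\<lambda>\<gamma>. cmod (c \<gamma>)) J"

lemma powr_le_one_plus_power:
  fixes t :: real assumes "0 \<le> t" "0 \<le> q" "q \<le> real n" shows "t powr q \<le> 1 + t ^ n"
proof (cases "t \<le> 1")
  case True
  then have "t powr q \<le> 1" using assms powr_mono2[of q t 1] by simp
  then show ?thesis using assms zero_le_power[of t n] by linarith
next
  case False
  then have "t powr q \<le> t powr real n" using assms by (intro powr_mono) auto
  then show ?thesis using False by (simp add: powr_realpow)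
qed

lemma L2_set_eq_0_trig_poly:
  assumes "finite J" "l2_fin c J = 0" shows "trig_poly J c x = 0"
proof -
  have "\<forall>\<gamma>\<in>J. cmod (c \<gamma>) = 0" using assms by (subst (asm) L2_set_eq_0_iff) auto
  then show ?thesis by (auto simp: trig_poly_def intro!: sum.neutral)
qed

context compact_haar begin

lemma Lp_functions_1_iff: "f \<in> Lp_functions \<mu> 1 \<longleftrightarrow> integrable \<mu> f"
  by (auto simp: Lp_functions_def integrable_norm_iff)

lemma Lp_norm_1: "Lp_norm \<mu> 1 f = (LINT x|\<mu>. cmod (f x))"
  by (simp add: Lp_norm_def)

text \<open>Tonelli followed by translation invariance in the inner integral. Joint measurability is
  a separate hypothesis because Borel measurability of g alone need not provide it on a
  non-metrizable group.\<close>

lemma nn_integral_convolution: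
  fixes a g :: "'g \<Rightarrow> ennreal"
  assumes [measurable]: "a \<in> borel_measurable borel" "g \<in> borel_measurable borel"
    and joint[measurable]: "(\<lambda>z. g (fst z - snd z)) \<in> borel_measurable (\<mu> \<Otimes>\<^sub>M \<mu>)"
  shows "(\<integral>\<^sup>+x. \<integral>\<^sup>+y. a y * g (x - y) \<partial>\<mu> \<partial>\<mu>) = (\<integral>\<^sup>+y. a y \<partial>\<mu>) * (\<integral>\<^sup>+x. g x \<partial>\<mu>)"
proof -
  interpret pair_sigma_finite \<mu> \<mu> ..
  have "(\<integral>\<^sup>+x. \<integral>\<^sup>+y. a y * g (x - y) \<partial>\<mu> \<partial>\<mu>) = (\<integral>\<^sup>+y. \<integral>\<^sup>+x. a y * g (x - y) \<partial>\<mu> \<partial>\<mu>)"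
    using Fubini'[of "\<lambda>x y. a y * g (x - y)"] by (simp add: case_prod_unfold)
  also have "\<dots> = (\<integral>\<^sup>+y. a y * (\<integral>\<^sup>+x. g x \<partial>\<mu>) \<partial>\<mu>)"
  proof (intro nn_integral_cong)
    fix y
    have m: "(\<lambda>x. g (- y + x)) \<in> borel_measurable \<mu>"
      using measurable_compose[OF measurable_translation[of "- y"] assms(2)] by simp
    have "(\<integral>\<^sup>+x. a y * g (x - y) \<partial>\<mu>) = (\<integral>\<^sup>+x. a y * g (- y + x) \<partial>\<mu>)" by simp
    also have "\<dots> = a y * (\<integral>\<^sup>+x. g (- y + x) \<partial>\<mu>)" by (rule nn_integral_cmult[OF m])
    also have "(\<integral>\<^sup>+x. g (- y + x) \<partial>\<mu>) = (\<integral>\<^sup>+x. g x \<partial>\<mu>)" by (rule nn_integral_translation[OF assms(2)])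
    finally show "(\<integral>\<^sup>+x. a y * g (x - y) \<partial>\<mu>) = a y * (\<integral>\<^sup>+x. g x \<partial>\<mu>)" .
  qed
  also have "\<dots> = (\<integral>\<^sup>+y. a y \<partial>\<mu>) * (\<integral>\<^sup>+x. g x \<partial>\<mu>)" by (rule nn_integral_multc) simp
  finally show ?thesis .
qed

text \<open>Since \<gamma>(x - y) is \<gamma>(x) times the conjugate of \<gamma>(y), only finitely
  many products of one-variable functions occur.\<close>

lemma trig_poly_joint_measurable:
  assumes "J \<subseteq> dual_group"
  shows "(\<lambda>z. trig_poly J c (fst z - snd z)) \<in> borel_measurable (\<mu> \<Otimes>\<^sub>M \<mu>)"
proof -
  have "(\<lambda>z. c \<gamma> * \<gamma> (fst z) * cnj (\<gamma> (snd z))) \<in> borel_measurable (\<mu> \<Otimes>\<^sub>M \<mu>)" if "\<gamma> \<in> J" for \<gamma>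
  proof -
    have [measurable]: "\<gamma> \<in> borel_measurable \<mu>" "(\<lambda>x. cnj (\<gamma> x)) \<in> borel_measurable \<mu>"
      using character_measurable[of \<gamma>] character_measurable[OF character_cnj, of \<gamma>] that assms by auto
    show ?thesis by measurable
  qed
  then have "(\<lambda>z. \<Sum>\<gamma>\<in>J. c \<gamma> * \<gamma> (fst z) * cnj (\<gamma> (snd z))) \<in> borel_measurable (\<mu> \<Otimes>\<^sub>M \<mu>)"
    by (rule borel_measurable_sum)
  then show ?thesis using assms by (simp add: trig_poly_diff_translation)
qed

text \<open>Young's inequality for L_1 * L_(n+1) in power form, with the convolution written through
  Fourier coefficients. The positive bound C replaces the norm of a, which might be 0, as a
  divisor.\<close>

lemma young_trig_poly:
  assumes a: "integrable \<mu> a" and C: "(LINT y|\<mu>. cmod (a y)) \<le> C" "0 < C"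
    and J: "finite J" "J \<subseteq> dual_group"
  shows "(LINT x|\<mu>. cmod (trig_poly J (\<lambda>\<gamma>. fourier \<mu> a \<gamma> * c \<gamma>) x) ^ Suc n)
     \<le> C ^ Suc n * (LINT x|\<mu>. cmod (trig_poly J c x) ^ Suc n)"
proof -
  define P where "P = trig_poly J c"
  have P: "P \<in> polynomials" using J by (simp add: P_def polynomials_trig_poly)
  have Pm [measurable]: "P \<in> borel_measurable borel" using P by (rule polynomials_measurable)
  obtain M where M: "M > 0" "\<And>x. cmod (P x) \<le> M" using polynomials_bounded[OF P] by blast
  have [measurable]: "a \<in> borel_measurable borel" using borel_measurable_integrable[OF a] by simp
  define A where "A = (LINT y|\<mu>. cmod (a y))"
  have int: "integrable \<mu> (\<lambda>y. cmod (a y) * cmod (P (x - y)) ^ k)" for x k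
  proof (rule integrable_mult_bounded[of _ _ "M ^ k"])
    show "(\<lambda>y. cmod (P (x - y)) ^ k) \<in> borel_measurable borel"
      using measurable_compose[OF measurable_reflection_translation[of x] Pm] by measurable
  qed (use a M in \<open>auto intro: power_mono\<close>)
  define V where "V x = (LINT y|\<mu>. cmod (a y) * cmod (P (x - y)) ^ Suc n)" for x
  have V0: "0 \<le> V x" for x unfolding V_def by (intro Bochner_Integration.integral_nonneg) auto
  have pt: "cmod (convolution \<mu> a P x) ^ Suc n \<le> C ^ n * V x" for x
  proof -
    define W where "W = (LINT y|\<mu>. cmod (a y) * cmod (P (x - y)))"
    \<comment> \<open>The tangent point for the convexity inequality: W is the integral of |a(y)|
      |P(x - y)|, and W / C would be its average if |a| had mass C.\<close>
    define t where "t = W / C"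
    have W0: "0 \<le> W" unfolding W_def by (intro Bochner_Integration.integral_nonneg) auto
    then have t0: "0 \<le> t" using C by (simp add: t_def)
    have WC: "W = t * C" using C by (simp add: t_def)
    have "cmod (convolution \<mu> a P x) \<le> (LINT y|\<mu>. cmod (a y * P (x - y)))"
      unfolding convolution_def by (rule integral_norm_bound)
    then have 1: "cmod (convolution \<mu> a P x) \<le> W" by (simp add: W_def norm_mult)
    have int1: "integrable \<mu> (\<lambda>y. cmod (a y) * cmod (P (x - y)))" using int[of x 1] by simp
    have "(LINT y|\<mu>. t ^ Suc n * cmod (a y) + real (Suc n) * t ^ n * (cmod (a y) * cmod (P (x - y)) - t * cmod (a y))) \<le> V x"
      unfolding V_def
    proof (intro integral_mono)
      show "integrable \<mu> (\<lambda>y. t ^ Suc n * cmod (a y) + real (Suc n) * t ^ n * (cmod (a y) * cmod (P (x - y)) - t * cmod (a y)))"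
        using int1 a by auto
      fix y
      have "cmod (a y) * (t ^ Suc n + real (Suc n) * t ^ n * (cmod (P (x - y)) - t)) \<le> cmod (a y) * cmod (P (x - y)) ^ Suc n"
        using t0 by (intro mult_left_mono power_Suc_tangent_le) auto
      then show "t ^ Suc n * cmod (a y) + real (Suc n) * t ^ n * (cmod (a y) * cmod (P (x - y)) - t * cmod (a y)) \<le> cmod (a y) * cmod (P (x - y)) ^ Suc n"
        by (simp add: algebra_simps)
    qed (rule int)
    also have "(LINT y|\<mu>. t ^ Suc n * cmod (a y) + real (Suc n) * t ^ n * (cmod (a y) * cmod (P (x - y)) - t * cmod (a y)))
       = t ^ Suc n * A + real (Suc n) * t ^ n * (W - t * A)"
      using int1 a by (simp add: A_def W_def)
    finally have "t ^ Suc n * A + real (Suc n) * t ^ n * (W - t * A) \<le> V x" .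
    \<comment> \<open>Replacing the true mass A by C leaves a remainder with the favourable
      sign.\<close>
    moreover have "t ^ Suc n * A + real (Suc n) * t ^ n * (W - t * A) = t ^ Suc n * C + real n * t ^ Suc n * (C - A)"
      by (simp add: WC algebra_simps)
    moreover have "0 \<le> real n * t ^ Suc n * (C - A)" using t0 C by (simp add: A_def)
    ultimately have "t ^ Suc n * C \<le> V x" by linarith
    then have "C ^ n * (t ^ Suc n * C) \<le> C ^ n * V x" using C by (intro mult_left_mono) auto
    then have "W ^ Suc n \<le> C ^ n * V x" by (simp add: WC power_mult_distrib mult_ac)
    moreover have "cmod (convolution \<mu> a P x) ^ Suc n \<le> W ^ Suc n" using 1 by (intro power_mono) auto
    ultimately show ?thesis by linarith
  qed
  define R where "R = convolution \<mu> a P"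
  have R: "R = trig_poly J (\<lambda>\<gamma>. fourier \<mu> a \<gamma> * c \<gamma>)"
    unfolding R_def P_def using J a by (intro convolution_trig_poly)
  then have Rp: "R \<in> polynomials" using J by (simp add: polynomials_trig_poly)
  have Rm [measurable]: "R \<in> borel_measurable borel" using Rp by (rule polynomials_measurable)
  have intR: "integrable \<mu> (\<lambda>x. cmod (R x) ^ Suc n)" and intP: "integrable \<mu> (\<lambda>x. cmod (P x) ^ Suc n)"
    by (rule polynomials_power_integrable[OF Rp], rule polynomials_power_integrable[OF P])
  have jm: "(\<lambda>z. ennreal (cmod (P (fst z - snd z)) ^ Suc n)) \<in> borel_measurable (\<mu> \<Otimes>\<^sub>M \<mu>)"
    using trig_poly_joint_measurable[OF J(2), of c] unfolding P_def by measurable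
  have "ennreal (LINT x|\<mu>. cmod (R x) ^ Suc n) = (\<integral>\<^sup>+x. cmod (R x) ^ Suc n \<partial>\<mu>)"
    using intR by (intro nn_integral_eq_integral[symmetric]) auto
  also have "\<dots> \<le> (\<integral>\<^sup>+x. \<integral>\<^sup>+y. ennreal (C ^ n * cmod (a y)) * ennreal (cmod (P (x - y)) ^ Suc n) \<partial>\<mu> \<partial>\<mu>)"
  proof (intro nn_integral_mono)
    fix x
    have "ennreal (cmod (R x) ^ Suc n) \<le> ennreal (C ^ n * V x)"
      using pt[of x] by (intro ennreal_leI) (simp add: R_def)
    also have "\<dots> = ennreal (LINT y|\<mu>. C ^ n * (cmod (a y) * cmod (P (x - y)) ^ Suc n))"
      by (simp add: V_def)
    also have "\<dots> = (\<integral>\<^sup>+y. ennreal (C ^ n * (cmod (a y) * cmod (P (x - y)) ^ Suc n)) \<partial>\<mu>)"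
      using int[of x "Suc n"] C by (intro nn_integral_eq_integral[symmetric]) auto
    also have "\<dots> = (\<integral>\<^sup>+y. ennreal (C ^ n * cmod (a y)) * ennreal (cmod (P (x - y)) ^ Suc n) \<partial>\<mu>)"
      using C by (intro nn_integral_cong) (simp add: ennreal_mult[symmetric] mult_ac)
    finally show "ennreal (cmod (R x) ^ Suc n) \<le> (\<integral>\<^sup>+y. ennreal (C ^ n * cmod (a y)) * ennreal (cmod (P (x - y)) ^ Suc n) \<partial>\<mu>)" .
  qed
  also have "\<dots> = (\<integral>\<^sup>+y. ennreal (C ^ n * cmod (a y)) \<partial>\<mu>) * (\<integral>\<^sup>+x. ennreal (cmod (P x) ^ Suc n) \<partial>\<mu>)"
    using jm by (intro nn_integral_convolution) auto
  also have "(\<integral>\<^sup>+y. ennreal (C ^ n * cmod (a y)) \<partial>\<mu>) = ennreal (C ^ n * A)"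
    using a C by (subst nn_integral_eq_integral) (auto simp: A_def)
  also have "(\<integral>\<^sup>+x. ennreal (cmod (P x) ^ Suc n) \<partial>\<mu>) = ennreal (LINT x|\<mu>. cmod (P x) ^ Suc n)"
    using intP by (intro nn_integral_eq_integral) auto
  also have "ennreal (C ^ n * A) * ennreal (LINT x|\<mu>. cmod (P x) ^ Suc n) \<le> ennreal (C ^ Suc n) * ennreal (LINT x|\<mu>. cmod (P x) ^ Suc n)"
    using C by (intro mult_right_mono ennreal_leI) (auto simp: A_def mult_left_mono mult.commute)
  also have "\<dots> = ennreal (C ^ Suc n * (LINT x|\<mu>. cmod (P x) ^ Suc n))"
    using C by (intro ennreal_mult[symmetric] Bochner_Integration.integral_nonneg) auto
  finally have "(LINT x|\<mu>. cmod (R x) ^ Suc n) \<le> C ^ Suc n * (LINT x|\<mu>. cmod (P x) ^ Suc n)"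
    by (rule ennreal_le_iff[THEN iffD1, rotated])
       (use C in \<open>intro mult_nonneg_nonneg Bochner_Integration.integral_nonneg; auto\<close>)
  then show ?thesis by (simp only: R P_def)
qed

section \<open>Uniform interpolation constants for Sidon sets, and moments\<close>

definition interpolable where
  "interpolable J e C \<longleftrightarrow>
    (\<exists>a. integrable \<mu> a \<and> (\<forall>\<gamma>\<in>J. fourier \<mu> a \<gamma> = e \<gamma>) \<and> (LINT x|\<mu>. cmod (a x)) \<le> C)"

text \<open>The wrong coefficients on the finite set F are corrected by a polynomial: each
  correction is at most 1 + C and there are at most card F of them. Used in contrapositive form:
  deleting finitely many characters cannot cure unbounded constants.\<close>

lemma interpolable_extend_finite:
  fixes C :: real
  assumes J: "finite J" "J \<subseteq> dual_group" "\<And>\<gamma>. \<gamma> \<in> J \<Longrightarrow> cmod (e \<gamma>) \<le> 1"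
    and F: "finite F" and C: "0 \<le> C" and "interpolable (J - F) e C"
  shows "interpolable J e (C + card F * (1 + C))"
proof -
  obtain a where a: "integrable \<mu> a" "\<And>\<gamma>. \<gamma> \<in> J - F \<Longrightarrow> fourier \<mu> a \<gamma> = e \<gamma>"
    "(LINT x|\<mu>. cmod (a x)) \<le> C"
    using assms(6) unfolding interpolable_def by blast
  define d where "d \<gamma> = e \<gamma> - fourier \<mu> a \<gamma>" for \<gamma>
  define R where "R = trig_poly (J \<inter> F) d"
  have JF: "finite (J \<inter> F)" "J \<inter> F \<subseteq> dual_group" using J by auto
  have R: "R \<in> polynomials" unfolding R_def using JF by (rule polynomials_trig_poly)
  have intR: "integrable \<mu> R" using R by (rule polynomials_integrable)
  have d: "cmod (d \<gamma>) \<le> 1 + C" if "\<gamma> \<in> J \<inter> F" for \<gamma>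
  proof -
    have "cmod (d \<gamma>) \<le> cmod (e \<gamma>) + cmod (fourier \<mu> a \<gamma>)" unfolding d_def by (rule norm_triangle_ineq4)
    also have "\<dots> \<le> 1 + C"
    proof (rule add_mono)
      have "\<gamma> \<in> dual_group" using that J by auto
      then show "cmod (fourier \<mu> a \<gamma>) \<le> C" using norm_fourier_le[of \<gamma> a] a(3) by linarith
    qed (use that J in auto)
    finally show ?thesis .
  qed
  have Rb: "cmod (R x) \<le> card F * (1 + C)" for x
  proof -
    have "cmod (R x) \<le> (\<Sum>\<gamma>\<in>J \<inter> F. cmod (d \<gamma>))" unfolding R_def by (rule trig_poly_bound[OF JF(2)])
    also have "\<dots> \<le> (\<Sum>\<gamma>\<in>J \<inter> F. 1 + C)" by (intro sum_mono d)
    also have "\<dots> = card (J \<inter> F) * (1 + C)" by simp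
    also have "\<dots> \<le> card F * (1 + C)" using C F by (intro mult_right_mono) (auto intro: card_mono)
    finally show ?thesis .
  qed
  show ?thesis unfolding interpolable_def
  proof (intro exI conjI ballI)
    show "integrable \<mu> (\<lambda>x. a x + R x)" using a intR by auto
    fix \<gamma> assume g: "\<gamma> \<in> J"
    have "fourier \<mu> (\<lambda>x. a x + R x) \<gamma> = fourier \<mu> a \<gamma> + (if \<gamma> \<in> J \<inter> F then d \<gamma> else 0)"
      using g J a(1) intR fourier_trig_poly[OF JF, of \<gamma> d] by (subst fourier_add) (auto simp: R_def)
    also have "\<dots> = e \<gamma>" using g a(2)[of \<gamma>] by (auto simp: d_def)
    finally show "fourier \<mu> (\<lambda>x. a x + R x) \<gamma> = e \<gamma>" .
  next
    have "(LINT x|\<mu>. cmod (a x + R x)) \<le> (LINT x|\<mu>. cmod (a x) + card F * (1 + C))"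
    proof (intro integral_mono)
      show "cmod (a x + R x) \<le> cmod (a x) + card F * (1 + C)" for x
        using norm_triangle_ineq[of "a x" "R x"] Rb[of x] by linarith
    qed (use a intR in auto)
    also have "\<dots> = (LINT x|\<mu>. cmod (a x)) + card F * (1 + C)"
      using a prob_space by (subst Bochner_Integration.integral_add) auto
    finally show "(LINT x|\<mu>. cmod (a x + R x)) \<le> C + card F * (1 + C)" using a(3) by simp
  qed
qed

text \<open>A gliding hump in place of the open mapping theorem: if the interpolation constants were
  unbounded, disjoint blocks \<open>J\<^sub>n\<close> with signs \<open>e\<^sub>n\<close> of huge constant could be glued to
  \<open>\<Sum>\<^sub>n 2\<^sup>-\<^sup>n e\<^sub>n \<in> c\<^sub>0\<close>, which no function in \<open>L\<^sub>1\<close> interpolates.\<close>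

lemma sidon_constant:
  assumes S: "sidon_set \<mu> \<Sigma>"
  shows "\<exists>C>0. \<forall>J e. finite J \<longrightarrow> J \<subseteq> \<Sigma> \<longrightarrow> (\<forall>\<gamma>\<in>J. cmod (e \<gamma>) \<le> 1) \<longrightarrow> interpolable J e C"
proof (rule ccontr)
  assume "\<not> ?thesis"
  then have neg: "\<forall>C. C > 0 \<longrightarrow> (\<exists>J e. finite J \<and> J \<subseteq> \<Sigma> \<and> (\<forall>\<gamma>\<in>J. cmod (e \<gamma>) \<le> 1) \<and> \<not> interpolable J e C)"
    by (simp only: not_ex not_all not_imp de_Morgan_conj de_Morgan_disj imp_conv_disj not_not simp_thms)
  note bad = neg[rule_format]
  have SG: "\<Sigma> \<subseteq> dual_group" using S by (simp add: sidon_set_def)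
  \<comment> \<open>Unboundedness persists away from any finite F, so each new block can avoid all
    earlier ones.\<close>
  have bad': "\<exists>J e. finite J \<and> J \<subseteq> \<Sigma> \<and> J \<inter> F = {} \<and> (\<forall>\<gamma>\<in>J. cmod (e \<gamma>) \<le> 1) \<and> \<not> interpolable J e C"
    if F: "finite F" and C: "C > 0" for F C
  proof -
    obtain J e where J: "finite J" "J \<subseteq> \<Sigma>" "\<forall>\<gamma>\<in>J. cmod (e \<gamma>) \<le> 1" "\<not> interpolable J e (C + card F * (1 + C))"
      using bad[of "C + card F * (1 + C)"] C by (auto simp: add_pos_nonneg)
    then have "\<not> interpolable (J - F) e C"
      using interpolable_extend_finite[of J e F C] SG F C by auto
    then show ?thesis using J by (intro exI[of _ "J - F"] exI[of _ e]) auto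
  qed
  \<comment> \<open>A state consists of the current block J, its coefficients e and the union F of
    the earlier blocks. The forbidden constant (n + 1) 2^n outgrows the scaling 2^n used below by an
    unbounded factor, and n + 1 keeps it positive at n = 0.\<close>
  define P where "P n x = (case x of (J, e, F) \<Rightarrow> finite J \<and> J \<subseteq> \<Sigma> \<and> finite F \<and> J \<inter> F = {} \<and>
      (\<forall>\<gamma>\<in>J. cmod (e \<gamma>) \<le> 1) \<and> \<not> interpolable J e (real (Suc n) * 2 ^ n))"
    for n :: nat and x :: "('g \<Rightarrow> complex) set \<times> (('g \<Rightarrow> complex) \<Rightarrow> complex) \<times> ('g \<Rightarrow> complex) set"
  define Q where "Q n x y = (snd (snd y) = snd (snd x) \<union> fst x)"
    for n :: nat and x y :: "('g \<Rightarrow> complex) set \<times> (('g \<Rightarrow> complex) \<Rightarrow> complex) \<times> ('g \<Rightarrow> complex) set"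
  have "\<exists>f. \<forall>n. P n (f n) \<and> Q n (f n) (f (Suc n))"
  proof (rule dependent_nat_choice)
    show "\<exists>x. P 0 x" using bad'[of "{}" 1] unfolding P_def by auto
  next
    fix x n assume "P n x"
    obtain J e F where x: "x = (J, e, F)" by (cases x)
    have "finite (F \<union> J)" using \<open>P n x\<close> x by (auto simp: P_def)
    from bad'[OF this, of "real (Suc (Suc n)) * 2 ^ Suc n"] obtain J' e' where
      "finite J'" "J' \<subseteq> \<Sigma>" "J' \<inter> (F \<union> J) = {}" "\<forall>\<gamma>\<in>J'. cmod (e' \<gamma>) \<le> 1"
      "\<not> interpolable J' e' (real (Suc (Suc n)) * 2 ^ Suc n)" by auto
    then show "\<exists>y. P (Suc n) y \<and> Q n x y"
      using \<open>finite (F \<union> J)\<close> by (intro exI[of _ "(J', e', F \<union> J)"]) (simp add: P_def Q_def x)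
  qed
  then obtain f where f: "\<And>n. P n (f n)" "\<And>n. Q n (f n) (f (Suc n))" by blast
  define J where "J n = fst (f n)" for n
  define e where "e n = fst (snd (f n))" for n
  define F where "F n = snd (snd (f n))" for n
  have fn: "f n = (J n, e n, F n)" for n by (simp add: J_def e_def F_def)
  have J: "finite (J n)" "J n \<subseteq> \<Sigma>" "J n \<inter> F n = {}" "\<And>\<gamma>. \<gamma> \<in> J n \<Longrightarrow> cmod (e n \<gamma>) \<le> 1"
    "\<not> interpolable (J n) (e n) (real (Suc n) * 2 ^ n)" for n
    using f(1)[of n] unfolding P_def fn by auto
  have FS: "F (Suc n) = F n \<union> J n" for n using f(2)[of n] unfolding Q_def fn by simp
  have JF: "J m \<subseteq> F n" if "m < n" for m n
    using that by (induction n) (auto simp: FS less_Suc_eq)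
  have disj: "m = n" if "\<gamma> \<in> J m" "\<gamma> \<in> J n" for \<gamma> m n
  proof (rule ccontr)
    assume "m \<noteq> n"
    then consider "m < n" | "n < m" by linarith
    then show False using JF[of m n] JF[of n m] J(3)[of n] J(3)[of m] that by cases auto
  qed
  \<comment> \<open>The glued sequence: by disjointness at most one block contains \<gamma>, so the
    description operator is legitimate there.\<close>
  define c where "c \<gamma> = (if \<exists>n. \<gamma> \<in> J n then e (THE n. \<gamma> \<in> J n) \<gamma> / 2 ^ (THE n. \<gamma> \<in> J n) else 0)" for \<gamma>
  have cJ: "c \<gamma> = e n \<gamma> / 2 ^ n" if "\<gamma> \<in> J n" for \<gamma> n
  proof -
    have "(THE n. \<gamma> \<in> J n) = n" using that disj by blast
    then show ?thesis using that by (auto simp: c_def)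
  qed
  have "c \<in> c0 \<Sigma>"
    unfolding c0_def functions_on_def
  proof (intro CollectI conjI allI impI)
    fix \<gamma> assume "\<gamma> \<notin> \<Sigma>" then show "c \<gamma> = 0" using J(2) by (auto simp: c_def)
  next
    fix \<epsilon> :: real assume "\<epsilon> > 0"
    then obtain N where N: "(1 / 2) ^ N < \<epsilon>" using real_arch_pow_inv[of \<epsilon> "1/2"] by auto
    have "{\<gamma>. \<epsilon> \<le> cmod (c \<gamma>)} \<subseteq> (\<Union>n<N. J n)"
    proof
      fix \<gamma> assume g: "\<gamma> \<in> {\<gamma>. \<epsilon> \<le> cmod (c \<gamma>)}"
      then have "c \<gamma> \<noteq> 0" using \<open>\<epsilon> > 0\<close> by auto
      then obtain n where n: "\<gamma> \<in> J n" unfolding c_def by meson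
      have "cmod (c \<gamma>) = cmod (e n \<gamma>) / 2 ^ n"
        using cJ[OF n] by (simp add: norm_divide norm_power)
      also have "\<dots> \<le> (1 / 2) ^ n"
        using J(4)[OF n] by (simp add: power_divide divide_right_mono)
      finally have *: "(1 / 2 :: real) ^ N < (1 / 2) ^ n" using g N unfolding mem_Collect_eq by linarith
      have "n < N"
      proof (rule ccontr)
        assume "\<not> n < N"
        then have "(1 / 2 :: real) ^ n \<le> (1 / 2) ^ N" by (intro power_decreasing) auto
        then show False using * by linarith
      qed
      then show "\<gamma> \<in> (\<Union>n<N. J n)" using n by auto
    qed
    then show "finite {\<gamma>. \<epsilon> \<le> cmod (c \<gamma>)}" by (rule finite_subset) (use J(1) in auto)
  qed
  then have "\<exists>a\<in>Lp_functions \<mu> 1. c = restrict_to \<Sigma> (fourier \<mu> a)" using S by (simp add: sidon_set_def)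
  then obtain a where a: "integrable \<mu> a" "c = restrict_to \<Sigma> (fourier \<mu> a)"
    by (auto simp: Lp_functions_1_iff)
  \<comment> \<open>For this n the function 2^n a interpolates \<open>e n\<close> on
    \<open>J n\<close> with norm at most n 2^n, below the forbidden constant.\<close>
  obtain n where n: "(LINT x|\<mu>. cmod (a x)) < real n" using reals_Archimedean2 by blast
  have "interpolable (J n) (e n) (real (Suc n) * 2 ^ n)"
    unfolding interpolable_def
  proof (intro exI[of _ "\<lambda>x. 2 ^ n * a x"] conjI ballI)
    show "integrable \<mu> (\<lambda>x. 2 ^ n * a x)" using a by auto
    fix \<gamma> assume g: "\<gamma> \<in> J n"
    then have "fourier \<mu> a \<gamma> = e n \<gamma> / 2 ^ n"
      using fun_cong[OF a(2), of \<gamma>] cJ[OF g] J(2)[of n] by (auto simp: restrict_to_def)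
    then show "fourier \<mu> (\<lambda>x. 2 ^ n * a x) \<gamma> = e n \<gamma>" by (simp add: fourier_scale)
  next
    have "(LINT x|\<mu>. cmod (2 ^ n * a x)) = 2 ^ n * (LINT x|\<mu>. cmod (a x))"
      by (simp add: norm_mult norm_power)
    also have "\<dots> \<le> 2 ^ n * real (Suc n)" using n by (intro mult_left_mono) auto
    finally show "(LINT x|\<mu>. cmod (2 ^ n * a x)) \<le> real (Suc n) * 2 ^ n" by (simp add: mult.commute)
  qed
  then show False using J(5) by blast
qed

text \<open>Rudin's argument: convolution with a function interpolating the signs \<open>s\<close> turns
  \<open>\<Sum> s\<^sub>\<gamma> c\<^sub>\<gamma> \<gamma>\<close> into \<open>\<Sum> c\<^sub>\<gamma> \<gamma>\<close>; average over all signs and use Khintchine pointwise.\<close>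

lemma sidon_moment_bound:
  assumes S: "sidon_set \<mu> \<Sigma>"
  shows "\<exists>B>0. \<forall>J c. finite J \<longrightarrow> J \<subseteq> \<Sigma> \<longrightarrow> (\<Sum>\<gamma>\<in>J. (cmod (c \<gamma>))\<^sup>2) \<le> 1 \<longrightarrow>
     (LINT x|\<mu>. cmod (trig_poly J c x) ^ Suc n) \<le> B"
proof -
  have SG: "\<Sigma> \<subseteq> dual_group" using S by (simp add: sidon_set_def)
  obtain C where C: "C > 0" "\<And>J e. finite J \<Longrightarrow> J \<subseteq> \<Sigma> \<Longrightarrow> (\<And>\<gamma>. \<gamma> \<in> J \<Longrightarrow> cmod (e \<gamma>) \<le> 1) \<Longrightarrow> interpolable J e C"
    using sidon_constant[OF S] by metis
  define B where "B = C ^ Suc n * (2 * fact (Suc n) * exp 2)"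
  have "(LINT x|\<mu>. cmod (trig_poly J c x) ^ Suc n) \<le> B"
    if J: "finite J" "J \<subseteq> \<Sigma>" and c: "(\<Sum>\<gamma>\<in>J. (cmod (c \<gamma>))\<^sup>2) \<le> 1" for J c
  proof -
    have JG: "J \<subseteq> dual_group" using J SG by auto
    define s where "s A \<gamma> = complex_of_real (sgn_of A \<gamma>)" for A and \<gamma> :: "'g \<Rightarrow> complex"
    define I where "I = (LINT x|\<mu>. cmod (trig_poly J c x) ^ Suc n)"
    have le: "I \<le> C ^ Suc n * (LINT x|\<mu>. cmod (trig_poly J (\<lambda>\<gamma>. s A \<gamma> * c \<gamma>) x) ^ Suc n)" for A
    proof -
      have "interpolable J (s A) C"
        by (rule C(2)[OF J]) (simp add: s_def sgn_of_def)
      then obtain a where a: "integrable \<mu> a" "\<And>\<gamma>. \<gamma> \<in> J \<Longrightarrow> fourier \<mu> a \<gamma> = s A \<gamma>" "(LINT x|\<mu>. cmod (a x)) \<le> C"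
        unfolding interpolable_def by blast
      \<comment> \<open>The sign occurs twice, once in the coefficients and once through a, and its
        square is 1.\<close>
      have "trig_poly J (\<lambda>\<gamma>. fourier \<mu> a \<gamma> * (s A \<gamma> * c \<gamma>)) = trig_poly J c"
        by (rule trig_poly_cong) (simp add: a s_def sgn_of_def)
      then show ?thesis
        using young_trig_poly[OF a(1,3) C(1) J(1) JG, of "\<lambda>\<gamma>. s A \<gamma> * c \<gamma>" n] by (simp only: I_def)
    qed
    have int: "integrable \<mu> (\<lambda>x. cmod (trig_poly J d x) ^ Suc n)" for d
      using J JG by (intro polynomials_power_integrable polynomials_trig_poly)
    have "2 ^ card J * I = (\<Sum>A\<in>Pow J. I)" using J by (simp add: card_Pow)
    also have "\<dots> \<le> (\<Sum>A\<in>Pow J. C ^ Suc n * (LINT x|\<mu>. cmod (trig_poly J (\<lambda>\<gamma>. s A \<gamma> * c \<gamma>) x) ^ Suc n))"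
      by (intro sum_mono le)
    also have "\<dots> = C ^ Suc n * (LINT x|\<mu>. (\<Sum>A\<in>Pow J. cmod (trig_poly J (\<lambda>\<gamma>. s A \<gamma> * c \<gamma>) x) ^ Suc n))"
      by (simp only: sum_distrib_left[symmetric] Bochner_Integration.integral_sum[OF int])
    also have "\<dots> \<le> C ^ Suc n * (LINT x|\<mu>. 2 ^ card J * (2 * fact (Suc n) * exp 2))"
    proof (intro mult_left_mono integral_mono)
      show "integrable \<mu> (\<lambda>x. \<Sum>A\<in>Pow J. cmod (trig_poly J (\<lambda>\<gamma>. s A \<gamma> * c \<gamma>) x) ^ Suc n)"
        by (intro Bochner_Integration.integrable_sum int)
      fix x
      \<comment> \<open>Characters have modulus 1, so at every fixed x Khintchine applies with the
        same normalization.\<close>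
      have "(\<Sum>\<gamma>\<in>J. (cmod (c \<gamma> * \<gamma> x))\<^sup>2) = (\<Sum>\<gamma>\<in>J. (cmod (c \<gamma>))\<^sup>2)"
        using JG by (intro sum.cong) (auto simp: norm_mult character_norm)
      then have "(\<Sum>A\<in>Pow J. cmod (\<Sum>\<gamma>\<in>J. of_real (sgn_of A \<gamma>) * (c \<gamma> * \<gamma> x)) ^ Suc n) \<le> 2 ^ card J * (2 * fact (Suc n) * exp 2)"
        using c by (intro sum_Pow_sgn_of_power_le J) simp
      then show "(\<Sum>A\<in>Pow J. cmod (trig_poly J (\<lambda>\<gamma>. s A \<gamma> * c \<gamma>) x) ^ Suc n) \<le> 2 ^ card J * (2 * fact (Suc n) * exp 2)"
        by (simp add: trig_poly_def s_def mult.assoc)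
    qed (use C in auto)
    also have "\<dots> = 2 ^ card J * B" using prob_space by (simp add: B_def)
    finally show ?thesis by (simp add: I_def)
  qed
  moreover have "B > 0" using C(1) by (simp add: B_def)
  ultimately show ?thesis by blast
qed

lemma polynomials_powr_integrable:
  assumes "f \<in> polynomials" "0 \<le> q" shows "integrable \<mu> (\<lambda>x. cmod (f x) powr q)"
proof -
  obtain M where M: "\<And>x. cmod (f x) \<le> M" using polynomials_bounded[OF assms(1)] by blast
  show ?thesis
    by (rule integrable_bounded[of _ "M powr q"])
       (use polynomials_measurable[OF assms(1)] powr_mono2[OF assms(2) _ M] in auto)
qed

text \<open>By homogeneity c may be normalized; then the real exponent is absorbed into an integer
  moment through t^q <= 1 + t^(n+1).\<close>

lemma sidon_powr_bound:
  assumes S: "sidon_set \<mu> \<Sigma>" and q: "1 \<le> q"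
  shows "\<exists>B>0. \<forall>J c. finite J \<longrightarrow> J \<subseteq> \<Sigma> \<longrightarrow>
     (LINT x|\<mu>. cmod (trig_poly J c x) powr q) \<le> (B * l2_fin c J) powr q"
proof -
  obtain n where n: "q \<le> real n" using real_arch_simple by blast
  obtain B where B: "B > 0" "\<And>J c. finite J \<Longrightarrow> J \<subseteq> \<Sigma> \<Longrightarrow> (\<Sum>\<gamma>\<in>J. (cmod (c \<gamma>))\<^sup>2) \<le> 1 \<Longrightarrow>
     (LINT x|\<mu>. cmod (trig_poly J c x) ^ Suc n) \<le> B"
    using sidon_moment_bound[OF S, of n] by metis
  have SG: "\<Sigma> \<subseteq> dual_group" using S by (simp add: sidon_set_def)
  \<comment> \<open>Chosen so that its q-th power is 1 + B, where the 1 is the integral of the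
    constant in t^q <= 1 + t^(n+1).\<close>
  define B' where "B' = (1 + B) powr (1 / q)"
  have B'q: "B' powr q = 1 + B" using B q by (simp add: B'_def powr_powr)
  have "(LINT x|\<mu>. cmod (trig_poly J c x) powr q) \<le> (B' * l2_fin c J) powr q"
    if J: "finite J" "J \<subseteq> \<Sigma>" for J c
  proof (cases "l2_fin c J = 0")
    case True
    then show ?thesis using L2_set_eq_0_trig_poly[OF J(1) True] q by simp
  next
    case False
    define N where "N = l2_fin c J"
    have N: "N > 0" using False L2_set_nonneg[of "\<lambda>\<gamma>. cmod (c \<gamma>)" J] unfolding N_def by linarith
    define d where "d \<gamma> = c \<gamma> / of_real N" for \<gamma>
    have P: "trig_poly J d \<in> polynomials" using J SG by (intro polynomials_trig_poly) auto
    have "(\<Sum>\<gamma>\<in>J. (cmod (d \<gamma>))\<^sup>2) = (\<Sum>\<gamma>\<in>J. (cmod (c \<gamma>))\<^sup>2) / N\<^sup>2"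
      by (simp add: d_def norm_divide power_divide sum_divide_distrib)
    also have "(\<Sum>\<gamma>\<in>J. (cmod (c \<gamma>))\<^sup>2) = N\<^sup>2" by (simp add: N_def L2_set_def sum_nonneg)
    finally have "(\<Sum>\<gamma>\<in>J. (cmod (d \<gamma>))\<^sup>2) \<le> 1" using N by simp
    from B(2)[OF J this] have 1: "(LINT x|\<mu>. cmod (trig_poly J d x) ^ Suc n) \<le> B" .
    have intS: "integrable \<mu> (\<lambda>x. cmod (trig_poly J d x) ^ Suc n)"
      by (rule polynomials_power_integrable[OF P])
    have "(LINT x|\<mu>. cmod (trig_poly J d x) powr q) \<le> (LINT x|\<mu>. 1 + cmod (trig_poly J d x) ^ Suc n)"
      using q n by (intro integral_mono polynomials_powr_integrable P powr_le_one_plus_power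
          Bochner_Integration.integrable_add intS) auto
    also have "\<dots> = 1 + (LINT x|\<mu>. cmod (trig_poly J d x) ^ Suc n)"
      using intS prob_space by simp
    also have "\<dots> \<le> 1 + B" using 1 by simp
    finally have 2: "(LINT x|\<mu>. cmod (trig_poly J d x) powr q) \<le> 1 + B" .
    have "trig_poly J c x = of_real N * trig_poly J d x" for x
      using N by (simp add: trig_poly_scale d_def)
    then have "(LINT x|\<mu>. cmod (trig_poly J c x) powr q) = N powr q * (LINT x|\<mu>. cmod (trig_poly J d x) powr q)"
      using N by (simp add: norm_mult powr_mult)
    also have "\<dots> \<le> N powr q * (1 + B)" using 2 by (intro mult_left_mono) auto
    also have "\<dots> = (B' * N) powr q" using N B B'q by (simp add: powr_mult B'_def)
    finally show ?thesis by (simp add: N_def)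
  qed
  moreover have "B' > 0" using B by (simp add: B'_def)
  ultimately show ?thesis by blast
qed

end

section \<open>Truncation to bounded polynomials and the lower L_1 estimate\<close>

text \<open>Here t stands for |P(x)|, and the condition on n keeps S in [0, 1]. Since n S = (t/M)^2,
  Bernoulli for 1 + S gives (1 + n S)(1 - S)^n <= (1 - S^2)^n <= 1, and t/M <= 1 + (t/M)^2 turns
  this into the bound M. Bernoulli for 1 - S bounds the part cut away.\<close>

lemma power_one_minus_le:
  fixes t M :: real
  assumes t: "0 \<le> t" and M: "0 < M" and n: "0 < n" and T: "t\<^sup>2 \<le> real n * M\<^sup>2"
  defines "S \<equiv> t\<^sup>2 / (real n * M\<^sup>2)"
  shows "t * (1 - S) ^ n \<le> M" "t * (1 - (1 - S) ^ n) \<le> t ^ 3 / M\<^sup>2" "0 \<le> (1 - S) ^ n" "(1 - S) ^ n \<le> 1"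
proof -
  have S: "0 \<le> S" "S \<le> 1" using T n M by (auto simp: S_def divide_le_eq)
  show 0: "0 \<le> (1 - S) ^ n" "(1 - S) ^ n \<le> 1" using S by (auto intro: power_le_one)
  have nS: "real n * S = (t / M)\<^sup>2" using n M by (simp add: S_def power_divide)
  have "1 + real n * S \<le> (1 + S) ^ n" using S Bernoulli_inequality[of S n] by simp
  then have "(1 + real n * S) * (1 - S) ^ n \<le> (1 + S) ^ n * (1 - S) ^ n"
    using 0 by (intro mult_right_mono) auto
  also have "\<dots> = (1 - S\<^sup>2) ^ n" by (simp add: power_mult_distrib[symmetric] power2_eq_square algebra_simps)
  also have "\<dots> \<le> 1" using S by (intro power_le_one) (auto simp: power_le_one)
  finally have 1: "(1 + real n * S) * (1 - S) ^ n \<le> 1" .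
  have "u \<le> 1 + u\<^sup>2" if "0 \<le> u" for u :: real
    using sum_squares_bound[of u 1] that by simp
  then have "t / M \<le> 1 + real n * S" unfolding nS using t M by simp
  then have "t \<le> M * (1 + real n * S)" using M by (simp only: pos_divide_le_eq mult.commute)
  then have "t * (1 - S) ^ n \<le> M * (1 + real n * S) * (1 - S) ^ n" using 0 by (intro mult_right_mono) auto
  also have "\<dots> \<le> M * 1" using 1 M unfolding mult.assoc by (intro mult_left_mono) auto
  finally show "t * (1 - S) ^ n \<le> M" by simp
  have "1 - (1 - S) ^ n \<le> real n * S" using Bernoulli_inequality[of "- S" n] S by simp
  then have "t * (1 - (1 - S) ^ n) \<le> t * (t / M)\<^sup>2" using t nS by (intro mult_left_mono) auto
  then show "t * (1 - (1 - S) ^ n) \<le> t ^ 3 / M\<^sup>2" by (simp add: power_divide power3_eq_cube power2_eq_square)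
qed

context compact_haar begin

text \<open>The truncation \<open>P(1 - |P|\<^sup>2/(nM\<^sup>2))\<^sup>n\<close> is itself a polynomial, is bounded by \<open>M\<close> as soon as
  \<open>|P|\<^sup>2 \<le> nM\<^sup>2\<close>, and differs from \<open>P\<close> by at most \<open>|P|\<^sup>3/M\<^sup>2\<close>, which is controlled by the sixth
  moment.\<close>

lemma sidon_truncation:
  assumes S: "sidon_set \<mu> \<Sigma>"
  shows "\<exists>M>0. \<forall>J c. finite J \<longrightarrow> J \<subseteq> \<Sigma> \<longrightarrow>
     (\<exists>f\<in>polynomials. (\<forall>x. cmod (f x) \<le> M * l2_fin c J) \<and>
       (LINT x|\<mu>. (cmod (trig_poly J c x - f x))\<^sup>2) \<le> (l2_fin c J / 2)\<^sup>2)"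
proof -
  obtain B where B: "B > 0" "\<And>J c. finite J \<Longrightarrow> J \<subseteq> \<Sigma> \<Longrightarrow> (\<Sum>\<gamma>\<in>J. (cmod (c \<gamma>))\<^sup>2) \<le> 1 \<Longrightarrow>
     (LINT x|\<mu>. cmod (trig_poly J c x) ^ Suc 5) \<le> B"
    using sidon_moment_bound[OF S, of 5] by metis
  have SG: "\<Sigma> \<subseteq> dual_group" using S by (simp add: sidon_set_def)
  \<comment> \<open>The squared truncation error is at most |P|^6 / M^4, whose integral is at most B
    / M^4. As M >= 1, also M^4 >= M > 4 B, so this is at most 1/4, the square of the desired factor
    1/2.\<close>
  define M where "M = 4 * B + 1"
  have M: "M > 1" using B by (simp add: M_def)
  have "M ^ 1 \<le> M ^ 4" using M by (intro power_increasing) auto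
  then have BM: "B / M ^ 4 \<le> 1 / 4" using M B by (simp add: M_def divide_le_eq)
  have "\<exists>f\<in>polynomials. (\<forall>x. cmod (f x) \<le> M * l2_fin c J) \<and>
       (LINT x|\<mu>. (cmod (trig_poly J c x - f x))\<^sup>2) \<le> (l2_fin c J / 2)\<^sup>2"
    if J: "finite J" "J \<subseteq> \<Sigma>" for J c
  proof (cases "l2_fin c J = 0")
    case True
    then show ?thesis using L2_set_eq_0_trig_poly[OF J(1) True]
      by (intro bexI[of _ "\<lambda>x. 0"]) (auto intro: polynomials_const)
  next
    case False
    define N where "N = l2_fin c J"
    have N: "N > 0" using False L2_set_nonneg[of "\<lambda>\<gamma>. cmod (c \<gamma>)" J] unfolding N_def by linarith
    define d where "d \<gamma> = c \<gamma> / of_real N" for \<gamma>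
    define P where "P = trig_poly J d"
    have P: "P \<in> polynomials" unfolding P_def using J SG by (intro polynomials_trig_poly) auto
    have cP: "trig_poly J c x = of_real N * P x" for x
      using N by (simp add: P_def trig_poly_scale d_def)
    have "(\<Sum>\<gamma>\<in>J. (cmod (d \<gamma>))\<^sup>2) = (\<Sum>\<gamma>\<in>J. (cmod (c \<gamma>))\<^sup>2) / N\<^sup>2"
      by (simp add: d_def norm_divide power_divide sum_divide_distrib)
    also have "(\<Sum>\<gamma>\<in>J. (cmod (c \<gamma>))\<^sup>2) = N\<^sup>2" by (simp add: N_def L2_set_def sum_nonneg)
    finally have "(\<Sum>\<gamma>\<in>J. (cmod (d \<gamma>))\<^sup>2) \<le> 1" using N by simp
    from B(2)[OF J this] have P6: "(LINT x|\<mu>. cmod (P x) ^ 6) \<le> B" by (simp add: P_def)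
    obtain R where R: "R > 0" "\<And>x. cmod (P x) \<le> R" using polynomials_bounded[OF P] by blast
    \<comment> \<open>The degree n depends on the sup norm of P, but M and the error bound do not
      depend on n.\<close>
    obtain n where n: "R\<^sup>2 / M\<^sup>2 < real n" using reals_Archimedean2 by blast
    have n0: "0 < n"
    proof (rule ccontr)
      assume "\<not> 0 < n"
      then have "R\<^sup>2 / M\<^sup>2 < 0" using n by simp
      moreover have "0 \<le> R\<^sup>2 / M\<^sup>2" by simp
      ultimately show False by linarith
    qed
    have nP: "(cmod (P x))\<^sup>2 \<le> real n * M\<^sup>2" for x
    proof -
      have "(cmod (P x))\<^sup>2 \<le> R\<^sup>2" by (intro power_mono R) auto
      also have "\<dots> \<le> real n * M\<^sup>2" using n M by (simp add: divide_less_eq)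
      finally show ?thesis .
    qed
    define s where "s x = (1 - (cmod (P x))\<^sup>2 / (real n * M\<^sup>2)) ^ n" for x
    define f where "f x = P x * of_real (s x)" for x
    have M0: "0 < M" using M by simp
    note trunc = power_one_minus_le[OF norm_ge_zero M0 n0 nP, folded s_def]
    \<comment> \<open>The cut-off stays within the polynomials because |P|^2 is P times its
      conjugate.\<close>
    have "f = (\<lambda>x. P x * (1 + (- 1 / of_real (real n * M\<^sup>2)) * (P x * cnj (P x))) ^ n)"
      by (auto simp: f_def s_def complex_norm_square[symmetric])
    also have "\<dots> \<in> polynomials"
      by (intro polynomials_mult polynomials_power polynomials_add polynomials_const polynomials_scale polynomials_cnj P)
    finally have f: "f \<in> polynomials" .
    have fM: "cmod (f x) \<le> M" for x
      using trunc(1,3)[of x] by (simp add: f_def norm_mult)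
    have diff: "(cmod (P x - f x))\<^sup>2 \<le> cmod (P x) ^ 6 / M ^ 4" for x
    proof -
      have "P x - f x = P x * of_real (1 - s x)" by (simp add: f_def algebra_simps)
      then have "cmod (P x - f x) = cmod (P x) * (1 - s x)"
        using trunc(4)[of x] by (simp add: norm_mult del: of_real_diff)
      then have "cmod (P x - f x) \<le> cmod (P x) ^ 3 / M\<^sup>2" using trunc(2)[of x] by linarith
      then have "(cmod (P x - f x))\<^sup>2 \<le> (cmod (P x) ^ 3 / M\<^sup>2)\<^sup>2"
        by (rule power_mono) (rule norm_ge_zero)
      then show ?thesis by (simp add: power_divide power_mult[symmetric])
    qed
    have intP: "integrable \<mu> (\<lambda>x. cmod (P x) ^ 6)" by (rule polynomials_power_integrable[OF P])
    have Pf: "(\<lambda>x. P x + (- 1) * f x) \<in> polynomials" by (intro polynomials_add polynomials_scale P f)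
    have intPf: "integrable \<mu> (\<lambda>x. (cmod (P x - f x))\<^sup>2)"
      using polynomials_power_integrable[OF Pf, of 2] by simp
    have "(LINT x|\<mu>. (cmod (P x - f x))\<^sup>2) \<le> (LINT x|\<mu>. cmod (P x) ^ 6 / M ^ 4)"
      by (intro integral_mono intPf diff) (use intP in auto)
    also have "\<dots> \<le> B / M ^ 4" using P6 M by (simp add: divide_right_mono)
    also have "\<dots> \<le> 1 / 4" by (rule BM)
    finally have 4: "(LINT x|\<mu>. (cmod (P x - f x))\<^sup>2) \<le> 1 / 4" .
    show ?thesis
    proof (intro bexI conjI allI)
      show "(\<lambda>x. of_real N * f x) \<in> polynomials" by (intro polynomials_scale f)
      fix x
      show "cmod (of_real N * f x) \<le> M * l2_fin c J"
        using fM[of x] N by (simp add: norm_mult N_def[symmetric] mult.commute)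
    next
      have "(cmod (trig_poly J c x - of_real N * f x))\<^sup>2 = N\<^sup>2 * (cmod (P x - f x))\<^sup>2" for x
        using N by (simp add: cP right_diff_distrib[symmetric] norm_mult power_mult_distrib)
      then have "(LINT x|\<mu>. (cmod (trig_poly J c x - of_real N * f x))\<^sup>2) = N\<^sup>2 * (LINT x|\<mu>. (cmod (P x - f x))\<^sup>2)"
        by simp
      also have "\<dots> \<le> N\<^sup>2 * (1 / 4)" using 4 by (intro mult_left_mono) auto
      finally show "(LINT x|\<mu>. (cmod (trig_poly J c x - of_real N * f x))\<^sup>2) \<le> (l2_fin c J / 2)\<^sup>2"
        by (simp add: N_def[symmetric] power_divide)
    qed
  qed
  moreover have "M > 0" using M by simp
  ultimately show ?thesis by blast
qed

text \<open>With f the truncation of P, |P|^2 <= |P| |f| + |P| |P - f|. The first term integrates to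
  at most M N times the L_1 norm of P; the second is absorbed into the left side because P - f has
  L_2 norm at most N/2.\<close>

lemma sidon_L1_lower_bound:
  assumes S: "sidon_set \<mu> \<Sigma>"
  shows "\<exists>M>0. \<forall>J c. finite J \<longrightarrow> J \<subseteq> \<Sigma> \<longrightarrow>
     l2_fin c J \<le> M * (LINT x|\<mu>. cmod (trig_poly J c x))"
proof -
  obtain M where M0: "M > 0" and "\<forall>J c. finite J \<longrightarrow> J \<subseteq> \<Sigma> \<longrightarrow>
     (\<exists>f\<in>polynomials. (\<forall>x. cmod (f x) \<le> M * l2_fin c J) \<and>
       (LINT x|\<mu>. (cmod (trig_poly J c x - f x))\<^sup>2) \<le> (l2_fin c J / 2)\<^sup>2)"
    using sidon_truncation[OF S] by (elim exE conjE) (rule that)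
  note M = M0 this(2)[rule_format]
  have SG: "\<Sigma> \<subseteq> dual_group" using S by (simp add: sidon_set_def)
  \<comment> \<open>The absorbed terms are N^2/2 and N^2/8, leaving 3/8 of N^2; the resulting factor
    8/3 is rounded up to 3.\<close>
  have "l2_fin c J \<le> (3 * M) * (LINT x|\<mu>. cmod (trig_poly J c x))"
    if J: "finite J" "J \<subseteq> \<Sigma>" for J c
  proof -
    define N where "N = l2_fin c J"
    define P where "P = trig_poly J c"
    have N0: "N \<ge> 0" by (simp add: N_def L2_set_nonneg)
    have JG: "J \<subseteq> dual_group" using J SG by auto
    have P: "P \<in> polynomials" unfolding P_def using J JG by (intro polynomials_trig_poly)
    have P2: "(LINT x|\<mu>. (cmod (P x))\<^sup>2) = N\<^sup>2"
      unfolding P_def using parseval_trig_poly[OF J(1) JG] by (simp add: N_def L2_set_def sum_nonneg)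
    obtain f where f: "f \<in> polynomials" "\<And>x. cmod (f x) \<le> M * N"
       "(LINT x|\<mu>. (cmod (P x - f x))\<^sup>2) \<le> (N / 2)\<^sup>2"
      using M(2)[OF J, of c] unfolding N_def P_def by blast
    have Pf: "(\<lambda>x. P x - f x) \<in> polynomials"
      using polynomials_add[OF P polynomials_scale[OF f(1), of "-1"]] by simp
    have pt: "(cmod (P x))\<^sup>2 \<le> M * N * cmod (P x) + ((cmod (P x))\<^sup>2 / 2 + (cmod (P x - f x))\<^sup>2 / 2)" for x
    proof -
      have "cmod (P x) \<le> cmod (f x) + cmod (P x - f x)" using norm_triangle_ineq[of "f x" "P x - f x"] by simp
      then have "cmod (P x) \<le> M * N + cmod (P x - f x)" using f(2)[of x] by linarith
      then have "cmod (P x) * cmod (P x) \<le> cmod (P x) * (M * N + cmod (P x - f x))" by (intro mult_left_mono) auto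
      moreover have "2 * cmod (P x) * cmod (P x - f x) \<le> (cmod (P x))\<^sup>2 + (cmod (P x - f x))\<^sup>2"
        by (rule sum_squares_bound)
      ultimately show ?thesis by (simp add: power2_eq_square algebra_simps)
    qed
    have int: "integrable \<mu> (\<lambda>x. (cmod (P x))\<^sup>2)" "integrable \<mu> (\<lambda>x. cmod (P x))" "integrable \<mu> (\<lambda>x. (cmod (P x - f x))\<^sup>2)"
      using polynomials_power_integrable[OF P, of 2] polynomials_power_integrable[OF P, of 1] polynomials_power_integrable[OF Pf, of 2] by simp_all
    have "N\<^sup>2 \<le> (LINT x|\<mu>. M * N * cmod (P x) + ((cmod (P x))\<^sup>2 / 2 + (cmod (P x - f x))\<^sup>2 / 2))"
      unfolding P2[symmetric] by (intro integral_mono pt) (use int in auto)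
    also have "\<dots> = M * N * (LINT x|\<mu>. cmod (P x)) + (N\<^sup>2 / 2 + (LINT x|\<mu>. (cmod (P x - f x))\<^sup>2) / 2)"
      using int P2 by simp
    also have "\<dots> \<le> M * N * (LINT x|\<mu>. cmod (P x)) + (N\<^sup>2 / 2 + (N / 2)\<^sup>2 / 2)"
      using f(3) by simp
    finally have "3 / 8 * N\<^sup>2 \<le> M * N * (LINT x|\<mu>. cmod (P x))" by (simp add: power_divide)
    then have "N * (3 * N) \<le> N * (8 * (M * (LINT x|\<mu>. cmod (P x))))" by (simp add: power2_eq_square algebra_simps)
    moreover have "0 \<le> M * (LINT x|\<mu>. cmod (P x))"
      using M by (intro mult_nonneg_nonneg Bochner_Integration.integral_nonneg) auto
    ultimately have "N \<le> 3 * (M * (LINT x|\<mu>. cmod (P x)))"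
      using N0 by (cases "N = 0") auto
    then show ?thesis by (simp add: N_def P_def)
  qed
  then show ?thesis using M0 by (intro exI[of _ "3 * M"]) simp
qed

end

section \<open>Lebesgue spaces\<close>

lemma powr_add_le_two_powr:
  fixes a b r :: real assumes "0 \<le> a" "0 \<le> b" "0 \<le> r"
  shows "(a + b) powr r \<le> 2 powr r * (a powr r + b powr r)"
proof -
  have "(a + b) powr r \<le> (2 * max a b) powr r" using assms by (intro powr_mono2) auto
  also have "\<dots> = 2 powr r * max a b powr r" using assms by (simp add: powr_mult)
  also have "max a b powr r \<le> a powr r + b powr r" by (simp add: max_def)
  finally show ?thesis by simp
qed

context compact_haar begin

lemma borel_measurable_haar_iff: "f \<in> borel_measurable \<mu> \<longleftrightarrow> f \<in> borel_measurable borel"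
  by (simp add: measurable_cong_sets[OF sets_haar refl])

lemma Lp_functions_measurable: "f \<in> Lp_functions \<mu> p \<Longrightarrow> f \<in> borel_measurable borel"
  by (simp add: Lp_functions_def borel_measurable_haar_iff)

lemma Lp_functions_bounded:
  assumes f: "f \<in> borel_measurable borel" and L: "\<And>x. cmod (f x) \<le> L" and p: "1 \<le> p"
  shows "f \<in> Lp_functions \<mu> p" "Lp_norm \<mu> p f \<le> L"
proof -
  have [measurable]: "f \<in> borel_measurable \<mu>" using f by simp
  have L0: "0 \<le> L" using order_trans[OF norm_ge_zero L] .
  have "f \<in> Lp_functions \<mu> p \<and> Lp_norm \<mu> p f \<le> L"
  proof (cases "p = \<infinity>")
    case True
    have le: "esssup \<mu> (\<lambda>x. ennreal (cmod (f x))) \<le> ennreal L"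
      by (intro esssup_I) (use L in \<open>auto intro: ennreal_leI\<close>)
    then have "esssup \<mu> (\<lambda>x. ennreal (cmod (f x))) < \<infinity>" using ennreal_less_top[of L] by (simp add: order_le_less_trans)
    moreover have "enn2real (esssup \<mu> (\<lambda>x. ennreal (cmod (f x)))) \<le> L" using enn2real_mono[OF le] L0 by simp
    ultimately show ?thesis using True by (simp add: Lp_functions_def Lp_norm_def)
  next
    case False
    define r where "r = enn2real p"
    have "1 \<le> r" using p False enn2real_mono[of 1 p] by (simp add: r_def top.not_eq_extremum)
    have b: "cmod (f x) powr r \<le> L powr r" for x using L \<open>1 \<le> r\<close> by (intro powr_mono2) auto
    have int: "integrable \<mu> (\<lambda>x. cmod (f x) powr r)"
      by (rule integrable_bounded[of _ "L powr r"]) (use f b in auto)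
    have "(LINT x|\<mu>. cmod (f x) powr r) \<le> (LINT x|\<mu>. L powr r)"
      by (intro integral_mono int b) auto
    also have "\<dots> = L powr r" using prob_space by simp
    finally have "(LINT x|\<mu>. cmod (f x) powr r) powr (1 / r) \<le> (L powr r) powr (1 / r)"
      using \<open>1 \<le> r\<close> by (intro powr_mono2 Bochner_Integration.integral_nonneg) auto
    then have "Lp_norm \<mu> p f \<le> L" using False \<open>1 \<le> r\<close> L0 by (simp add: Lp_norm_def r_def powr_powr)
    then show ?thesis using False int by (simp add: Lp_functions_def r_def)
  qed
  then show "f \<in> Lp_functions \<mu> p" "Lp_norm \<mu> p f \<le> L" by auto
qed

lemma polynomials_Lp_functions:
  assumes "f \<in> polynomials" "1 \<le> p" shows "f \<in> Lp_functions \<mu> p"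
  using polynomials_bounded[OF assms(1)] Lp_functions_bounded(1)[OF polynomials_measurable[OF assms(1)] _ assms(2)]
  by blast

lemma Lp_norm_nonneg: "0 \<le> Lp_norm \<mu> p f"
  by (simp add: Lp_norm_def)

end

locale compact_haar_exponent = compact_haar \<mu>
  for \<mu> :: "'g::{topological_ab_group_add, t2_space} measure" +
  fixes q :: ennreal
  assumes q_ge: "1 \<le> q" and q_less: "q < \<infinity>"
begin

definition "r = enn2real q"

abbreviation "Lq_norm \<equiv> Lp_norm \<mu> q"
abbreviation "Lq \<equiv> Lp_functions \<mu> q"

lemma q_eq: "q \<noteq> \<infinity>" "q \<noteq> top"
  using q_less by auto

lemma r_ge: "1 \<le> r"
  using enn2real_mono[OF q_ge] q_less by (simp add: r_def)

lemma Lq_functions_iff: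
  "f \<in> Lq \<longleftrightarrow> f \<in> borel_measurable borel \<and> integrable \<mu> (\<lambda>x. cmod (f x) powr r)"
  by (simp add: Lp_functions_def q_eq r_def borel_measurable_haar_iff)

lemma Lq_norm_eq: "Lq_norm f = (LINT x|\<mu>. cmod (f x) powr r) powr (1 / r)"
  by (simp add: Lp_norm_def q_eq r_def)

lemma Lq_norm_powr: "Lq_norm f powr r = (LINT x|\<mu>. cmod (f x) powr r)"
  unfolding Lq_norm_eq using r_ge by (simp add: powr_powr Bochner_Integration.integral_nonneg)

lemma Lq_norm_le_iff:
  assumes "0 \<le> L"
  shows "Lq_norm f \<le> L \<longleftrightarrow> (LINT x|\<mu>. cmod (f x) powr r) \<le> L powr r"
  unfolding Lq_norm_powr[symmetric]
proof
  assume "Lq_norm f \<le> L"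
  then show "Lq_norm f powr r \<le> L powr r"
    using r_ge by (intro powr_mono2 Lp_norm_nonneg) auto
next
  assume "Lq_norm f powr r \<le> L powr r"
  then have "(Lq_norm f powr r) powr (1 / r) \<le> (L powr r) powr (1 / r)"
    by (rule powr_mono2[rotated 2]) (use r_ge in auto)
  then show "Lq_norm f \<le> L" using r_ge assms by (simp add: powr_powr Lp_norm_nonneg)
qed

lemma Lq_nn_integral:
  assumes f: "f \<in> borel_measurable borel" and L: "0 \<le> L"
    and le: "(\<integral>\<^sup>+x. ennreal (cmod (f x) powr r) \<partial>\<mu>) \<le> ennreal (L powr r)"
  shows "f \<in> Lq" "Lq_norm f \<le> L"
proof -
  have [measurable]: "f \<in> borel_measurable \<mu>" using f by simp
  have "(\<integral>\<^sup>+x. ennreal (cmod (f x) powr r) \<partial>\<mu>) < \<infinity>"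
    using le ennreal_less_top[of "L powr r"] by (simp add: order_le_less_trans)
  then have int: "integrable \<mu> (\<lambda>x. cmod (f x) powr r)"
    by (intro integrableI_nonneg) auto
  then show "f \<in> Lq" using f by (simp add: Lq_functions_iff)
  have "ennreal (LINT x|\<mu>. cmod (f x) powr r) \<le> ennreal (L powr r)"
    using le int by (subst nn_integral_eq_integral[symmetric]) auto
  then show "Lq_norm f \<le> L" using L by (simp add: Lq_norm_le_iff)
qed

lemma Lq_AE_cong:
  assumes "f \<in> borel_measurable borel" "g \<in> borel_measurable borel" "AE x in \<mu>. f x = g x"
  shows "f \<in> Lq \<longleftrightarrow> g \<in> Lq" "Lq_norm f = Lq_norm g"
proof -
  have [measurable]: "f \<in> borel_measurable \<mu>" "g \<in> borel_measurable \<mu>" using assms by auto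
  have "AE x in \<mu>. cmod (f x) powr r = cmod (g x) powr r" using assms(3) by eventually_elim simp
  then have "integrable \<mu> (\<lambda>x. cmod (f x) powr r) = integrable \<mu> (\<lambda>x. cmod (g x) powr r)"
    "(LINT x|\<mu>. cmod (f x) powr r) = (LINT x|\<mu>. cmod (g x) powr r)"
    by (intro integrable_cong_AE integral_cong_AE; measurable)+
  then show "f \<in> Lq \<longleftrightarrow> g \<in> Lq" "Lq_norm f = Lq_norm g"
    using assms by (simp_all add: Lq_functions_iff Lq_norm_eq)
qed

lemma Lq_scale:
  assumes "f \<in> Lq"
  shows "(\<lambda>x. t * f x) \<in> Lq" "Lq_norm (\<lambda>x. t * f x) = cmod t * Lq_norm f"
proof -
  have [measurable]: "f \<in> borel_measurable borel" using assms by (rule Lp_functions_measurable)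
  have eq: "cmod (t * f x) powr r = cmod t powr r * cmod (f x) powr r" for x
    by (simp add: norm_mult powr_mult)
  show "(\<lambda>x. t * f x) \<in> Lq"
    using assms unfolding Lq_functions_iff eq by auto
  show "Lq_norm (\<lambda>x. t * f x) = cmod t * Lq_norm f"
    unfolding Lq_norm_eq eq using r_ge
    by (simp add: powr_mult powr_powr Bochner_Integration.integral_nonneg)
qed

text \<open>Minkowski's inequality up to a constant is enough throughout.\<close>

lemma Lq_add:
  assumes f: "f \<in> Lq" and g: "g \<in> Lq"
  shows "(\<lambda>x. f x + g x) \<in> Lq"
    "Lq_norm f \<le> L \<Longrightarrow> Lq_norm g \<le> L \<Longrightarrow> Lq_norm (\<lambda>x. f x + g x) \<le> 4 * L"
proof -
  have [measurable]: "f \<in> borel_measurable \<mu>" "g \<in> borel_measurable \<mu>"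
    using f g Lp_functions_measurable[of f] Lp_functions_measurable[of g] by auto
  have int: "integrable \<mu> (\<lambda>x. cmod (f x) powr r)" "integrable \<mu> (\<lambda>x. cmod (g x) powr r)"
    using f g by (auto simp: Lq_functions_iff)
  have le: "cmod (f x + g x) powr r \<le> 2 powr r * (cmod (f x) powr r + cmod (g x) powr r)" for x
  proof -
    have "cmod (f x + g x) powr r \<le> (cmod (f x) + cmod (g x)) powr r"
      using r_ge by (intro powr_mono2 norm_triangle_ineq) auto
    also have "\<dots> \<le> 2 powr r * (cmod (f x) powr r + cmod (g x) powr r)"
      using r_ge by (intro powr_add_le_two_powr) auto
    finally show ?thesis .
  qed
  have intb: "integrable \<mu> (\<lambda>x. 2 powr r * (cmod (f x) powr r + cmod (g x) powr r))" using int by auto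
  have ints: "integrable \<mu> (\<lambda>x. cmod (f x + g x) powr r)"
    by (rule Bochner_Integration.integrable_bound[OF intb])
       (use le in \<open>auto intro!: AE_I2 simp: abs_mult abs_of_nonneg add_nonneg_nonneg\<close>)
  show "(\<lambda>x. f x + g x) \<in> Lq"
    using ints unfolding Lq_functions_iff by auto
  assume L: "Lq_norm f \<le> L" "Lq_norm g \<le> L"
  then have L0: "0 \<le> L" using Lp_norm_nonneg[of q f] by linarith
  have "(LINT x|\<mu>. cmod (f x + g x) powr r) \<le> (LINT x|\<mu>. 2 powr r * (cmod (f x) powr r + cmod (g x) powr r))"
    by (intro integral_mono ints intb le)
  also have "\<dots> = 2 powr r * ((LINT x|\<mu>. cmod (f x) powr r) + (LINT x|\<mu>. cmod (g x) powr r))"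
    using int by simp
  also have "\<dots> \<le> 2 powr r * (L powr r + L powr r)"
    using L L0 by (intro mult_left_mono add_mono) (auto simp: Lq_norm_le_iff)
  \<comment> \<open>Since r >= 1, the factor 2 is at most 2^r, which makes the whole constant
    4^r.\<close>
  also have "\<dots> = 2 powr r * 2 powr 1 * L powr r" by simp
  also have "\<dots> \<le> 2 powr r * 2 powr r * L powr r"
    using r_ge by (intro mult_right_mono mult_left_mono powr_mono) auto
  also have "\<dots> = (4 * L) powr r"
    using L0 by (simp add: powr_mult[symmetric])
  finally show "Lq_norm (\<lambda>x. f x + g x) \<le> 4 * L" using L0 by (simp add: Lq_norm_le_iff)
qed

lemma Lq_diff:
  assumes f: "f \<in> Lq" and g: "g \<in> Lq"
  shows "(\<lambda>x. f x - g x) \<in> Lq"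
    "Lq_norm f \<le> L \<Longrightarrow> Lq_norm g \<le> L \<Longrightarrow> Lq_norm (\<lambda>x. f x - g x) \<le> 4 * L"
  using Lq_add[OF f Lq_scale(1)[OF g, of "- 1"]] Lq_scale(2)[OF g, of "- 1"] by simp_all

lemma Lq_norm_minus_commute:
  "Lq_norm (\<lambda>x. f x - g x) = Lq_norm (\<lambda>x. g x - f x)"
  by (simp add: Lq_norm_eq norm_minus_commute)

lemma Lq_integrable:
  assumes f: "f \<in> Lq" shows "integrable \<mu> f"
proof -
  have [measurable]: "f \<in> borel_measurable \<mu>" using Lp_functions_measurable[OF f] by simp
  have intb: "integrable \<mu> (\<lambda>x. 1 + cmod (f x) powr r)" using f by (auto simp: Lq_functions_iff)
  have "t \<le> 1 + t powr r" if "0 \<le> t" for t :: real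
  proof (cases "t \<le> 1")
    case False
    then have "t powr 1 \<le> t powr r" using r_ge by (intro powr_mono) auto
    then show ?thesis using that by simp
  qed (use powr_ge_zero[of t r] in linarith)
  then show ?thesis
    by (intro Bochner_Integration.integrable_bound[OF intb]) (auto intro!: AE_I2)
qed

text \<open>Integrating t <= K (1 + (t/K)^r) replaces Hoelder's inequality at the price of the
  factor 2. The scale K is taken above L so that it is positive even when L = 0.\<close>

lemma integral_le_Lq_norm:
  assumes f: "f \<in> Lq" and L: "Lq_norm f \<le> L"
  shows "(LINT x|\<mu>. cmod (f x)) \<le> 2 * L"
proof -
  have L0: "0 \<le> L" using L Lp_norm_nonneg[of q f] by linarith
  have "(LINT x|\<mu>. cmod (f x)) \<le> 2 * K" if "L \<le> K" "0 < K" for K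
  proof -
    have "t \<le> K * (1 + t powr r / K powr r)" if "0 \<le> t" for t
    proof (cases "t \<le> K")
      case True
      then have "t \<le> K * 1" by simp
      also have "\<dots> \<le> K * (1 + t powr r / K powr r)" using \<open>0 < K\<close> by (intro mult_left_mono) auto
      finally show ?thesis .
    next
      case False
      then have "(t / K) powr 1 \<le> (t / K) powr r" using r_ge \<open>0 < K\<close> by (intro powr_mono) auto
      then have "t / K \<le> 1 + t powr r / K powr r" using that \<open>0 < K\<close> by (simp add: powr_divide)
      then show ?thesis using \<open>0 < K\<close> by (simp add: divide_le_eq mult.commute)
    qed
    then have "(LINT x|\<mu>. cmod (f x)) \<le> (LINT x|\<mu>. K * (1 + cmod (f x) powr r / K powr r))"
      using Lq_integrable[OF f] f by (intro integral_mono) (auto simp: Lq_functions_iff)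
    also have "\<dots> = K * (1 + (LINT x|\<mu>. cmod (f x) powr r) / K powr r)"
      using f prob_space by (simp add: Lq_functions_iff)
    also have "\<dots> \<le> K * (1 + K powr r / K powr r)"
    proof -
      have "(LINT x|\<mu>. cmod (f x) powr r) \<le> K powr r" using L that by (subst Lq_norm_le_iff[symmetric]) auto
      then show ?thesis using \<open>0 < K\<close> by (intro mult_left_mono add_mono divide_right_mono) auto
    qed
    also have "\<dots> = 2 * K" using \<open>0 < K\<close> by simp
    finally show ?thesis .
  qed
  note * = this
  show ?thesis
  proof (rule field_le_epsilon)
    fix e :: real assume "0 < e"
    then show "(LINT x|\<mu>. cmod (f x)) \<le> 2 * L + e" using *[of "L + e / 2"] L0 by simp
  qed
qed

lemma Lq_norm_le_0_AE:
  assumes f: "f \<in> Lq" and L: "Lq_norm f \<le> 0"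
  shows "AE x in \<mu>. f x = 0"
proof -
  have "(LINT x|\<mu>. cmod (f x)) = 0"
    using integral_le_Lq_norm[OF f L] by (intro antisym Bochner_Integration.integral_nonneg) auto
  then have "AE x in \<mu>. cmod (f x) = 0"
    using integral_nonneg_eq_0_iff_AE[of \<mu> "\<lambda>x. cmod (f x)"] Lq_integrable[OF f] by auto
  then show ?thesis by simp
qed

end

section \<open>The summation operator\<close>

abbreviation l2_norm :: "'s set \<Rightarrow> ('s \<Rightarrow> complex) \<Rightarrow> real" where
  "l2_norm \<Sigma> \<equiv> qnorm (l2 \<Sigma>)"

lemma l2_carrier_iff:
  "c \<in> carrier (l2 \<Sigma>) \<longleftrightarrow> c \<in> functions_on \<Sigma> \<and> (\<lambda>\<gamma>. (cmod (c \<gamma>))\<^sup>2) summable_on \<Sigma>"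
  by (simp add: l2_def)

lemma l2_norm_eq: "l2_norm \<Sigma> c = sqrt (\<Sum>\<^sub>\<infinity>\<gamma>\<in>\<Sigma>. (cmod (c \<gamma>))\<^sup>2)"
  by (simp add: l2_def)

lemma l2_norm_nonneg: "0 \<le> l2_norm \<Sigma> c"
  by (simp add: l2_norm_eq infsum_nonneg)

lemma l2_fin_le_l2_norm:
  assumes "c \<in> carrier (l2 \<Sigma>)" "finite J" "J \<subseteq> \<Sigma>" shows "l2_fin c J \<le> l2_norm \<Sigma> c"
  unfolding L2_set_def l2_norm_eq
  by (intro real_sqrt_le_mono finite_sum_le_infsum) (use assms in \<open>auto simp: l2_carrier_iff\<close>)

lemma l2_boundedI:
  assumes c: "c \<in> functions_on \<Sigma>" and b: "0 \<le> b"
    and J: "\<And>J. finite J \<Longrightarrow> J \<subseteq> \<Sigma> \<Longrightarrow> l2_fin c J \<le> b"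
  shows "c \<in> carrier (l2 \<Sigma>)" "l2_norm \<Sigma> c \<le> b"
proof -
  have le: "(\<Sum>\<gamma>\<in>J. (cmod (c \<gamma>))\<^sup>2) \<le> b\<^sup>2" if "finite J" "J \<subseteq> \<Sigma>" for J
    using J[OF that] b by (simp add: L2_set_def real_sqrt_le_iff' sum_nonneg)
  have s: "(\<lambda>\<gamma>. (cmod (c \<gamma>))\<^sup>2) summable_on \<Sigma>"
    by (rule nonneg_bdd_above_summable_on) (auto intro!: bdd_aboveI[of _ "b\<^sup>2"] le)
  then show "c \<in> carrier (l2 \<Sigma>)" using c by (simp add: l2_carrier_iff)
  have "(\<Sum>\<^sub>\<infinity>\<gamma>\<in>\<Sigma>. (cmod (c \<gamma>))\<^sup>2) \<le> b\<^sup>2"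
    using s le by (intro infsum_le_finite_sums) auto
  then show "l2_norm \<Sigma> c \<le> b" unfolding l2_norm_eq using b real_le_lsqrt by (simp add: infsum_nonneg)
qed

lemma l2_add:
  assumes "c \<in> carrier (l2 \<Sigma>)" "d \<in> carrier (l2 \<Sigma>)"
  shows "(\<lambda>\<gamma>. c \<gamma> + d \<gamma>) \<in> carrier (l2 \<Sigma>)" "l2_norm \<Sigma> (\<lambda>\<gamma>. c \<gamma> + d \<gamma>) \<le> l2_norm \<Sigma> c + l2_norm \<Sigma> d"
proof -
  have "l2_fin (\<lambda>\<gamma>. c \<gamma> + d \<gamma>) J \<le> l2_norm \<Sigma> c + l2_norm \<Sigma> d" if "finite J" "J \<subseteq> \<Sigma>" for J
  proof -
    have "l2_fin (\<lambda>\<gamma>. c \<gamma> + d \<gamma>) J \<le> L2_set (\<lambda>\<gamma>. cmod (c \<gamma>) + cmod (d \<gamma>)) J"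
      by (intro L2_set_mono norm_triangle_ineq) auto
    also have "\<dots> \<le> l2_fin c J + l2_fin d J" by (rule L2_set_triangle_ineq)
    also have "\<dots> \<le> l2_norm \<Sigma> c + l2_norm \<Sigma> d"
      using assms that by (intro add_mono l2_fin_le_l2_norm)
    finally show ?thesis .
  qed
  moreover have "(\<lambda>\<gamma>. c \<gamma> + d \<gamma>) \<in> functions_on \<Sigma>" using assms by (auto simp: l2_carrier_iff functions_on_def)
  ultimately show "(\<lambda>\<gamma>. c \<gamma> + d \<gamma>) \<in> carrier (l2 \<Sigma>)" "l2_norm \<Sigma> (\<lambda>\<gamma>. c \<gamma> + d \<gamma>) \<le> l2_norm \<Sigma> c + l2_norm \<Sigma> d"
    using l2_boundedI[of "\<lambda>\<gamma>. c \<gamma> + d \<gamma>" \<Sigma> "l2_norm \<Sigma> c + l2_norm \<Sigma> d"] by (auto simp: l2_norm_nonneg)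
qed

text \<open>Negation, scaling, restriction and multiplication by a bounded function are all handled
  as instances.\<close>

lemma l2_dominated:
  assumes c: "c \<in> carrier (l2 \<Sigma>)" and K: "0 \<le> K" and le: "\<And>\<gamma>. cmod (d \<gamma>) \<le> K * cmod (c \<gamma>)"
  shows "d \<in> carrier (l2 \<Sigma>)" "l2_norm \<Sigma> d \<le> K * l2_norm \<Sigma> c"
proof -
  have "l2_fin d J \<le> K * l2_norm \<Sigma> c" if "finite J" "J \<subseteq> \<Sigma>" for J
  proof -
    have "l2_fin d J \<le> L2_set (\<lambda>\<gamma>. K * cmod (c \<gamma>)) J" by (intro L2_set_mono le) auto
    also have "\<dots> = K * l2_fin c J" using K by (simp add: L2_set_right_distrib)
    also have "\<dots> \<le> K * l2_norm \<Sigma> c"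
      using c that K by (intro mult_left_mono l2_fin_le_l2_norm)
    finally show ?thesis .
  qed
  moreover have "d \<in> functions_on \<Sigma>"
    unfolding functions_on_def
  proof (intro CollectI allI impI)
    fix \<gamma> assume "\<gamma> \<notin> \<Sigma>"
    then have "c \<gamma> = 0" using c by (auto simp: l2_carrier_iff functions_on_def)
    then show "d \<gamma> = 0" using le[of \<gamma>] by simp
  qed
  ultimately show "d \<in> carrier (l2 \<Sigma>)" "l2_norm \<Sigma> d \<le> K * l2_norm \<Sigma> c"
    using l2_boundedI[of d \<Sigma> "K * l2_norm \<Sigma> c"] K by (auto simp: l2_norm_nonneg)
qed

lemma l2_diff:
  assumes c: "c \<in> carrier (l2 \<Sigma>)" and d: "d \<in> carrier (l2 \<Sigma>)"
  shows "(\<lambda>\<gamma>. c \<gamma> - d \<gamma>) \<in> carrier (l2 \<Sigma>)" "l2_norm \<Sigma> (\<lambda>\<gamma>. c \<gamma> - d \<gamma>) \<le> l2_norm \<Sigma> c + l2_norm \<Sigma> d"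
  using l2_add[OF c l2_dominated(1)[OF d, of 1 "\<lambda>\<gamma>. - d \<gamma>"]] l2_dominated(2)[OF d, of 1 "\<lambda>\<gamma>. - d \<gamma>"]
  by auto

lemma l2_finite_support:
  assumes J: "finite J" "J \<subseteq> \<Sigma>" and c: "\<And>\<gamma>. \<gamma> \<notin> J \<Longrightarrow> c \<gamma> = 0"
  shows "c \<in> carrier (l2 \<Sigma>)" "l2_norm \<Sigma> c = l2_fin c J"
proof -
  have f: "c \<in> functions_on \<Sigma>" using J c by (auto simp: functions_on_def)
  have le: "l2_fin c K \<le> l2_fin c J" if "finite K" for K
  proof -
    have "(\<Sum>\<gamma>\<in>K. (cmod (c \<gamma>))\<^sup>2) = (\<Sum>\<gamma>\<in>K \<inter> J. (cmod (c \<gamma>))\<^sup>2)"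
      using c that by (intro sum.mono_neutral_right) auto
    also have "\<dots> \<le> (\<Sum>\<gamma>\<in>J. (cmod (c \<gamma>))\<^sup>2)" using J by (intro sum_mono2) auto
    finally show ?thesis by (simp add: L2_set_def)
  qed
  show "c \<in> carrier (l2 \<Sigma>)" by (rule l2_boundedI(1)[OF f L2_set_nonneg le])
  moreover have "l2_norm \<Sigma> c \<le> l2_fin c J" by (rule l2_boundedI(2)[OF f L2_set_nonneg le])
  ultimately show "l2_norm \<Sigma> c = l2_fin c J"
    using l2_fin_le_l2_norm[of c \<Sigma> J] J by (intro antisym) auto
qed

lemma l2_tail:
  assumes c: "c \<in> carrier (l2 \<Sigma>)" and e: "0 < e"
  shows "\<exists>J. finite J \<and> J \<subseteq> \<Sigma> \<and> (\<forall>K. finite K \<longrightarrow> K \<subseteq> \<Sigma> - J \<longrightarrow> l2_fin c K \<le> e)"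
proof -
  let ?f = "\<lambda>\<gamma>. (cmod (c \<gamma>))\<^sup>2"
  have s: "?f summable_on \<Sigma>" using c by (simp add: l2_carrier_iff)
  have "(sum ?f \<longlongrightarrow> infsum ?f \<Sigma>) (finite_subsets_at_top \<Sigma>)"
    using has_sum_infsum[OF s] by (simp add: has_sum_def)
  then have "\<forall>\<^sub>F J in finite_subsets_at_top \<Sigma>. infsum ?f \<Sigma> - e\<^sup>2 < sum ?f J"
    using e by (intro order_tendstoD(1)) auto
  then obtain J where J: "finite J" "J \<subseteq> \<Sigma>" "infsum ?f \<Sigma> - e\<^sup>2 < sum ?f J"
    unfolding eventually_finite_subsets_at_top by blast
  have "l2_fin c K \<le> e" if K: "finite K" "K \<subseteq> \<Sigma> - J" for K
  proof -
    have "sum ?f J + sum ?f K = sum ?f (J \<union> K)" using J K by (intro sum.union_disjoint[symmetric]) auto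
    also have "\<dots> \<le> infsum ?f \<Sigma>" using J K s by (intro finite_sum_le_infsum) auto
    finally have "sum ?f K \<le> e\<^sup>2" using J by linarith
    then show ?thesis using e by (simp add: L2_set_def real_sqrt_le_iff' sum_nonneg)
  qed
  then show ?thesis using J by blast
qed

text \<open>The difference of any two partial sums is a single polynomial on the symmetric
  difference, to which the \<Lambda>(q) bound applies directly; the signs do not change its l_2
  norm.\<close>

lemma trig_poly_diff_sets:
  assumes "finite K" "finite J"
  shows "trig_poly K c x - trig_poly J c x =
    trig_poly ((K - J) \<union> (J - K)) (\<lambda>\<gamma>. if \<gamma> \<in> K then c \<gamma> else - c \<gamma>) x"
proof -
  have "trig_poly K c x = trig_poly (K - J) c x + trig_poly (K \<inter> J) c x"
    unfolding trig_poly_def using assms by (subst sum.Int_Diff[of K _ J]) auto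
  moreover have "trig_poly J c x = trig_poly (J - K) c x + trig_poly (K \<inter> J) c x"
    unfolding trig_poly_def using assms by (subst sum.Int_Diff[of J _ K]) (auto simp: Int_commute)
  moreover have "trig_poly ((K - J) \<union> (J - K)) (\<lambda>\<gamma>. if \<gamma> \<in> K then c \<gamma> else - c \<gamma>) x =
    trig_poly (K - J) (\<lambda>\<gamma>. if \<gamma> \<in> K then c \<gamma> else - c \<gamma>) x + trig_poly (J - K) (\<lambda>\<gamma>. if \<gamma> \<in> K then c \<gamma> else - c \<gamma>) x"
    unfolding trig_poly_def using assms by (intro sum.union_disjoint) auto
  moreover have "trig_poly (K - J) (\<lambda>\<gamma>. if \<gamma> \<in> K then c \<gamma> else - c \<gamma>) = trig_poly (K - J) c"
    by (rule trig_poly_cong) auto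
  moreover have "trig_poly (J - K) (\<lambda>\<gamma>. if \<gamma> \<in> K then c \<gamma> else - c \<gamma>) x = - trig_poly (J - K) c x"
    by (simp add: trig_poly_def sum_negf[symmetric])
  ultimately show ?thesis by simp
qed

locale sidon_haar = compact_haar_exponent \<mu> q
  for \<mu> :: "'g::{topological_ab_group_add, t2_space} measure" and q :: ennreal +
  fixes \<Sigma> :: "('g \<Rightarrow> complex) set"
  assumes sidon: "sidon_set \<mu> \<Sigma>"
begin

abbreviation "l2n \<equiv> l2_norm \<Sigma>"
abbreviation "series \<equiv> summation \<mu> q \<Sigma>"

lemma Sigma_dual: "\<Sigma> \<subseteq> dual_group"
  using sidon by (simp add: sidon_set_def)

lemma trig_poly_Sigma: "finite J \<Longrightarrow> J \<subseteq> \<Sigma> \<Longrightarrow> trig_poly J c \<in> polynomials"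
  using Sigma_dual by (intro polynomials_trig_poly) auto

lemma trig_poly_Lq: "finite J \<Longrightarrow> J \<subseteq> \<Sigma> \<Longrightarrow> trig_poly J c \<in> Lq"
  by (intro polynomials_Lp_functions trig_poly_Sigma q_ge)

lemma Lq_trig_poly_bound:
  obtains B where "B > 0" "\<And>J c. finite J \<Longrightarrow> J \<subseteq> \<Sigma> \<Longrightarrow> Lq_norm (trig_poly J c) \<le> B * l2_fin c J"
proof -
  obtain B where B: "B > 0" and "\<forall>J c. finite J \<longrightarrow> J \<subseteq> \<Sigma> \<longrightarrow>
     (LINT x|\<mu>. cmod (trig_poly J c x) powr r) \<le> (B * l2_fin c J) powr r"
    using sidon_powr_bound[OF sidon r_ge] by (elim exE conjE) (rule that)
  note * = this(2)[rule_format]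
  have "Lq_norm (trig_poly J c) \<le> B * l2_fin c J" if "finite J" "J \<subseteq> \<Sigma>" for J c
    using B *[OF that, of c] by (subst Lq_norm_le_iff) (auto simp: L2_set_nonneg)
  with B show ?thesis by (rule that)
qed

lemma summation_iff:
  "F \<in> series c \<longleftrightarrow> F \<in> Lq \<and>
    (\<forall>e>0. \<exists>J\<^sub>0. finite J\<^sub>0 \<and> J\<^sub>0 \<subseteq> \<Sigma> \<and>
      (\<forall>J. finite J \<and> J\<^sub>0 \<subseteq> J \<and> J \<subseteq> \<Sigma> \<longrightarrow> Lq_norm (\<lambda>x. F x - trig_poly J c x) < e))"
  by (simp add: summation_def tendsto_iff eventually_finite_subsets_at_top Lp_norm_nonneg trig_poly_def)

lemma summation_approx:
  assumes "F \<in> series c" "0 < e"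
  obtains J\<^sub>0 where "finite J\<^sub>0" "J\<^sub>0 \<subseteq> \<Sigma>"
    "\<And>J. finite J \<Longrightarrow> J\<^sub>0 \<subseteq> J \<Longrightarrow> J \<subseteq> \<Sigma> \<Longrightarrow> Lq_norm (\<lambda>x. F x - trig_poly J c x) < e"
proof -
  obtain J\<^sub>0 where "finite J\<^sub>0" "J\<^sub>0 \<subseteq> \<Sigma>" "\<forall>J. finite J \<and> J\<^sub>0 \<subseteq> J \<and> J \<subseteq> \<Sigma> \<longrightarrow> Lq_norm (\<lambda>x. F x - trig_poly J c x) < e"
    using assms unfolding summation_iff by blast
  then show ?thesis by (intro that[of J\<^sub>0]) auto
qed

lemma summation_Lq: "F \<in> series c \<Longrightarrow> F \<in> Lq"
  by (simp add: summation_iff)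

lemma summation_measurable: "F \<in> series c \<Longrightarrow> F \<in> borel_measurable borel"
  using summation_Lq Lp_functions_measurable by blast

lemma summation_AE_cong:
  assumes F: "F \<in> series c" and H: "H \<in> borel_measurable borel" and ae: "AE x in \<mu>. H x = F x"
  shows "H \<in> series c"
proof -
  have "Lq_norm (\<lambda>x. H x - trig_poly J c x) = Lq_norm (\<lambda>x. F x - trig_poly J c x)"
    if "finite J" "J \<subseteq> \<Sigma>" for J
  proof (rule Lq_AE_cong(2))
    have [measurable]: "H \<in> borel_measurable borel" "F \<in> borel_measurable borel" "trig_poly J c \<in> borel_measurable borel"
      using H summation_measurable[OF F] polynomials_measurable[OF trig_poly_Sigma[OF that]] by auto
    show "(\<lambda>x. H x - trig_poly J c x) \<in> borel_measurable borel" "(\<lambda>x. F x - trig_poly J c x) \<in> borel_measurable borel"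
      by measurable
    show "AE x in \<mu>. H x - trig_poly J c x = F x - trig_poly J c x" using ae by eventually_elim simp
  qed
  moreover have "H \<in> Lq"
    using Lq_AE_cong(1)[OF H summation_measurable[OF F] ae] summation_Lq[OF F] by simp
  ultimately show ?thesis using F unfolding summation_iff by simp
qed

lemma summation_add:
  assumes F: "F \<in> series c" and H: "H \<in> series d"
  shows "(\<lambda>x. F x + H x) \<in> series (\<lambda>\<gamma>. c \<gamma> + d \<gamma>)"
  unfolding summation_iff
proof (intro conjI allI impI)
  show "(\<lambda>x. F x + H x) \<in> Lq" using F H by (intro Lq_add summation_Lq)
  fix e :: real assume e: "0 < e"
  \<comment> \<open>Adding the two errors costs the constant 4 of \<open>Lq_add\<close>, and 4 (e/8)
    is still strictly below e.\<close>
  then have e8: "0 < e / 8" by simp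
  obtain J1 where J1: "finite J1" "J1 \<subseteq> \<Sigma>"
    "\<And>J. finite J \<Longrightarrow> J1 \<subseteq> J \<Longrightarrow> J \<subseteq> \<Sigma> \<Longrightarrow> Lq_norm (\<lambda>x. F x - trig_poly J c x) < e / 8"
    using summation_approx[OF F e8] by metis
  obtain J2 where J2: "finite J2" "J2 \<subseteq> \<Sigma>"
    "\<And>J. finite J \<Longrightarrow> J2 \<subseteq> J \<Longrightarrow> J \<subseteq> \<Sigma> \<Longrightarrow> Lq_norm (\<lambda>x. H x - trig_poly J d x) < e / 8"
    using summation_approx[OF H e8] by metis
  show "\<exists>J\<^sub>0. finite J\<^sub>0 \<and> J\<^sub>0 \<subseteq> \<Sigma> \<and>
      (\<forall>J. finite J \<and> J\<^sub>0 \<subseteq> J \<and> J \<subseteq> \<Sigma> \<longrightarrow> Lq_norm (\<lambda>x. F x + H x - trig_poly J (\<lambda>\<gamma>. c \<gamma> + d \<gamma>) x) < e)"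
  proof (intro exI[of _ "J1 \<union> J2"] conjI allI impI)
    fix J assume J: "finite J \<and> J1 \<union> J2 \<subseteq> J \<and> J \<subseteq> \<Sigma>"
    have "Lq_norm (\<lambda>x. (F x - trig_poly J c x) + (H x - trig_poly J d x)) \<le> 4 * (e / 8)"
      using J J1(3)[of J] J2(3)[of J]
      by (intro Lq_add(2) Lq_diff(1) summation_Lq[OF F] summation_Lq[OF H] trig_poly_Lq) auto
    then show "Lq_norm (\<lambda>x. F x + H x - trig_poly J (\<lambda>\<gamma>. c \<gamma> + d \<gamma>) x) < e"
      using e by (simp add: trig_poly_add[symmetric] algebra_simps)
  qed (use J1 J2 in auto)
qed

lemma summation_scale:
  assumes F: "F \<in> series c"
  shows "(\<lambda>x. t * F x) \<in> series (\<lambda>\<gamma>. t * c \<gamma>)"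
  unfolding summation_iff
proof (intro conjI allI impI)
  show "(\<lambda>x. t * F x) \<in> Lq" using F by (intro Lq_scale summation_Lq)
  fix e :: real assume e: "0 < e"
  then have e': "0 < e / (cmod t + 1)" by (simp add: add_nonneg_pos)
  obtain J1 where J1: "finite J1" "J1 \<subseteq> \<Sigma>"
    "\<And>J. finite J \<Longrightarrow> J1 \<subseteq> J \<Longrightarrow> J \<subseteq> \<Sigma> \<Longrightarrow> Lq_norm (\<lambda>x. F x - trig_poly J c x) < e / (cmod t + 1)"
    using summation_approx[OF F e'] by metis
  show "\<exists>J\<^sub>0. finite J\<^sub>0 \<and> J\<^sub>0 \<subseteq> \<Sigma> \<and>
      (\<forall>J. finite J \<and> J\<^sub>0 \<subseteq> J \<and> J \<subseteq> \<Sigma> \<longrightarrow> Lq_norm (\<lambda>x. t * F x - trig_poly J (\<lambda>\<gamma>. t * c \<gamma>) x) < e)"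
  proof (intro exI[of _ J1] conjI allI impI)
    fix J assume J: "finite J \<and> J1 \<subseteq> J \<and> J \<subseteq> \<Sigma>"
    define N where "N = Lq_norm (\<lambda>x. F x - trig_poly J c x)"
    have N: "N < e / (cmod t + 1)" "0 \<le> N" using J J1(3)[of J] by (auto simp: N_def Lp_norm_nonneg)
    have "Lq_norm (\<lambda>x. t * (F x - trig_poly J c x)) = cmod t * N"
      unfolding N_def using J by (intro Lq_scale(2) Lq_diff(1) summation_Lq[OF F] trig_poly_Lq) auto
    also have "\<dots> \<le> (cmod t + 1) * N" using N by (intro mult_right_mono) auto
    also have "\<dots> < e" using N by (simp add: less_divide_eq mult.commute add_nonneg_pos)
    finally show "Lq_norm (\<lambda>x. t * F x - trig_poly J (\<lambda>\<gamma>. t * c \<gamma>) x) < e"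
      by (simp add: trig_poly_scale[symmetric] right_diff_distrib)
  qed (use J1 in auto)
qed

lemma summation_diff:
  assumes "F \<in> series c" "H \<in> series d"
  shows "(\<lambda>x. F x - H x) \<in> series (\<lambda>\<gamma>. c \<gamma> - d \<gamma>)"
  using summation_add[OF assms(1) summation_scale[OF assms(2), of "- 1"]] by simp

lemma summation_finite_support:
  assumes J: "finite J" "J \<subseteq> \<Sigma>" and c: "\<And>\<gamma>. \<gamma> \<in> \<Sigma> - J \<Longrightarrow> c \<gamma> = 0"
  shows "trig_poly J c \<in> series c"
  unfolding summation_iff
proof (intro conjI allI impI)
  fix e :: real assume e: "0 < e"
  show "\<exists>J\<^sub>0. finite J\<^sub>0 \<and> J\<^sub>0 \<subseteq> \<Sigma> \<and>
      (\<forall>K. finite K \<and> J\<^sub>0 \<subseteq> K \<and> K \<subseteq> \<Sigma> \<longrightarrow> Lq_norm (\<lambda>x. trig_poly J c x - trig_poly K c x) < e)"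
  proof (intro exI[of _ J] conjI allI impI)
    fix K assume K: "finite K \<and> J \<subseteq> K \<and> K \<subseteq> \<Sigma>"
    then have "trig_poly J c = trig_poly K c" using c by (intro trig_poly_mono) auto
    then show "Lq_norm (\<lambda>x. trig_poly J c x - trig_poly K c x) < e"
      using e r_ge by (simp add: Lq_norm_eq)
  qed (use J in auto)
qed (use J in \<open>auto intro: trig_poly_Lq\<close>)

lemma summation_norm_le:
  obtains B where "B > 0" "\<And>F c. c \<in> carrier (l2 \<Sigma>) \<Longrightarrow> F \<in> series c \<Longrightarrow> Lq_norm F \<le> B * l2n c"
proof -
  obtain B where B: "B > 0" "\<And>J c. finite J \<Longrightarrow> J \<subseteq> \<Sigma> \<Longrightarrow> Lq_norm (trig_poly J c) \<le> B * l2_fin c J"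
    using Lq_trig_poly_bound by metis
  have "Lq_norm F \<le> (4 * B) * l2n c" if c: "c \<in> carrier (l2 \<Sigma>)" and F: "F \<in> series c" for F c
  proof (rule field_le_epsilon)
    fix e :: real assume e: "0 < e"
    then have e4: "0 < e / 4" by simp
    obtain J where J: "finite J" "J \<subseteq> \<Sigma>"
      "\<And>K. finite K \<Longrightarrow> J \<subseteq> K \<Longrightarrow> K \<subseteq> \<Sigma> \<Longrightarrow> Lq_norm (\<lambda>x. F x - trig_poly K c x) < e / 4"
      using summation_approx[OF F e4] by metis
    define L where "L = B * l2n c + e / 4"
    have l0: "0 \<le> B * l2n c" using B by (simp add: l2_norm_nonneg)
    have "Lq_norm (trig_poly J c) \<le> B * l2_fin c J" by (rule B(2)[OF J(1,2)])
    also have "\<dots> \<le> B * l2n c" using B J c by (intro mult_left_mono l2_fin_le_l2_norm) auto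
    finally have "Lq_norm (trig_poly J c) \<le> L" using e by (simp add: L_def)
    moreover have "Lq_norm (\<lambda>x. F x - trig_poly J c x) \<le> L" using J(3)[OF J(1) order_refl J(2)] l0 by (simp add: L_def)
    ultimately have "Lq_norm (\<lambda>x. (F x - trig_poly J c x) + trig_poly J c x) \<le> 4 * L"
      using J by (intro Lq_add(2) Lq_diff(1) summation_Lq[OF F] trig_poly_Lq) auto
    then show "Lq_norm F \<le> 4 * B * l2n c + e" by (simp add: L_def)
  qed
  then show ?thesis using B by (intro that[of "4 * B"]) auto
qed

text \<open>The difference of two limits is a limit for the zero coefficients, and boundedness of S
  makes its norm 0.\<close>

lemma summation_AE_unique:
  assumes F: "F \<in> series c" and H: "H \<in> series c"
  shows "AE x in \<mu>. F x = H x"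
proof -
  obtain B where B: "B > 0" "\<And>F c. c \<in> carrier (l2 \<Sigma>) \<Longrightarrow> F \<in> series c \<Longrightarrow> Lq_norm F \<le> B * l2n c"
    using summation_norm_le by metis
  have "(\<lambda>x. F x - H x) \<in> series (\<lambda>\<gamma>. 0)" using summation_diff[OF F H] by simp
  moreover have "(\<lambda>\<gamma>. 0) \<in> carrier (l2 \<Sigma>)" "l2n (\<lambda>\<gamma>. 0) = 0"
    using l2_finite_support[of "{}" \<Sigma> "\<lambda>_. 0"] by auto
  ultimately have "Lq_norm (\<lambda>x. F x - H x) \<le> 0" using B(2)[of "\<lambda>_. 0" "\<lambda>x. F x - H x"] by simp
  then have "AE x in \<mu>. F x - H x = 0"
    using F H by (intro Lq_norm_le_0_AE Lq_diff(1) summation_Lq)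
  then show ?thesis by simp
qed

text \<open>The finite lower bound passes to the limit because L_q convergence implies L_1
  convergence. Keeping the L_1 norm on the right matters later, where the part of a polynomial off
  \<Sigma> is controlled only through its L_2 norm.\<close>

lemma summation_norm_ge:
  obtains M where "M > 0" "\<And>F c. c \<in> carrier (l2 \<Sigma>) \<Longrightarrow> F \<in> series c \<Longrightarrow> l2n c \<le> M * (LINT x|\<mu>. cmod (F x))"
proof -
  obtain M where M0: "M > 0" and "\<forall>J c. finite J \<longrightarrow> J \<subseteq> \<Sigma> \<longrightarrow>
     l2_fin c J \<le> M * (LINT x|\<mu>. cmod (trig_poly J c x))"
    using sidon_L1_lower_bound[OF sidon] by (elim exE conjE) (rule that)
  note M = this(2)[rule_format]
  have "l2n c \<le> M * (LINT x|\<mu>. cmod (F x))" if c: "c \<in> carrier (l2 \<Sigma>)" and F: "F \<in> series c" for F c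
  proof (rule l2_boundedI(2))
    show "c \<in> functions_on \<Sigma>" using c by (simp add: l2_carrier_iff)
    show "0 \<le> M * (LINT x|\<mu>. cmod (F x))" using M0 by (intro mult_nonneg_nonneg Bochner_Integration.integral_nonneg) auto
    fix J assume J: "finite J" "J \<subseteq> \<Sigma>"
    show "l2_fin c J \<le> M * (LINT x|\<mu>. cmod (F x))"
    proof (rule field_le_epsilon)
      fix e :: real assume e: "0 < e"
      \<comment> \<open>The 2 compensates for the factor in \<open>integral_le_Lq_norm\<close>, the
        M for the constant of the lower bound.\<close>
      then have e': "0 < e / (2 * M)" using M0 by simp
      obtain K0 where K0: "finite K0" "K0 \<subseteq> \<Sigma>"
        "\<And>K. finite K \<Longrightarrow> K0 \<subseteq> K \<Longrightarrow> K \<subseteq> \<Sigma> \<Longrightarrow> Lq_norm (\<lambda>x. F x - trig_poly K c x) < e / (2 * M)"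
        using summation_approx[OF F e'] by metis
      define K where "K = J \<union> K0"
      have K: "finite K" "K \<subseteq> \<Sigma>" "Lq_norm (\<lambda>x. F x - trig_poly K c x) \<le> e / (2 * M)"
        using J K0 less_imp_le[OF K0(3)[of K]] by (auto simp: K_def)
      have d: "(\<lambda>x. F x - trig_poly K c x) \<in> Lq"
        using K by (intro Lq_diff(1) summation_Lq[OF F] trig_poly_Lq)
      have int: "integrable \<mu> F" "integrable \<mu> (\<lambda>x. F x - trig_poly K c x)" "integrable \<mu> (trig_poly K c)"
        using Lq_integrable[OF summation_Lq[OF F]] Lq_integrable[OF d] polynomials_integrable[OF trig_poly_Sigma[OF K(1,2)]] by auto
      have "l2_fin c J \<le> l2_fin c K"
        unfolding L2_set_def using K by (intro real_sqrt_le_mono sum_mono2) (auto simp: K_def)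
      also have "\<dots> \<le> M * (LINT x|\<mu>. cmod (trig_poly K c x))" by (rule M[OF K(1,2)])
      also have "(LINT x|\<mu>. cmod (trig_poly K c x)) \<le> (LINT x|\<mu>. cmod (F x) + cmod (F x - trig_poly K c x))"
      proof (intro integral_mono)
        show "cmod (trig_poly K c x) \<le> cmod (F x) + cmod (F x - trig_poly K c x)" for x
          using norm_triangle_ineq4[of "F x" "F x - trig_poly K c x"] by simp
      qed (use int in auto)
      also have "\<dots> = (LINT x|\<mu>. cmod (F x)) + (LINT x|\<mu>. cmod (F x - trig_poly K c x))"
        using int by (intro Bochner_Integration.integral_add) auto
      also have "\<dots> \<le> (LINT x|\<mu>. cmod (F x)) + 2 * (e / (2 * M))"
        using integral_le_Lq_norm[OF d K(3)] by simp
      finally show "l2_fin c J \<le> M * (LINT x|\<mu>. cmod (F x)) + e"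
        using M0 by (simp add: distrib_left mult_left_mono)
    qed
  qed
  with M0 show ?thesis by (rule that)
qed

section \<open>Existence of sums, and convolution as multiplication of coefficients\<close>

text \<open>This is demanded of a particular representative, not of a class. It is obtained for one
  limit of each series, and \<open>convolution_AE_cong\<close> carries its consequences over to the
  others.\<close>

definition jointly_measurable :: "('g \<Rightarrow> complex) \<Rightarrow> bool" where
  "jointly_measurable F \<longleftrightarrow> F \<in> borel_measurable borel \<and>
     (\<lambda>z. F (fst z - snd z)) \<in> borel_measurable (\<mu> \<Otimes>\<^sub>M \<mu>)"

text \<open>The limit along a sequence of finite sets involves only countably many characters, which makes
  \<open>(x, y) \<mapsto> F(x - y)\<close> measurable for the product \<open>\<sigma>\<close>-algebra; Fubini's theorem is then available
  even if \<open>G\<close> is not metrizable.\<close>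

lemma summation_exists:
  assumes c: "c \<in> carrier (l2 \<Sigma>)"
  shows "\<exists>F. F \<in> series c \<and> jointly_measurable F"
proof -
  obtain B where B: "B > 0" "\<And>J c. finite J \<Longrightarrow> J \<subseteq> \<Sigma> \<Longrightarrow> Lq_norm (trig_poly J c) \<le> B * l2_fin c J"
    using Lq_trig_poly_bound by metis
  have "\<exists>J. finite J \<and> J \<subseteq> \<Sigma> \<and> (\<forall>K. finite K \<longrightarrow> K \<subseteq> \<Sigma> - J \<longrightarrow> l2_fin c K \<le> (1/2) ^ n)" for n :: nat
    by (rule l2_tail[OF c]) simp
  then obtain I where I: "\<And>n. finite (I n)" "\<And>n. I n \<subseteq> \<Sigma>"
    "\<And>n K. finite K \<Longrightarrow> K \<subseteq> \<Sigma> - I n \<Longrightarrow> l2_fin c K \<le> (1/2) ^ n"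
    by metis
  \<comment> \<open>Taking unions makes the sets increase while keeping the tail bound 2^-n outside
    \<open>J n\<close>.\<close>
  define J where "J n = (\<Union>k\<le>n. I k)" for n :: nat
  have J: "finite (J n)" "J n \<subseteq> \<Sigma>" for n using I by (auto simp: J_def)
  have J_mono: "J m \<subseteq> J n" if "m \<le> n" for m n unfolding J_def using that by (intro UN_mono) auto
  have IJ: "I n \<subseteq> J n" for n by (auto simp: J_def)
  define P where "P n = trig_poly (J n) c" for n
  have P_Lq: "P n \<in> Lq" for n unfolding P_def by (intro trig_poly_Lq J)
  have Pm [measurable]: "P n \<in> borel_measurable borel" for n by (rule Lp_functions_measurable[OF P_Lq])
  \<comment> \<open>Both \<open>J m\<close> and K contain \<open>J n\<close>, so their symmetric
    difference lies in the tail; K need not be comparable with \<open>J m\<close>. This generality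
    turns convergence along the sequence into convergence of the whole net.\<close>
  have diff: "Lq_norm (\<lambda>x. P m x - trig_poly K c x) \<le> B * (1/2) ^ n"
    if "n \<le> m" and K: "finite K" "J n \<subseteq> K" "K \<subseteq> \<Sigma>" for m n K
  proof -
    define D where "D = (J m - K) \<union> (K - J m)"
    define d where "d \<gamma> = (if \<gamma> \<in> J m then c \<gamma> else - c \<gamma>)" for \<gamma>
    have D: "finite D" "D \<subseteq> \<Sigma> - I n" using J K IJ[of n] J_mono[OF that(1)] by (auto simp: D_def)
    have "(\<lambda>x. P m x - trig_poly K c x) = trig_poly D d"
      unfolding P_def D_def d_def[abs_def] by (intro ext trig_poly_diff_sets J K)
    then have "Lq_norm (\<lambda>x. P m x - trig_poly K c x) \<le> B * l2_fin d D"
      using B(2)[of D d] D by auto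
    also have "l2_fin d D = l2_fin c D" by (intro L2_set_cong) (auto simp: d_def)
    also have "\<dots> \<le> (1/2) ^ n" using D by (rule I(3))
    finally show ?thesis using B(1) by simp
  qed
  \<comment> \<open>The increments have geometrically decreasing L_1 norms, so almost everywhere
    their moduli are summable.\<close>
  have AE_conv: "AE x in \<mu>. convergent (\<lambda>n. P n x)"
  proof -
    define h where "h n x = cmod (P (Suc n) x - P n x)" for n x
    have h0: "0 \<le> h n x" for n x by (simp add: h_def)
    have hm [measurable]: "h n \<in> borel_measurable \<mu>" for n unfolding h_def[abs_def] by measurable
    have "(LINT x|\<mu>. h n x) \<le> 2 * (B * (1/2) ^ n)" for n
      unfolding h_def using diff[of n "Suc n" "J n"] J
      by (intro integral_le_Lq_norm Lq_diff(1) P_Lq) (auto simp: P_def)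
    moreover have "integrable \<mu> (h n)" for n
      unfolding h_def[abs_def] by (intro integrable_norm Lq_integrable Lq_diff(1) P_Lq)
    ultimately have hle: "(\<integral>\<^sup>+x. ennreal (h n x) \<partial>\<mu>) \<le> ennreal (2 * B * (1/2) ^ n)" for n
      by (subst nn_integral_eq_integral) (auto simp: mult.assoc h0 intro!: ennreal_leI)
    have "(\<integral>\<^sup>+x. (\<Sum>n. ennreal (h n x)) \<partial>\<mu>) = (\<Sum>n. \<integral>\<^sup>+x. ennreal (h n x) \<partial>\<mu>)"
      by (intro nn_integral_suminf) auto
    also have "\<dots> \<le> (\<Sum>n. ennreal (2 * B * (1/2) ^ n))" by (intro suminf_le hle) auto
    also have "\<dots> < \<infinity>"
    proof -
      have "summable (\<lambda>n. 2 * B * (1/2 :: real) ^ n)" by (intro summable_mult summable_geometric) auto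
      then have "(\<Sum>n. ennreal (2 * B * (1/2) ^ n)) = ennreal (\<Sum>n. 2 * B * (1/2) ^ n)"
        using B by (intro suminf_ennreal2) auto
      then show ?thesis by simp
    qed
    finally have "AE x in \<mu>. (\<Sum>n. ennreal (h n x)) \<noteq> \<infinity>"
      by (intro nn_integral_PInf_AE) auto
    then show ?thesis
    proof eventually_elim
      case (elim x)
      then have "summable (\<lambda>n. h n x)" by (intro summable_suminf_not_top) (auto simp: h_def)
      then have "summable (\<lambda>n. P (Suc n) x - P n x)" unfolding h_def by (rule summable_norm_cancel)
      then obtain L where "(\<lambda>N. \<Sum>n<N. P (Suc n) x - P n x) \<longlonglongrightarrow> L"
        by (auto simp: summable_def sums_def)
      then have "(\<lambda>N. P N x - P 0 x) \<longlonglongrightarrow> L" by (simp only: sum_lessThan_telescope[of "\<lambda>n. P n x" for x])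
      then have "(\<lambda>N. (P N x - P 0 x) + P 0 x) \<longlonglongrightarrow> L + P 0 x" by (intro tendsto_intros)
      then show ?case by (auto simp: convergent_def)
    qed
  qed
  define F where "F x = lim (\<lambda>n. P n x)" for x
  have Fm [measurable]: "F \<in> borel_measurable borel" unfolding F_def[abs_def] by measurable
  have "(\<lambda>z. F (fst z - snd z)) \<in> borel_measurable (\<mu> \<Otimes>\<^sub>M \<mu>)"
    unfolding F_def P_def
    by (intro borel_measurable_lim_metric trig_poly_joint_measurable) (use J Sigma_dual in blast)
  then have joint: "jointly_measurable F" using Fm by (simp add: jointly_measurable_def)
  \<comment> \<open>Fatou's lemma for m tending to infinity in \<open>diff\<close>.\<close>
  have F_diff: "(\<lambda>x. F x - trig_poly K c x) \<in> Lq \<and>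
     Lq_norm (\<lambda>x. F x - trig_poly K c x) \<le> B * (1/2) ^ n"
    if K: "finite K" "J n \<subseteq> K" "K \<subseteq> \<Sigma>" for K n
  proof -
    have [measurable]: "trig_poly K c \<in> borel_measurable borel"
      using polynomials_measurable[OF trig_poly_Sigma[OF K(1,3)]] .
    have "(\<integral>\<^sup>+x. ennreal (cmod (F x - trig_poly K c x) powr r) \<partial>\<mu>) =
      (\<integral>\<^sup>+x. liminf (\<lambda>m. ennreal (cmod (P m x - trig_poly K c x) powr r)) \<partial>\<mu>)"
    proof (rule nn_integral_cong_AE)
      show "AE x in \<mu>. ennreal (cmod (F x - trig_poly K c x) powr r) =
        liminf (\<lambda>m. ennreal (cmod (P m x - trig_poly K c x) powr r))"
        using AE_conv
      proof eventually_elim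
        case (elim x)
        then have "(\<lambda>n. P n x) \<longlonglongrightarrow> F x" by (simp add: F_def convergent_LIMSEQ_iff)
        then have "(\<lambda>m. ennreal (cmod (P m x - trig_poly K c x) powr r)) \<longlonglongrightarrow> ennreal (cmod (F x - trig_poly K c x) powr r)"
          using r_ge by (intro tendsto_ennrealI tendsto_powr' tendsto_intros) auto
        then show ?case by (rule lim_imp_Liminf[OF trivial_limit_sequentially, symmetric])
      qed
    qed
    also have "\<dots> \<le> liminf (\<lambda>m. \<integral>\<^sup>+x. ennreal (cmod (P m x - trig_poly K c x) powr r) \<partial>\<mu>)"
      by (intro nn_integral_liminf) measurable
    also have "\<dots> \<le> ennreal ((B * (1/2) ^ n) powr r)"
    proof (rule Liminf_le)
      show "\<forall>\<^sub>F m in sequentially. (\<integral>\<^sup>+x. ennreal (cmod (P m x - trig_poly K c x) powr r) \<partial>\<mu>) \<le> ennreal ((B * (1/2) ^ n) powr r)"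
        using eventually_ge_at_top[of n]
      proof eventually_elim
        case (elim m)
        have d: "(\<lambda>x. P m x - trig_poly K c x) \<in> Lq"
          using K by (intro Lq_diff(1) P_Lq trig_poly_Lq)
        have "(LINT x|\<mu>. cmod (P m x - trig_poly K c x) powr r) \<le> (B * (1/2) ^ n) powr r"
          using diff[OF elim K] B by (subst Lq_norm_le_iff[symmetric]) auto
        then show ?case
          using d by (subst nn_integral_eq_integral) (auto simp: Lq_functions_iff intro: ennreal_leI)
      qed
    qed simp
    finally have le: "(\<integral>\<^sup>+x. ennreal (cmod (F x - trig_poly K c x) powr r) \<partial>\<mu>) \<le> ennreal ((B * (1/2) ^ n) powr r)" .
    have m: "(\<lambda>x. F x - trig_poly K c x) \<in> borel_measurable borel" by measurable
    have "0 \<le> B * (1/2) ^ n" using B by simp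
    from Lq_nn_integral[OF m this le] show ?thesis by blast
  qed
  have "F \<in> series c" unfolding summation_iff
  proof (intro conjI allI impI)
    have "(\<lambda>x. (F x - P 0 x) + P 0 x) \<in> Lq"
      using F_diff[of "J 0" 0] J by (intro Lq_add(1) P_Lq) (auto simp: P_def)
    then show "F \<in> Lq" by simp
    fix e :: real assume "0 < e"
    then have "0 < e / B" using B by simp
    then obtain n where n: "(1 / 2) ^ n < e / B" using real_arch_pow_inv[of "e / B" "1/2"] by auto
    then have "B * (1 / 2) ^ n < e" using B by (simp only: pos_less_divide_eq mult.commute)
    then show "\<exists>J\<^sub>0. finite J\<^sub>0 \<and> J\<^sub>0 \<subseteq> \<Sigma> \<and>
      (\<forall>J. finite J \<and> J\<^sub>0 \<subseteq> J \<and> J \<subseteq> \<Sigma> \<longrightarrow> Lq_norm (\<lambda>x. F x - trig_poly J c x) < e)"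
      using F_diff[of _ n] J by (intro exI[of _ "J n"]) (meson order_le_less_trans)
  qed
  then show ?thesis using joint by blast
qed

text \<open>The conclusion holds at every x, not just almost everywhere, because for each fixed x
  the map y -> x - y preserves null sets.\<close>

lemma convolution_AE_cong:
  assumes a: "a \<in> borel_measurable borel" and F: "F \<in> borel_measurable borel" and H: "H \<in> borel_measurable borel"
    and ae: "AE x in \<mu>. F x = H x"
  shows "convolution \<mu> a F = convolution \<mu> a H"
proof
  fix x
  note [measurable] = a F H
  have [measurable]: "(\<lambda>y. F (x - y)) \<in> borel_measurable borel" "(\<lambda>y. H (x - y)) \<in> borel_measurable borel"
    using measurable_compose[OF measurable_reflection_translation[of x]] F H by auto
  have "AE y in \<mu>. F (x - y) = H (x - y)" by (rule AE_reflection_translation[OF ae]) measurable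
  then have "AE y in \<mu>. a y * F (x - y) = a y * H (x - y)" by eventually_elim simp
  then show "convolution \<mu> a F x = convolution \<mu> a H x"
    unfolding convolution_def by (rule integral_cong_AE[rotated 2]) measurable
qed

text \<open>The L_1 case of Young's inequality for F - P, stated with two separate convolutions
  because the one with P is known explicitly. It is the approximation tool for
  \<open>summation_convolution\<close>.\<close>

lemma convolution_L1_le:
  assumes a: "integrable \<mu> a" and F: "integrable \<mu> F" "jointly_measurable F" and P: "P \<in> polynomials"
  shows "convolution \<mu> a F \<in> borel_measurable borel"
    "(\<integral>\<^sup>+x. ennreal (cmod (convolution \<mu> a F x - convolution \<mu> a P x)) \<partial>\<mu>)
      \<le> ennreal (LINT x|\<mu>. cmod (a x)) * ennreal (LINT x|\<mu>. cmod (F x - P x))"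
proof -
  have am [measurable]: "a \<in> borel_measurable borel"
    using borel_measurable_integrable[OF a] by (simp add: borel_measurable_haar_iff)
  have Fm [measurable]: "F \<in> borel_measurable borel" "(\<lambda>z. F (fst z - snd z)) \<in> borel_measurable (\<mu> \<Otimes>\<^sub>M \<mu>)"
    using F(2) by (auto simp: jointly_measurable_def)
  obtain J c where J: "finite J" "J \<subseteq> dual_group" "P = trig_poly J c" using P by (auto simp: polynomials_eq)
  have Pm [measurable]: "P \<in> borel_measurable borel" "(\<lambda>z. P (fst z - snd z)) \<in> borel_measurable (\<mu> \<Otimes>\<^sub>M \<mu>)"
    using polynomials_measurable[OF P] trig_poly_joint_measurable[OF J(2), of c] J(3) by auto
  obtain B where B: "\<And>x. cmod (P x) \<le> B" using polynomials_bounded[OF P] by blast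
  have comp [measurable]: "(\<lambda>y. f (x - y)) \<in> borel_measurable borel"
    if "f \<in> borel_measurable borel" for f :: "'g \<Rightarrow> complex" and x
    using measurable_compose[OF measurable_reflection_translation[of x] that] .
  have "(\<lambda>x. LINT y|\<mu>. (\<lambda>z. a (snd z) * F (fst z - snd z)) (x, y)) \<in> borel_measurable \<mu>"
    by (intro borel_measurable_lebesgue_integral) (simp add: case_prod_unfold, measurable)
  then show "convolution \<mu> a F \<in> borel_measurable borel"
    by (simp add: convolution_def[abs_def] borel_measurable_haar_iff)
  \<comment> \<open>Outside this null set y -> a(y) F(x - y) is integrable. Elsewhere its Bochner
    integral would be the default value 0, and the two convolutions could not be subtracted under
    the integral.\<close>
  have fin: "AE x in \<mu>. (\<integral>\<^sup>+y. ennreal (cmod (a y)) * ennreal (cmod (F (x - y))) \<partial>\<mu>) \<noteq> \<infinity>"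
  proof (rule nn_integral_PInf_AE)
    show "(\<lambda>x. \<integral>\<^sup>+y. ennreal (cmod (a y)) * ennreal (cmod (F (x - y))) \<partial>\<mu>) \<in> borel_measurable \<mu>"
    proof -
      have "(\<lambda>x. \<integral>\<^sup>+y. (\<lambda>z. ennreal (cmod (a (snd z))) * ennreal (cmod (F (fst z - snd z)))) (x, y) \<partial>\<mu>) \<in> borel_measurable \<mu>"
        by (intro borel_measurable_nn_integral_fst) measurable
      then show ?thesis by simp
    qed
    have "(\<integral>\<^sup>+x. \<integral>\<^sup>+y. ennreal (cmod (a y)) * ennreal (cmod (F (x - y))) \<partial>\<mu> \<partial>\<mu>)
       = (\<integral>\<^sup>+y. ennreal (cmod (a y)) \<partial>\<mu>) * (\<integral>\<^sup>+x. ennreal (cmod (F x)) \<partial>\<mu>)"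
      by (intro nn_integral_convolution) measurable
    also have "\<dots> = ennreal (LINT x|\<mu>. cmod (a x)) * ennreal (LINT x|\<mu>. cmod (F x))"
      using a F(1) by (simp add: nn_integral_eq_integral)
    also have "\<dots> \<noteq> \<infinity>" by (simp add: ennreal_mult_eq_top_iff)
    finally show "(\<integral>\<^sup>+x. \<integral>\<^sup>+y. ennreal (cmod (a y)) * ennreal (cmod (F (x - y))) \<partial>\<mu> \<partial>\<mu>) \<noteq> \<infinity>" .
  qed
  have "(\<integral>\<^sup>+x. ennreal (cmod (convolution \<mu> a F x - convolution \<mu> a P x)) \<partial>\<mu>)
    \<le> (\<integral>\<^sup>+x. \<integral>\<^sup>+y. ennreal (cmod (a y)) * ennreal (cmod (F (x - y) - P (x - y))) \<partial>\<mu> \<partial>\<mu>)"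
  proof (rule nn_integral_mono_AE)
    show "AE x in \<mu>. ennreal (cmod (convolution \<mu> a F x - convolution \<mu> a P x)) \<le>
       (\<integral>\<^sup>+y. ennreal (cmod (a y)) * ennreal (cmod (F (x - y) - P (x - y))) \<partial>\<mu>)"
      using fin
    proof eventually_elim
      case (elim x)
      have i1: "integrable \<mu> (\<lambda>y. a y * F (x - y))"
      proof (rule integrableI_bounded)
        show "(\<lambda>y. a y * F (x - y)) \<in> borel_measurable \<mu>" by measurable
        show "(\<integral>\<^sup>+y. ennreal (cmod (a y * F (x - y))) \<partial>\<mu>) < \<infinity>"
          using elim by (simp add: norm_mult ennreal_mult less_top)
      qed
      have i2: "integrable \<mu> (\<lambda>y. a y * P (x - y))"
        by (rule integrable_mult_bounded[OF a, of _ B]) (use comp[OF Pm(1)] B in auto)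
      have "convolution \<mu> a F x - convolution \<mu> a P x = (LINT y|\<mu>. a y * F (x - y) - a y * P (x - y))"
        unfolding convolution_def using i1 i2 by simp
      then have "ennreal (cmod (convolution \<mu> a F x - convolution \<mu> a P x))
          \<le> (\<integral>\<^sup>+y. ennreal (cmod (a y * F (x - y) - a y * P (x - y))) \<partial>\<mu>)"
        using i1 i2 integral_norm_bound_ennreal[of \<mu> "\<lambda>y. a y * F (x - y) - a y * P (x - y)"] by simp
      then show ?case by (simp add: right_diff_distrib[symmetric] norm_mult ennreal_mult)
    qed
  qed
  also have "\<dots> = (\<integral>\<^sup>+y. ennreal (cmod (a y)) \<partial>\<mu>) * (\<integral>\<^sup>+x. ennreal (cmod (F x - P x)) \<partial>\<mu>)"
    by (intro nn_integral_convolution) measurable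
  also have "\<dots> = ennreal (LINT x|\<mu>. cmod (a x)) * ennreal (LINT x|\<mu>. cmod (F x - P x))"
    using a F(1) polynomials_integrable[OF P] by (simp add: nn_integral_eq_integral)
  finally show "(\<integral>\<^sup>+x. ennreal (cmod (convolution \<mu> a F x - convolution \<mu> a P x)) \<partial>\<mu>)
      \<le> ennreal (LINT x|\<mu>. cmod (a x)) * ennreal (LINT x|\<mu>. cmod (F x - P x))" .
qed

text \<open>For a finite partial sum this is the identity \<open>convolution_trig_poly\<close>. Both
  sides are approximated in L_1 along a common finite set J, on the left by
  \<open>convolution_L1_le\<close>, so they agree almost everywhere.\<close>

lemma summation_convolution:
  assumes c: "c \<in> carrier (l2 \<Sigma>)" and F: "F \<in> series c" and a: "integrable \<mu> a"
    and H: "H \<in> series (\<lambda>\<gamma>. restrict_to \<Sigma> (fourier \<mu> a) \<gamma> * c \<gamma>)"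
  shows "AE x in \<mu>. convolution \<mu> a F x = H x"
proof -
  let ?d = "\<lambda>\<gamma>. restrict_to \<Sigma> (fourier \<mu> a) \<gamma> * c \<gamma>"
  \<comment> \<open>F itself is an arbitrary representative; it is exchanged for one to which
    Tonelli applies, without changing the convolution.\<close>
  obtain F' where F': "F' \<in> series c" "jointly_measurable F'" using summation_exists[OF c] by blast
  have am: "a \<in> borel_measurable borel"
    using borel_measurable_integrable[OF a] by (simp add: borel_measurable_haar_iff)
  have eq: "convolution \<mu> a F = convolution \<mu> a F'"
    using summation_measurable[OF F] summation_measurable[OF F'(1)] summation_AE_unique[OF F F'(1)]
    by (intro convolution_AE_cong am)
  have intF': "integrable \<mu> F'" using Lq_integrable[OF summation_Lq[OF F'(1)]] .
  define A where "A = (LINT x|\<mu>. cmod (a x))"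
  have A: "0 \<le> A" unfolding A_def by (intro Bochner_Integration.integral_nonneg) auto
  have cm [measurable]: "convolution \<mu> a F' \<in> borel_measurable borel"
    by (rule convolution_L1_le(1)[OF a intF' F'(2) polynomials_const])
  have Hm [measurable]: "H \<in> borel_measurable borel" using summation_measurable[OF H] .
  have le: "(\<integral>\<^sup>+x. ennreal (cmod (convolution \<mu> a F' x - H x)) \<partial>\<mu>) \<le> ennreal (2 * (A + 1) * e)" if e: "0 < e" for e
  proof -
    obtain J1 where J1: "finite J1" "J1 \<subseteq> \<Sigma>"
      "\<And>J. finite J \<Longrightarrow> J1 \<subseteq> J \<Longrightarrow> J \<subseteq> \<Sigma> \<Longrightarrow> Lq_norm (\<lambda>x. F' x - trig_poly J c x) < e"
      using summation_approx[OF F'(1) e] by metis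
    obtain J2 where J2: "finite J2" "J2 \<subseteq> \<Sigma>"
      "\<And>J. finite J \<Longrightarrow> J2 \<subseteq> J \<Longrightarrow> J \<subseteq> \<Sigma> \<Longrightarrow> Lq_norm (\<lambda>x. H x - trig_poly J ?d x) < e"
      using summation_approx[OF H e] by metis
    define J where "J = J1 \<union> J2"
    have J: "finite J" "J \<subseteq> \<Sigma>" using J1 J2 by (auto simp: J_def)
    have n1: "Lq_norm (\<lambda>x. F' x - trig_poly J c x) \<le> e"
      by (rule less_imp_le[OF J1(3)]) (use J in \<open>auto simp: J_def\<close>)
    have n2: "Lq_norm (\<lambda>x. trig_poly J ?d x - H x) \<le> e"
      unfolding Lq_norm_minus_commute[of "trig_poly J ?d"]
      by (rule less_imp_le[OF J2(3)]) (use J in \<open>auto simp: J_def\<close>)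
    have d1: "(\<lambda>x. F' x - trig_poly J c x) \<in> Lq" "(\<lambda>x. trig_poly J ?d x - H x) \<in> Lq"
      by (rule Lq_diff(1)[OF summation_Lq[OF F'(1)] trig_poly_Lq[OF J]],
          rule Lq_diff(1)[OF trig_poly_Lq[OF J] summation_Lq[OF H]])
    have P: "trig_poly J c \<in> polynomials" "trig_poly J ?d \<in> polynomials" using J by (auto intro: trig_poly_Sigma)
    have [measurable]: "trig_poly J ?d \<in> borel_measurable borel" using polynomials_measurable[OF P(2)] .
    have JG: "J \<subseteq> dual_group" using J Sigma_dual by auto
    have "convolution \<mu> a (trig_poly J c) = trig_poly J (\<lambda>\<gamma>. fourier \<mu> a \<gamma> * c \<gamma>)"
      by (rule convolution_trig_poly[OF JG a])
    also have "\<dots> = trig_poly J ?d" using J by (intro trig_poly_cong) (auto simp: restrict_to_def)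
    finally have conv: "convolution \<mu> a (trig_poly J c) = trig_poly J ?d" .
    have "(\<integral>\<^sup>+x. ennreal (cmod (convolution \<mu> a F' x - H x)) \<partial>\<mu>) \<le>
      (\<integral>\<^sup>+x. ennreal (cmod (convolution \<mu> a F' x - trig_poly J ?d x)) + ennreal (cmod (trig_poly J ?d x - H x)) \<partial>\<mu>)"
    proof (intro nn_integral_mono)
      fix x
      have "cmod (convolution \<mu> a F' x - H x) \<le> cmod (convolution \<mu> a F' x - trig_poly J ?d x) + cmod (trig_poly J ?d x - H x)"
        using norm_triangle_ineq[of "convolution \<mu> a F' x - trig_poly J ?d x" "trig_poly J ?d x - H x"] by simp
      then show "ennreal (cmod (convolution \<mu> a F' x - H x)) \<le>
        ennreal (cmod (convolution \<mu> a F' x - trig_poly J ?d x)) + ennreal (cmod (trig_poly J ?d x - H x))"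
        unfolding ennreal_plus[OF norm_ge_zero norm_ge_zero, symmetric] by (rule ennreal_leI)
    qed
    also have "\<dots> = (\<integral>\<^sup>+x. ennreal (cmod (convolution \<mu> a F' x - trig_poly J ?d x)) \<partial>\<mu>) + (\<integral>\<^sup>+x. ennreal (cmod (trig_poly J ?d x - H x)) \<partial>\<mu>)"
      by (intro nn_integral_add) measurable
    also have "\<dots> \<le> ennreal (A * (2 * e)) + ennreal (2 * e)"
    proof (rule add_mono)
      have "(\<integral>\<^sup>+x. ennreal (cmod (convolution \<mu> a F' x - trig_poly J ?d x)) \<partial>\<mu>)
         \<le> ennreal A * ennreal (LINT x|\<mu>. cmod (F' x - trig_poly J c x))"
        using convolution_L1_le(2)[OF a intF' F'(2) P(1)] by (simp only: conv A_def)
      also have "\<dots> = ennreal (A * (LINT x|\<mu>. cmod (F' x - trig_poly J c x)))"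
        using A by (intro ennreal_mult[symmetric] Bochner_Integration.integral_nonneg) auto
      also have "\<dots> \<le> ennreal (A * (2 * e))"
        using A integral_le_Lq_norm[OF d1(1) n1] by (intro ennreal_leI mult_left_mono)
      finally show "(\<integral>\<^sup>+x. ennreal (cmod (convolution \<mu> a F' x - trig_poly J ?d x)) \<partial>\<mu>) \<le> ennreal (A * (2 * e))" .
      show "(\<integral>\<^sup>+x. ennreal (cmod (trig_poly J ?d x - H x)) \<partial>\<mu>) \<le> ennreal (2 * e)"
        using integral_le_Lq_norm[OF d1(2) n2] Lq_integrable[OF d1(2)]
        by (subst nn_integral_eq_integral) (auto intro: ennreal_leI)
    qed
    also have "\<dots> = ennreal (2 * (A + 1) * e)"
      using A e by (simp add: ennreal_plus[symmetric] algebra_simps del: ennreal_plus)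
    finally show ?thesis .
  qed
  have "(\<integral>\<^sup>+x. ennreal (cmod (convolution \<mu> a F' x - H x)) \<partial>\<mu>) \<le> 0"
  proof (rule ennreal_le_epsilon)
    fix e :: real assume e: "0 < e"
    have "0 < e / (2 * (A + 1))" using A e by simp
    from le[OF this] A show "(\<integral>\<^sup>+x. ennreal (cmod (convolution \<mu> a F' x - H x)) \<partial>\<mu>) \<le> 0 + ennreal e"
      by simp
  qed
  then have "(\<integral>\<^sup>+x. ennreal (cmod (convolution \<mu> a F' x - H x)) \<partial>\<mu>) = 0" by simp
  then have "AE x in \<mu>. ennreal (cmod (convolution \<mu> a F' x - H x)) = 0"
    by (subst (asm) nn_integral_0_iff_AE) measurable
  then have "AE x in \<mu>. convolution \<mu> a F' x = H x" by eventually_elim simp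
  then show ?thesis by (simp add: eq)
qed

end

section \<open>The induced map is a centralizer\<close>

context compact_haar begin

lemma ae_class_cong: "AE x in \<mu>. f x = g x \<Longrightarrow> ae_class \<mu> f = ae_class \<mu> g"
  by (auto simp: ae_class_def elim: eventually_elim2)

lemma rep_ae_class:
  assumes "f \<in> borel_measurable borel"
  shows "rep (ae_class \<mu> f) \<in> borel_measurable borel" "AE x in \<mu>. rep (ae_class \<mu> f) x = f x"
proof -
  have "f \<in> ae_class \<mu> f" using assms by (simp add: ae_class_def borel_measurable_haar_iff)
  then have "rep (ae_class \<mu> f) \<in> ae_class \<mu> f" unfolding rep_def by (rule someI[of "\<lambda>g. g \<in> ae_class \<mu> f"])
  then show "rep (ae_class \<mu> f) \<in> borel_measurable borel" "AE x in \<mu>. rep (ae_class \<mu> f) x = f x"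
    by (auto simp: ae_class_def borel_measurable_haar_iff)
qed

lemma vadd_ae_class:
  assumes "f \<in> borel_measurable borel" "g \<in> borel_measurable borel"
  shows "vadd (Lp \<mu> p) (ae_class \<mu> f) (ae_class \<mu> g) = ae_class \<mu> (\<lambda>x. f x + g x)"
  unfolding Lp_def qmodule.simps
proof (rule ae_class_cong)
  show "AE x in \<mu>. rep (ae_class \<mu> f) x + rep (ae_class \<mu> g) x = f x + g x"
    using rep_ae_class(2)[OF assms(1)] rep_ae_class(2)[OF assms(2)] by eventually_elim simp
qed

lemma vscale_ae_class:
  assumes "f \<in> borel_measurable borel"
  shows "vscale (Lp \<mu> p) t (ae_class \<mu> f) = ae_class \<mu> (\<lambda>x. t * f x)"
  unfolding Lp_def qmodule.simps
proof (rule ae_class_cong)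
  show "AE x in \<mu>. t * rep (ae_class \<mu> f) x = t * f x"
    using rep_ae_class(2)[OF assms] by eventually_elim simp
qed

lemma vsub_ae_class:
  assumes [measurable]: "f \<in> borel_measurable borel" "g \<in> borel_measurable borel"
  shows "vsub (Lp \<mu> p) (ae_class \<mu> f) (ae_class \<mu> g) = ae_class \<mu> (\<lambda>x. f x - g x)"
proof -
  have "(\<lambda>x. - 1 * g x) \<in> borel_measurable borel" by measurable
  then show ?thesis by (simp add: vsub_def vscale_ae_class vadd_ae_class assms)
qed

lemma convolution_algebra_carrier:
  assumes "a \<in> carrier (Lp \<mu> 1)" shows "integrable \<mu> (rep a)"
proof -
  obtain a0 where a0: "a = ae_class \<mu> a0" "integrable \<mu> a0"
    using assms by (auto simp: Lp_def Lp_functions_1_iff)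
  have m: "a0 \<in> borel_measurable borel"
    using borel_measurable_integrable[OF a0(2)] by (simp add: borel_measurable_haar_iff)
  have "AE x in \<mu>. rep a x = a0 x" "rep a \<in> borel_measurable \<mu>"
    using rep_ae_class[OF m] by (auto simp: a0 borel_measurable_haar_iff)
  then show ?thesis using a0(2) m borel_measurable_haar_iff[of a0]
    by (subst integrable_cong_AE[of _ _ a0]) auto
qed

lemma qnorm_convolution_algebra: "qnorm (Lp \<mu> 1) a = (LINT x|\<mu>. cmod (rep a x))"
  by (simp add: Lp_def Lp_norm_1)

end

lemma restrict_to_functions_on: "restrict_to \<Sigma> c \<in> functions_on \<Sigma>"
  by (simp add: restrict_to_def functions_on_def)

context sidon_haar begin

lemma qnorm_ae_class:
  assumes "f \<in> borel_measurable borel" shows "qnorm (Lp \<mu> q) (ae_class \<mu> f) = Lq_norm f"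
  unfolding Lp_def qmodule.simps using rep_ae_class[OF assms] by (intro Lq_AE_cong(2) assms)

text \<open>Uniqueness gives one inclusion and stability under almost-everywhere change the other.
  Thus the set of limits is itself an element of \<open>Lp\<close>.\<close>

lemma summation_ae_class:
  assumes F: "F \<in> series c" shows "series c = ae_class \<mu> F"
proof (intro equalityI subsetI)
  fix H assume H: "H \<in> series c"
  then show "H \<in> ae_class \<mu> F"
    using summation_AE_unique[OF H F] summation_measurable[OF H]
    by (simp add: ae_class_def borel_measurable_haar_iff)
next
  fix H assume "H \<in> ae_class \<mu> F"
  then show "H \<in> series c"
    by (intro summation_AE_cong[OF F]) (auto simp: ae_class_def borel_measurable_haar_iff)
qed

text \<open>For p = \<infinity> this is Bessel's inequality. Otherwise the square sum of the
  coefficients equals the pairing of f with its partial sum g over J; since p > 1 the conjugate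
  exponent t is finite, and the \<Lambda>(t) bound controls the L_t norm of g by its l_2
  norm.\<close>

lemma l2_fin_fourier_le_Lp_norm:
  assumes p: "1 < p"
  shows "\<exists>D>0. \<forall>f\<in>polynomials. \<forall>J. finite J \<longrightarrow> J \<subseteq> \<Sigma> \<longrightarrow> l2_fin (fourier \<mu> f) J \<le> D * Lp_norm \<mu> p f"
proof (cases "p = \<infinity>")
  case True
  have "l2_fin (fourier \<mu> f) J \<le> 1 * Lp_norm \<mu> p f" if f: "f \<in> polynomials" and J: "finite J" "J \<subseteq> \<Sigma>" for f J
  proof -
    define N where "N = Lp_norm \<mu> p f"
    have N0: "0 \<le> N" by (simp add: N_def Lp_norm_nonneg)
    have "f \<in> Lp_functions \<mu> p" using f p by (intro polynomials_Lp_functions) auto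
    then have fin: "esssup \<mu> (\<lambda>x. ennreal (cmod (f x))) < \<infinity>" using True by (simp add: Lp_functions_def)
    have "AE x in \<mu>. ennreal (cmod (f x)) \<le> esssup \<mu> (\<lambda>x. ennreal (cmod (f x)))" by (rule esssup_AE)
    moreover have "esssup \<mu> (\<lambda>x. ennreal (cmod (f x))) = ennreal N"
      using fin True by (simp add: N_def Lp_norm_def)
    ultimately have ae: "AE x in \<mu>. (cmod (f x))\<^sup>2 \<le> N\<^sup>2"
      using N0 by (auto simp: ennreal_le_iff elim!: eventually_mono intro: power_mono)
    have "(\<Sum>\<gamma>\<in>J. (cmod (fourier \<mu> f \<gamma>))\<^sup>2) \<le> (LINT x|\<mu>. (cmod (f x))\<^sup>2)"
      using J Sigma_dual by (intro bessel_polynomial f) auto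
    also have "\<dots> \<le> (LINT x|\<mu>. N\<^sup>2)"
      by (intro integral_mono_AE ae polynomials_power_integrable f) auto
    also have "\<dots> = N\<^sup>2" using prob_space by simp
    finally show ?thesis using N0 by (simp add: L2_set_def real_sqrt_le_iff' sum_nonneg N_def)
  qed
  then show ?thesis by (intro exI[of _ 1]) auto
next
  case False
  define s where "s = enn2real p"
  have "ennreal s = p" using False by (simp add: s_def less_top)
  then have "ennreal 1 < ennreal s" using p by simp
  then have s: "1 < s" using ennreal_less_iff[of 1 s] by simp
  define t where "t = s / (s - 1)"
  have t: "1 < t" "1 / s + 1 / t = 1" using s by (auto simp: t_def field_simps)
  obtain B where B: "B > 0" and "\<forall>J c. finite J \<longrightarrow> J \<subseteq> \<Sigma> \<longrightarrow>
     (LINT x|\<mu>. cmod (trig_poly J c x) powr t) \<le> (B * l2_fin c J) powr t"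
    using sidon_powr_bound[OF sidon less_imp_le[OF t(1)]] by (elim exE conjE) (rule that)
  note Bb = this(2)[rule_format]
  have "l2_fin (fourier \<mu> f) J \<le> (2 * B) * Lp_norm \<mu> p f" if f: "f \<in> polynomials" and J: "finite J" "J \<subseteq> \<Sigma>" for f J
  proof (rule field_le_epsilon)
    fix e :: real assume e: "0 < e"
    define N where "N = Lp_norm \<mu> p f"
    have N0: "0 \<le> N" by (simp add: N_def Lp_norm_nonneg)
    have Nint: "(LINT x|\<mu>. cmod (f x) powr s) = N powr s"
      using False s by (simp add: N_def Lp_norm_def s_def powr_powr Bochner_Integration.integral_nonneg)
    \<comment> \<open>A positive substitute for the norm N, so that f can be divided by it; the
      excess becomes e in the final bound.\<close>
    define A where "A = N + e / (2 * B)"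
    have A: "0 < A" "N \<le> A" using N0 e B by (auto simp: A_def add_nonneg_pos)
    define n where "n = l2_fin (fourier \<mu> f) J"
    define g where "g = trig_poly J (fourier \<mu> f)"
    have g: "g \<in> polynomials" unfolding g_def by (rule trig_poly_Sigma[OF J])
    have n0: "0 \<le> n" by (simp add: n_def L2_set_nonneg)
    have "n \<le> 2 * B * A"
    proof (cases "n = 0")
      case True then show ?thesis using A B by simp
    next
      case False
      then have n: "0 < n" using n0 by simp
      have "complex_of_real (n\<^sup>2) = (\<Sum>\<gamma>\<in>J. fourier \<mu> f \<gamma> * cnj (fourier \<mu> f \<gamma>))"
        by (simp only: n_def L2_set_def real_sqrt_pow2 sum_nonneg zero_le_power2 of_real_sum complex_norm_square)
      also have "\<dots> = (LINT x|\<mu>. f x * cnj (g x))"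
        unfolding g_def using J Sigma_dual by (intro integral_mult_cnj_trig_poly[symmetric] polynomials_integrable f) auto
      finally have "n\<^sup>2 = cmod (LINT x|\<mu>. f x * cnj (g x))" by (metis norm_of_real abs_of_nonneg zero_le_power2)
      also have "\<dots> \<le> (LINT x|\<mu>. cmod (f x * cnj (g x)))" by (rule integral_norm_bound)
      also have "\<dots> \<le> (LINT x|\<mu>. A * (B * n) * ((cmod (f x) powr s) / A powr s + (cmod (g x) powr t) / (B * n) powr t))"
      proof (intro integral_mono)
        show "integrable \<mu> (\<lambda>x. cmod (f x * cnj (g x)))"
          by (intro integrable_norm polynomials_integrable polynomials_mult f polynomials_cnj g)
        show "integrable \<mu> (\<lambda>x. A * (B * n) * ((cmod (f x) powr s) / A powr s + (cmod (g x) powr t) / (B * n) powr t))"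
          using s t by (intro Bochner_Integration.integrable_mult_right Bochner_Integration.integrable_add
              integrable_divide polynomials_powr_integrable f g) auto
        fix x
        \<comment> \<open>Hoelder's inequality is obtained from Young's for the normalized
          functions; dropping the weights 1/s and 1/t is what puts the 2 into the constant 2
          B.\<close>
        have "(cmod (f x) / A) * (cmod (g x) / (B * n)) \<le> (cmod (f x) / A) powr s / s + (cmod (g x) / (B * n)) powr t / t"
          using A B n by (intro Youngs_inequality s t) auto
        also have "\<dots> \<le> (cmod (f x) / A) powr s + (cmod (g x) / (B * n)) powr t"
          using s t by (intro add_mono) (auto simp: divide_le_eq mult_le_cancel_left1)
        finally have "(cmod (f x) / A) * (cmod (g x) / (B * n)) \<le> cmod (f x) powr s / A powr s + cmod (g x) powr t / (B * n) powr t"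
          using A B n by (simp add: powr_divide)
        then have "A * (B * n) * ((cmod (f x) / A) * (cmod (g x) / (B * n))) \<le> A * (B * n) * (cmod (f x) powr s / A powr s + cmod (g x) powr t / (B * n) powr t)"
          using A B n by (intro mult_left_mono) auto
        moreover have "A * (B * n) * ((cmod (f x) / A) * (cmod (g x) / (B * n))) = cmod (f x * cnj (g x))"
          using A B n by (simp add: norm_mult)
        ultimately show "cmod (f x * cnj (g x)) \<le> A * (B * n) * ((cmod (f x) powr s) / A powr s + (cmod (g x) powr t) / (B * n) powr t)"
          by linarith
      qed
      also have "\<dots> = A * (B * n) * ((LINT x|\<mu>. cmod (f x) powr s) / A powr s + (LINT x|\<mu>. cmod (g x) powr t) / (B * n) powr t)"
        using polynomials_powr_integrable[OF f, of s] polynomials_powr_integrable[OF g, of t] s t by simp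
      also have "\<dots> \<le> A * (B * n) * (1 + 1)"
      proof (intro mult_left_mono add_mono)
        show "(LINT x|\<mu>. cmod (f x) powr s) / A powr s \<le> 1"
          unfolding Nint using A N0 s by (simp add: divide_le_eq powr_mono2)
        show "(LINT x|\<mu>. cmod (g x) powr t) / (B * n) powr t \<le> 1"
          using Bb[OF J, of "fourier \<mu> f"] B n by (simp add: divide_le_eq g_def n_def)
      qed (use A B n in auto)
      finally have "n * n \<le> n * (2 * B * A)" by (simp add: power2_eq_square mult_ac)
      then show ?thesis using n by simp
    qed
    also have "2 * B * A = 2 * B * N + e" using B by (simp add: A_def distrib_left)
    finally show "l2_fin (fourier \<mu> f) J \<le> 2 * B * Lp_norm \<mu> p f + e" by (simp add: n_def N_def)
  qed
  then show ?thesis using B by (intro exI[of _ "2 * B"]) auto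
qed

definition coefficients :: "('g \<Rightarrow> complex) \<Rightarrow> ('g \<Rightarrow> complex) \<Rightarrow> complex" where
  "coefficients f = restrict_to \<Sigma> (fourier \<mu> f)"

lemma coefficients_eq: "\<gamma> \<in> \<Sigma> \<Longrightarrow> coefficients f \<gamma> = fourier \<mu> f \<gamma>"
  by (simp add: coefficients_def restrict_to_def)

lemma coefficients_l2_0:
  assumes "f \<in> polynomials" shows "coefficients f \<in> carrier (l2_0 \<Sigma>)"
proof -
  obtain J where J: "finite J" "J \<subseteq> dual_group" "f = trig_poly J (fourier \<mu> f)"
    "\<And>\<gamma>. \<gamma> \<in> dual_group - J \<Longrightarrow> fourier \<mu> f \<gamma> = 0"
    using polynomial_expansion[OF assms] by blast
  have "{\<gamma>. coefficients f \<gamma> \<noteq> 0} \<subseteq> J"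
    using J(4) Sigma_dual by (auto simp: coefficients_def restrict_to_def split: if_splits)
  then show ?thesis
    using J(1) finite_subset restrict_to_functions_on[of \<Sigma>] by (auto simp: l2_0_def coefficients_def)
qed

lemma l2_0_carrier_iff:
  "c \<in> carrier (l2_0 \<Sigma>) \<longleftrightarrow> c \<in> functions_on \<Sigma> \<and> finite {\<gamma>. c \<gamma> \<noteq> 0}"
  by (simp add: l2_0_def)

lemma l2_0_carrier_l2:
  assumes "c \<in> carrier (l2_0 \<Sigma>)" shows "c \<in> carrier (l2 \<Sigma>)"
proof (rule l2_finite_support(1))
  show "finite {\<gamma>. c \<gamma> \<noteq> 0}" using assms by (simp add: l2_0_carrier_iff)
  show "{\<gamma>. c \<gamma> \<noteq> 0} \<subseteq> \<Sigma>" using assms by (auto simp: l2_0_carrier_iff functions_on_def)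
qed simp

lemma l2_norm_coefficients_le:
  assumes p: "1 < p"
  obtains D where "D > 0" "\<And>f. f \<in> polynomials \<Longrightarrow> l2n (coefficients f) \<le> D * Lp_norm \<mu> p f"
proof -
  obtain D where D: "D > 0" and "\<forall>f\<in>polynomials. \<forall>J. finite J \<longrightarrow> J \<subseteq> \<Sigma> \<longrightarrow> l2_fin (fourier \<mu> f) J \<le> D * Lp_norm \<mu> p f"
    using l2_fin_fourier_le_Lp_norm[OF p] by (elim exE conjE) (rule that)
  note * = this(2)[rule_format]
  have "l2n (coefficients f) \<le> D * Lp_norm \<mu> p f" if f: "f \<in> polynomials" for f
  proof (rule l2_boundedI(2))
    show "coefficients f \<in> functions_on \<Sigma>" by (simp add: coefficients_def restrict_to_functions_on)
    show "0 \<le> D * Lp_norm \<mu> p f" using D by (simp add: Lp_norm_nonneg)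
    fix J assume J: "finite J" "J \<subseteq> \<Sigma>"
    have "l2_fin (coefficients f) J = l2_fin (fourier \<mu> f) J"
      using J by (intro L2_set_cong) (auto simp: coefficients_eq)
    then show "l2_fin (coefficients f) J \<le> D * Lp_norm \<mu> p f" using *[OF f J] by simp
  qed
  with D show ?thesis by (rule that)
qed

lemma coefficients_add:
  assumes "integrable \<mu> f" "integrable \<mu> g"
  shows "coefficients (\<lambda>x. f x + g x) = (\<lambda>\<gamma>. coefficients f \<gamma> + coefficients g \<gamma>)"
  using assms Sigma_dual by (auto simp: coefficients_def restrict_to_def fourier_add fun_eq_iff subset_iff)

lemma coefficients_scale: "coefficients (\<lambda>x. t * f x) = (\<lambda>\<gamma>. t * coefficients f \<gamma>)"
  by (auto simp: coefficients_def restrict_to_def fourier_scale fun_eq_iff)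

lemma convolution_polynomial:
  assumes f: "f \<in> polynomials" and a: "integrable \<mu> a"
  shows "convolution \<mu> a f \<in> polynomials"
    "coefficients (convolution \<mu> a f) = (\<lambda>\<gamma>. coefficients a \<gamma> * coefficients f \<gamma>)"
proof -
  obtain J where J: "finite J" "J \<subseteq> dual_group" "f = trig_poly J (fourier \<mu> f)"
    "\<And>\<gamma>. \<gamma> \<in> dual_group - J \<Longrightarrow> fourier \<mu> f \<gamma> = 0"
    using polynomial_expansion[OF f] by blast
  have eq: "convolution \<mu> a f = trig_poly J (\<lambda>\<gamma>. fourier \<mu> a \<gamma> * fourier \<mu> f \<gamma>)"
    by (subst J(3)) (rule convolution_trig_poly[OF J(2) a])
  then show "convolution \<mu> a f \<in> polynomials" using J by (simp add: polynomials_trig_poly)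
  show "coefficients (convolution \<mu> a f) = (\<lambda>\<gamma>. coefficients a \<gamma> * coefficients f \<gamma>)"
    unfolding eq using J Sigma_dual
    by (auto simp: coefficients_def restrict_to_def fourier_trig_poly subset_iff fun_eq_iff)
qed

lemma coefficients_linf:
  assumes "integrable \<mu> a"
  shows "coefficients a \<in> carrier (linf \<Sigma>)" "qnorm (linf \<Sigma>) (coefficients a) \<le> (LINT x|\<mu>. cmod (a x))"
    "cmod (coefficients a \<gamma>) \<le> (LINT x|\<mu>. cmod (a x))"
proof -
  show le: "cmod (coefficients a \<gamma>) \<le> (LINT x|\<mu>. cmod (a x))" for \<gamma>
    using norm_fourier_le[of \<gamma> a] Sigma_dual
    by (auto simp: coefficients_def restrict_to_def intro!: Bochner_Integration.integral_nonneg)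
  then show "coefficients a \<in> carrier (linf \<Sigma>)"
    by (auto simp: linf_def coefficients_def restrict_to_functions_on intro!: boundedI)
  show "qnorm (linf \<Sigma>) (coefficients a) \<le> (LINT x|\<mu>. cmod (a x))"
    by (auto simp: linf_def intro!: cSUP_least le)
qed

end

text \<open>The centralizer hypotheses on \<Omega> with the operations unfolded. Nonnegative
  constants let estimates be chained by monotonicity.\<close>

locale sidon_centralizer = sidon_haar \<mu> q \<Sigma>
  for \<mu> :: "'g::{topological_ab_group_add, t2_space} measure" and q :: ennreal
    and \<Sigma> :: "('g \<Rightarrow> complex) set" +
  fixes \<Omega> :: "(('g \<Rightarrow> complex) \<Rightarrow> complex) \<Rightarrow> (('g \<Rightarrow> complex) \<Rightarrow> complex)" and Q C :: real
  assumes Omega_carrier: "c \<in> carrier (l2_0 \<Sigma>) \<Longrightarrow> \<Omega> c \<in> carrier (l2 \<Sigma>)"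
    and Omega_scale: "c \<in> carrier (l2_0 \<Sigma>) \<Longrightarrow> \<Omega> (\<lambda>\<gamma>. t * c \<gamma>) = (\<lambda>\<gamma>. t * \<Omega> c \<gamma>)"
    and Q_nonneg: "0 \<le> Q" and C_nonneg: "0 \<le> C"
    and Omega_add: "c \<in> carrier (l2_0 \<Sigma>) \<Longrightarrow> d \<in> carrier (l2_0 \<Sigma>) \<Longrightarrow>
      l2n (\<lambda>\<gamma>. \<Omega> (\<lambda>\<gamma>. c \<gamma> + d \<gamma>) \<gamma> - \<Omega> c \<gamma> - \<Omega> d \<gamma>) \<le> Q * (l2n c + l2n d)"
    and Omega_mult: "u \<in> carrier (linf \<Sigma>) \<Longrightarrow> c \<in> carrier (l2_0 \<Sigma>) \<Longrightarrow>
      l2n (\<lambda>\<gamma>. \<Omega> (\<lambda>\<gamma>. u \<gamma> * c \<gamma>) \<gamma> - u \<gamma> * \<Omega> c \<gamma>) \<le> C * qnorm (linf \<Sigma>) u * l2n c"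
begin

lemma mho_eq: "mho \<mu> q \<Sigma> \<Omega> f = series (\<Omega> (coefficients f))"
  by (simp add: mho_def coefficients_def)

lemma mho_exists:
  assumes "f \<in> polynomials"
  obtains F where "F \<in> series (\<Omega> (coefficients f))" "mho \<mu> q \<Sigma> \<Omega> f = ae_class \<mu> F"
    "F \<in> borel_measurable borel"
proof -
  obtain F where F: "F \<in> series (\<Omega> (coefficients f))"
    using summation_exists[OF Omega_carrier[OF coefficients_l2_0[OF assms]]] by blast
  then show ?thesis using summation_ae_class[OF F] summation_measurable[OF F] that by (simp add: mho_eq)
qed

text \<open>The action is computed from a chosen representative of the class. Every representative
  is again a sum of the same series, so the multiplication rule for coefficients applies to
  it.\<close>

lemma act_mho:
  assumes f: "f \<in> polynomials" and a: "a \<in> carrier (Lp \<mu> 1)"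
    and H: "H \<in> series (\<lambda>\<gamma>. coefficients (rep a) \<gamma> * \<Omega> (coefficients f) \<gamma>)"
  shows "act (Lp \<mu> q) a (mho \<mu> q \<Sigma> \<Omega> f) = ae_class \<mu> H"
proof -
  obtain F where F: "F \<in> series (\<Omega> (coefficients f))" "mho \<mu> q \<Sigma> \<Omega> f = ae_class \<mu> F"
    "F \<in> borel_measurable borel"
    using mho_exists[OF f] .
  have R: "rep (ae_class \<mu> F) \<in> series (\<Omega> (coefficients f))"
    using rep_ae_class[OF F(3)] by (intro summation_AE_cong[OF F(1)])
  have "AE x in \<mu>. convolution \<mu> (rep a) (rep (ae_class \<mu> F)) x = H x"
    using H by (intro summation_convolution[OF Omega_carrier[OF coefficients_l2_0[OF f]] R
        convolution_algebra_carrier[OF a]]) (simp add: coefficients_def)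
  then have "ae_class \<mu> (convolution \<mu> (rep a) (rep (ae_class \<mu> F))) = ae_class \<mu> H"
    by (rule ae_class_cong)
  then show ?thesis by (simp add: F(2) Lp_def)
qed

text \<open>S is linear and intertwines the two actions, so each centralizer error of the induced
  map is S of the corresponding error of \<Omega>. The constants are B Q D and B C D, where B bounds
  S and D bounds the coefficient map from L_p to l_2.\<close>

lemma centralizer_mho:
  assumes p: "1 < p"
  shows "centralizer (Lp \<mu> 1) (Lp0 \<mu> p) (Lp \<mu> q) (mho \<mu> q \<Sigma> \<Omega>)"
proof -
  obtain B where B: "B > 0" "\<And>F c. c \<in> carrier (l2 \<Sigma>) \<Longrightarrow> F \<in> series c \<Longrightarrow> Lq_norm F \<le> B * l2n c"
    using summation_norm_le by metis
  obtain D where D: "D > 0" "\<And>f. f \<in> polynomials \<Longrightarrow> l2n (coefficients f) \<le> D * Lp_norm \<mu> p f"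
    using l2_norm_coefficients_le[OF p] by metis
  show ?thesis
    unfolding centralizer_def homogeneous_map_def
  proof (intro conjI exI ballI allI)
    show "mho \<mu> q \<Sigma> \<Omega> \<in> carrier (Lp0 \<mu> p) \<rightarrow> carrier (Lp \<mu> q)"
    proof
      fix f assume "f \<in> carrier (Lp0 \<mu> p)"
      then have f: "f \<in> polynomials" by (simp add: Lp0_def)
      obtain F where F: "F \<in> series (\<Omega> (coefficients f))" "mho \<mu> q \<Sigma> \<Omega> f = ae_class \<mu> F"
        using mho_exists[OF f] .
      then show "mho \<mu> q \<Sigma> \<Omega> f \<in> carrier (Lp \<mu> q)" using summation_Lq[OF F(1)] by (simp add: Lp_def)
    qed
  next
    fix f t assume "f \<in> carrier (Lp0 \<mu> p)"
    then have f: "f \<in> polynomials" by (simp add: Lp0_def)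
    obtain F where F: "F \<in> series (\<Omega> (coefficients f))" "mho \<mu> q \<Sigma> \<Omega> f = ae_class \<mu> F"
      "F \<in> borel_measurable borel"
      using mho_exists[OF f] .
    have "(\<lambda>x. t * F x) \<in> series (\<Omega> (coefficients (\<lambda>x. t * f x)))"
      using summation_scale[OF F(1), of t] Omega_scale[OF coefficients_l2_0[OF f]] by (simp add: coefficients_scale)
    from summation_ae_class[OF this]
    show "mho \<mu> q \<Sigma> \<Omega> (vscale (Lp0 \<mu> p) t f) = vscale (Lp \<mu> q) t (mho \<mu> q \<Sigma> \<Omega> f)"
      using vscale_ae_class[OF F(3)] by (simp add: mho_eq[of "\<lambda>x. t * f x"] F(2) Lp0_def)
  next
    fix f g assume "f \<in> carrier (Lp0 \<mu> p)" "g \<in> carrier (Lp0 \<mu> p)"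
    then have f: "f \<in> polynomials" and g: "g \<in> polynomials" by (auto simp: Lp0_def)
    let ?h = "\<lambda>x. f x + g x"
    have h: "?h \<in> polynomials" by (rule polynomials_add[OF f g])
    obtain F where F: "F \<in> series (\<Omega> (coefficients f))" "mho \<mu> q \<Sigma> \<Omega> f = ae_class \<mu> F"
      "F \<in> borel_measurable borel" using mho_exists[OF f] .
    obtain G where G: "G \<in> series (\<Omega> (coefficients g))" "mho \<mu> q \<Sigma> \<Omega> g = ae_class \<mu> G"
      "G \<in> borel_measurable borel" using mho_exists[OF g] .
    obtain H where H: "H \<in> series (\<Omega> (coefficients ?h))" "mho \<mu> q \<Sigma> \<Omega> ?h = ae_class \<mu> H"
      "H \<in> borel_measurable borel" using mho_exists[OF h] .
    let ?E = "\<lambda>x. H x - F x - G x"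
    have coeffs: "coefficients ?h = (\<lambda>\<gamma>. coefficients f \<gamma> + coefficients g \<gamma>)"
      using f g by (intro coefficients_add polynomials_integrable)
    have E: "?E \<in> series (\<lambda>\<gamma>. \<Omega> (coefficients ?h) \<gamma> - \<Omega> (coefficients f) \<gamma> - \<Omega> (coefficients g) \<gamma>)"
      by (intro summation_diff F G H)
    have "(\<lambda>\<gamma>. \<Omega> (coefficients ?h) \<gamma> - \<Omega> (coefficients f) \<gamma> - \<Omega> (coefficients g) \<gamma>) \<in> carrier (l2 \<Sigma>)"
      by (intro l2_diff(1) Omega_carrier coefficients_l2_0 f g h)
    from B(2)[OF this E] have "Lq_norm ?E \<le> B * l2n (\<lambda>\<gamma>. \<Omega> (coefficients ?h) \<gamma> - \<Omega> (coefficients f) \<gamma> - \<Omega> (coefficients g) \<gamma>)" .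
    also have "\<dots> \<le> B * (Q * (l2n (coefficients f) + l2n (coefficients g)))"
      using B(1) Omega_add[OF coefficients_l2_0[OF f] coefficients_l2_0[OF g]] unfolding coeffs by (intro mult_left_mono) auto
    also have "\<dots> \<le> B * (Q * (D * Lp_norm \<mu> p f + D * Lp_norm \<mu> p g))"
      using B(1) Q_nonneg D(2)[OF f] D(2)[OF g] by (intro mult_left_mono add_mono) auto
    also have "\<dots> = (B * Q * D) * (Lp_norm \<mu> p f + Lp_norm \<mu> p g)" by (simp add: algebra_simps)
    finally have le: "Lq_norm ?E \<le> (B * Q * D) * (Lp_norm \<mu> p f + Lp_norm \<mu> p g)" .
    have [measurable]: "F \<in> borel_measurable borel" "G \<in> borel_measurable borel" "H \<in> borel_measurable borel" by fact+
    have m: "(\<lambda>x. H x - F x) \<in> borel_measurable borel" "?E \<in> borel_measurable borel" by measurable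
    have "vsub (Lp \<mu> q) (vsub (Lp \<mu> q) (mho \<mu> q \<Sigma> \<Omega> ?h) (mho \<mu> q \<Sigma> \<Omega> f)) (mho \<mu> q \<Sigma> \<Omega> g) = ae_class \<mu> ?E"
      using m by (simp add: F(2) G(2) H(2) vsub_ae_class F(3) G(3) H(3))
    then show "qnorm (Lp \<mu> q) (vsub (Lp \<mu> q) (vsub (Lp \<mu> q) (mho \<mu> q \<Sigma> \<Omega> (vadd (Lp0 \<mu> p) f g)) (mho \<mu> q \<Sigma> \<Omega> f)) (mho \<mu> q \<Sigma> \<Omega> g))
        \<le> (B * Q * D) * (qnorm (Lp0 \<mu> p) f + qnorm (Lp0 \<mu> p) g)"
      using le qnorm_ae_class[OF m(2)] by (simp add: Lp0_def)
  next
    fix a f assume a: "a \<in> carrier (Lp \<mu> 1)" and "f \<in> carrier (Lp0 \<mu> p)"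
    then have f: "f \<in> polynomials" by (auto simp: Lp0_def)
    have inta: "integrable \<mu> (rep a)" by (rule convolution_algebra_carrier[OF a])
    define A where "A = (LINT x|\<mu>. cmod (rep a x))"
    have A0: "0 \<le> A" unfolding A_def by (intro Bochner_Integration.integral_nonneg) auto
    let ?u = "coefficients (rep a)" and ?c = "coefficients f"
    let ?h = "convolution \<mu> (rep a) f"
    have h: "?h \<in> polynomials" and ch: "coefficients ?h = (\<lambda>\<gamma>. ?u \<gamma> * ?c \<gamma>)"
      using convolution_polynomial[OF f inta] by auto
    obtain F where F: "F \<in> series (\<Omega> (coefficients ?h))" "mho \<mu> q \<Sigma> \<Omega> ?h = ae_class \<mu> F"
      "F \<in> borel_measurable borel" using mho_exists[OF h] .
    have uc: "(\<lambda>\<gamma>. ?u \<gamma> * \<Omega> ?c \<gamma>) \<in> carrier (l2 \<Sigma>)"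
      by (rule l2_dominated(1)[OF Omega_carrier[OF coefficients_l2_0[OF f]] A0])
         (auto simp: norm_mult A_def intro!: mult_right_mono coefficients_linf(3)[OF inta])
    obtain H where H: "H \<in> series (\<lambda>\<gamma>. ?u \<gamma> * \<Omega> ?c \<gamma>)" using summation_exists[OF uc] by blast
    have Hm: "H \<in> borel_measurable borel" by (rule summation_measurable[OF H])
    let ?E = "\<lambda>x. F x - H x"
    have E: "?E \<in> series (\<lambda>\<gamma>. \<Omega> (coefficients ?h) \<gamma> - ?u \<gamma> * \<Omega> ?c \<gamma>)"
      by (intro summation_diff F H)
    have "(\<lambda>\<gamma>. \<Omega> (coefficients ?h) \<gamma> - ?u \<gamma> * \<Omega> ?c \<gamma>) \<in> carrier (l2 \<Sigma>)"
      by (intro l2_diff(1) Omega_carrier coefficients_l2_0 h uc)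
    from B(2)[OF this E] have "Lq_norm ?E \<le> B * l2n (\<lambda>\<gamma>. \<Omega> (coefficients ?h) \<gamma> - ?u \<gamma> * \<Omega> ?c \<gamma>)" .
    also have "\<dots> \<le> B * (C * qnorm (linf \<Sigma>) ?u * l2n ?c)"
      using B(1) Omega_mult[OF coefficients_linf(1)[OF inta] coefficients_l2_0[OF f]]
      unfolding ch by (intro mult_left_mono) auto
    also have "\<dots> \<le> B * (C * A * l2n ?c)"
      using B(1) C_nonneg coefficients_linf(2)[OF inta]
      by (intro mult_left_mono mult_right_mono) (auto simp: A_def l2_norm_nonneg)
    also have "\<dots> \<le> B * (C * A * (D * Lp_norm \<mu> p f))"
      using B(1) C_nonneg A0 D(2)[OF f] by (intro mult_left_mono) auto
    also have "\<dots> = (B * C * D) * A * Lp_norm \<mu> p f" by (simp add: mult_ac)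
    finally have le: "Lq_norm ?E \<le> (B * C * D) * A * Lp_norm \<mu> p f" .
    have [measurable]: "F \<in> borel_measurable borel" "H \<in> borel_measurable borel" by fact+
    have m: "?E \<in> borel_measurable borel" by measurable
    have "vsub (Lp \<mu> q) (mho \<mu> q \<Sigma> \<Omega> ?h) (act (Lp \<mu> q) a (mho \<mu> q \<Sigma> \<Omega> f)) = ae_class \<mu> ?E"
      by (simp add: F(2) act_mho[OF f a H] vsub_ae_class F(3) Hm)
    moreover have "act (Lp0 \<mu> p) a f = ?h" "qnorm (Lp0 \<mu> p) f = Lp_norm \<mu> p f" by (simp_all add: Lp0_def)
    ultimately show "qnorm (Lp \<mu> q) (vsub (Lp \<mu> q) (mho \<mu> q \<Sigma> \<Omega> (act (Lp0 \<mu> p) a f)) (act (Lp \<mu> q) a (mho \<mu> q \<Sigma> \<Omega> f)))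
        \<le> (B * C * D) * qnorm (Lp \<mu> 1) a * qnorm (Lp0 \<mu> p) f"
      using le qnorm_ae_class[OF m] by (simp add: A_def qnorm_convolution_algebra)
  qed
qed

end

section \<open>Nontriviality\<close>

context compact_haar begin

text \<open>The substitution y -> x - y shows that convolving with \<gamma> projects onto the
  \<gamma>-component. The factor a is only almost everywhere \<gamma> because it arises as a
  representative of a class.\<close>

lemma convolution_character:
  assumes g: "\<gamma> \<in> dual_group" and H: "H \<in> borel_measurable borel"
    and a: "a \<in> borel_measurable borel" "AE x in \<mu>. a x = \<gamma> x"
  shows "convolution \<mu> a H = (\<lambda>x. fourier \<mu> H \<gamma> * \<gamma> x)"
proof
  fix x
  note [measurable] = H a(1) character_measurable[OF g]
  have [measurable]: "(\<lambda>y. H (x - y)) \<in> borel_measurable borel"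
    using measurable_compose[OF measurable_reflection_translation[of x] H] .
  have "AE y in \<mu>. a y * H (x - y) = \<gamma> y * H (x - y)" using a(2) by eventually_elim simp
  then have "convolution \<mu> a H x = (LINT y|\<mu>. \<gamma> y * H (x - y))"
    unfolding convolution_def by (rule integral_cong_AE[rotated 2]) measurable
  also have "\<dots> = (LINT y|\<mu>. (\<lambda>y. \<gamma> y * H (x - y)) (x - y))"
    by (rule integral_reflection_translation[symmetric]) measurable
  also have "\<dots> = (LINT y|\<mu>. \<gamma> x * (H y * cnj (\<gamma> y)))"
    by (simp add: character_diff[OF g] mult_ac)
  also have "\<dots> = fourier \<mu> H \<gamma> * \<gamma> x" by (simp add: fourier_def mult.commute)
  finally show "convolution \<mu> a H x = fourier \<mu> H \<gamma> * \<gamma> x" .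
qed

text \<open>Cauchy-Schwarz against the constant 1, in the form t <= s/2 + t^2/(2 s), combined with
  Parseval.\<close>

lemma integral_norm_trig_poly_le:
  assumes J: "finite J" "J \<subseteq> dual_group" and s: "0 < s" and le: "(\<Sum>\<gamma>\<in>J. (cmod (c \<gamma>))\<^sup>2) \<le> s\<^sup>2"
  shows "(LINT x|\<mu>. cmod (trig_poly J c x)) \<le> s"
proof -
  have P: "trig_poly J c \<in> polynomials" by (rule polynomials_trig_poly[OF J])
  have int: "integrable \<mu> (\<lambda>x. (cmod (trig_poly J c x))\<^sup>2)" by (rule polynomials_power_integrable[OF P])
  have "t \<le> s / 2 + t\<^sup>2 / (2 * s)" for t
  proof -
    have "2 * t * s \<le> t\<^sup>2 + s\<^sup>2" by (rule sum_squares_bound)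
    then have "(2 * t * s) / (2 * s) \<le> (t\<^sup>2 + s\<^sup>2) / (2 * s)" using s by (intro divide_right_mono) auto
    then show ?thesis using s by (simp add: add_divide_distrib power2_eq_square)
  qed
  then have "(LINT x|\<mu>. cmod (trig_poly J c x)) \<le> (LINT x|\<mu>. s / 2 + (cmod (trig_poly J c x))\<^sup>2 / (2 * s))"
    using polynomials_integrable[OF P] int by (intro integral_mono) auto
  also have "\<dots> = s / 2 + (LINT x|\<mu>. (cmod (trig_poly J c x))\<^sup>2) / (2 * s)"
    using int prob_space by simp
  also have "\<dots> \<le> s / 2 + s\<^sup>2 / (2 * s)"
    unfolding parseval_trig_poly[OF J] using le s by (intro add_mono divide_right_mono) auto
  also have "\<dots> = s" using s by (simp add: power2_eq_square)
  finally show ?thesis .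
qed

end

context sidon_haar begin

lemma l2_norm_coefficients_le_bound:
  assumes f: "f \<in> polynomials" and L: "\<And>x. cmod (f x) \<le> L"
  shows "l2n (coefficients f) \<le> L"
proof (rule l2_boundedI(2))
  show L0: "0 \<le> L" using order_trans[OF norm_ge_zero L] .
  show "coefficients f \<in> functions_on \<Sigma>" by (simp add: coefficients_def restrict_to_functions_on)
  fix J assume J: "finite J" "J \<subseteq> \<Sigma>"
  have "(\<Sum>\<gamma>\<in>J. (cmod (coefficients f \<gamma>))\<^sup>2) = (\<Sum>\<gamma>\<in>J. (cmod (fourier \<mu> f \<gamma>))\<^sup>2)"
    using J by (intro sum.cong) (auto simp: coefficients_eq)
  also have "\<dots> \<le> (LINT x|\<mu>. (cmod (f x))\<^sup>2)"
    using J Sigma_dual by (intro bessel_polynomial f) auto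
  also have "\<dots> \<le> (LINT x|\<mu>. L\<^sup>2)"
    by (intro integral_mono polynomials_power_integrable f power_mono L) auto
  also have "\<dots> = L\<^sup>2" using prob_space by simp
  finally show "l2_fin (coefficients f) J \<le> L" using L0 by (simp add: L2_set_def real_sqrt_le_iff' sum_nonneg)
qed

end

section \<open>A nearby morphism as a Fourier multiplier\<close>

locale trivial_sidon_centralizer = sidon_centralizer \<mu> q \<Sigma> \<Omega> Q C
  for \<mu> :: "'g::{topological_ab_group_add, t2_space} measure" and q :: ennreal
    and \<Sigma> :: "('g \<Rightarrow> complex) set" and \<Omega> Q C +
  fixes p :: ennreal and \<phi> :: "('g \<Rightarrow> complex) \<Rightarrow> ('g \<Rightarrow> complex) set" and K :: real
  assumes p_ge: "1 \<le> p" and morphism: "module_morphism (Lp \<mu> 1) (Lp0 \<mu> p) (Lp \<mu> q) \<phi>"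
    and K_pos: "0 < K"
    and close: "f \<in> polynomials \<Longrightarrow> qnorm (Lp \<mu> q) (vsub (Lp \<mu> q) (mho \<mu> q \<Sigma> \<Omega> f) (\<phi> f)) \<le> K * Lp_norm \<mu> p f"
begin

definition symbol :: "('g \<Rightarrow> complex) \<Rightarrow> complex" where
  "symbol \<gamma> = fourier \<mu> (rep (\<phi> \<gamma>)) \<gamma>"

lemma phi_carrier:
  assumes "f \<in> polynomials" shows "\<exists>h. h \<in> borel_measurable borel \<and> \<phi> f = ae_class \<mu> h"
proof -
  have "\<phi> \<in> carrier (Lp0 \<mu> p) \<rightarrow> carrier (Lp \<mu> q)"
    using morphism by (simp add: module_morphism_def homogeneous_map_def)
  then have "\<phi> f \<in> ae_class \<mu> ` Lq" using assms by (auto simp: Lp0_def Lp_def)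
  then show ?thesis using Lp_functions_measurable[of _ q] by blast
qed

lemma phi_add: "f \<in> polynomials \<Longrightarrow> g \<in> polynomials \<Longrightarrow> \<phi> (\<lambda>x. f x + g x) = vadd (Lp \<mu> q) (\<phi> f) (\<phi> g)"
  using morphism by (simp add: module_morphism_def Lp0_def)

lemma phi_scale: "f \<in> polynomials \<Longrightarrow> \<phi> (\<lambda>x. t * f x) = vscale (Lp \<mu> q) t (\<phi> f)"
  using morphism by (simp add: module_morphism_def homogeneous_map_def Lp0_def)

lemma phi_act: "f \<in> polynomials \<Longrightarrow> a \<in> carrier (Lp \<mu> 1) \<Longrightarrow> \<phi> (convolution \<mu> (rep a) f) = act (Lp \<mu> q) a (\<phi> f)"
  using morphism by (simp add: module_morphism_def Lp0_def)

text \<open>Since \<open>\<gamma> * \<gamma> = \<gamma>\<close>, also \<open>\<phi> \<gamma> = \<gamma> * \<phi> \<gamma>\<close>, and \<open>\<gamma> * L\<^sub>q\<close> consists of multiples of \<open>\<gamma>\<close>.\<close>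

lemma phi_character:
  assumes g: "\<gamma> \<in> dual_group" shows "\<phi> \<gamma> = ae_class \<mu> (\<lambda>x. symbol \<gamma> * \<gamma> x)"
proof -
  have gp: "\<gamma> \<in> polynomials" by (rule polynomials_character[OF g])
  note gm = character_measurable[OF g]
  define a where "a = ae_class \<mu> \<gamma>"
  have a: "a \<in> carrier (Lp \<mu> 1)"
    using polynomials_integrable[OF gp] by (simp add: a_def Lp_def Lp_functions_1_iff)
  have ra: "rep a \<in> borel_measurable borel" "AE x in \<mu>. rep a x = \<gamma> x"
    using rep_ae_class[OF gm] by (auto simp: a_def)
  obtain h where h: "h \<in> borel_measurable borel" "\<phi> \<gamma> = ae_class \<mu> h" using phi_carrier[OF gp] by blast
  have rh: "rep (\<phi> \<gamma>) \<in> borel_measurable borel" using rep_ae_class(1)[OF h(1)] by (simp add: h)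
  have "convolution \<mu> (rep a) \<gamma> = \<gamma>"
    using convolution_character[OF g gm ra] character_orthogonality[OF g g] by (simp add: fourier_def)
  then have "\<phi> \<gamma> = act (Lp \<mu> q) a (\<phi> \<gamma>)" using phi_act[OF gp a] by simp
  also have "\<dots> = ae_class \<mu> (convolution \<mu> (rep a) (rep (\<phi> \<gamma>)))" by (simp add: Lp_def)
  also have "\<dots> = ae_class \<mu> (\<lambda>x. symbol \<gamma> * \<gamma> x)"
    unfolding convolution_character[OF g rh ra] symbol_def ..
  finally show ?thesis .
qed

lemma phi_trig_poly:
  assumes "finite J" "J \<subseteq> dual_group"
  shows "\<phi> (trig_poly J c) = ae_class \<mu> (trig_poly J (\<lambda>\<gamma>. symbol \<gamma> * c \<gamma>))"
  using assms
proof (induction J rule: finite_induct)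
  case empty
  have "\<phi> (\<lambda>x. 0 * 0) = vscale (Lp \<mu> q) 0 (\<phi> (\<lambda>x. 0))" by (rule phi_scale[OF polynomials_const])
  then show ?case by (simp add: trig_poly_def[abs_def] Lp_def)
next
  case (insert \<gamma> J)
  then have g: "\<gamma> \<in> dual_group" and J: "J \<subseteq> dual_group" by auto
  have gp: "\<gamma> \<in> polynomials" by (rule polynomials_character[OF g])
  have gs: "(\<lambda>x. s * \<gamma> x) \<in> borel_measurable borel" for s
    by (intro polynomials_measurable polynomials_scale gp)
  have ins: "trig_poly (insert \<gamma> J) d = (\<lambda>x. d \<gamma> * \<gamma> x + trig_poly J d x)" for d
    using insert by (simp add: trig_poly_def[abs_def])
  have "\<phi> (trig_poly (insert \<gamma> J) c) = vadd (Lp \<mu> q) (\<phi> (\<lambda>x. c \<gamma> * \<gamma> x)) (\<phi> (trig_poly J c))"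
    unfolding ins by (intro phi_add polynomials_scale gp polynomials_trig_poly insert J)
  also have "\<phi> (\<lambda>x. c \<gamma> * \<gamma> x) = ae_class \<mu> (\<lambda>x. c \<gamma> * (symbol \<gamma> * \<gamma> x))"
    by (simp only: phi_scale[OF gp] phi_character[OF g] vscale_ae_class[OF gs])
  also have "(\<lambda>x. c \<gamma> * (symbol \<gamma> * \<gamma> x)) = (\<lambda>x. (symbol \<gamma> * c \<gamma>) * \<gamma> x)" by (simp add: mult_ac)
  also have "\<phi> (trig_poly J c) = ae_class \<mu> (trig_poly J (\<lambda>\<gamma>. symbol \<gamma> * c \<gamma>))"
    by (rule insert.IH[OF J])
  also have "vadd (Lp \<mu> q) (ae_class \<mu> (\<lambda>x. (symbol \<gamma> * c \<gamma>) * \<gamma> x)) (ae_class \<mu> (trig_poly J (\<lambda>\<gamma>. symbol \<gamma> * c \<gamma>)))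
     = ae_class \<mu> (trig_poly (insert \<gamma> J) (\<lambda>\<gamma>. symbol \<gamma> * c \<gamma>))"
    unfolding ins by (intro vadd_ae_class gs trig_poly_measurable J)
  finally show ?case .
qed

text \<open>On a probability space a sup bound dominates every L_p norm and the L_q norm dominates
  the L_1 norm up to 2. Closeness is thus reduced to a form that no longer mentions p or q.\<close>

lemma integral_mho_minus_phi_le:
  assumes E: "finite E" "E \<subseteq> dual_group" and L: "\<And>x. cmod (trig_poly E c x) \<le> L"
    and F: "F \<in> series (\<Omega> (coefficients (trig_poly E c)))"
  shows "(LINT x|\<mu>. cmod (F x - trig_poly E (\<lambda>\<gamma>. symbol \<gamma> * c \<gamma>) x)) \<le> 2 * (K * L)"
proof -
  let ?f = "trig_poly E c" and ?g = "trig_poly E (\<lambda>\<gamma>. symbol \<gamma> * c \<gamma>)"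
  have f: "?f \<in> polynomials" and g: "?g \<in> polynomials" using E by (auto intro: polynomials_trig_poly)
  note m = summation_measurable[OF F] polynomials_measurable[OF g]
  have d: "(\<lambda>x. F x - ?g x) \<in> Lq"
    by (intro Lq_diff(1) summation_Lq[OF F] polynomials_Lp_functions g q_ge)
  have "vsub (Lp \<mu> q) (mho \<mu> q \<Sigma> \<Omega> ?f) (\<phi> ?f) = ae_class \<mu> (\<lambda>x. F x - ?g x)"
    unfolding mho_eq summation_ae_class[OF F] phi_trig_poly[OF E] by (rule vsub_ae_class[OF m])
  then have "Lq_norm (\<lambda>x. F x - ?g x) \<le> K * Lp_norm \<mu> p ?f"
    using close[OF f] qnorm_ae_class[OF Lp_functions_measurable[OF d]] by simp
  also have "\<dots> \<le> K * L"
    using K_pos Lp_functions_bounded(2)[OF polynomials_measurable[OF f] L p_ge] by simp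
  finally show ?thesis by (rule integral_le_Lq_norm[OF d])
qed

lemma Omega_zero: "\<Omega> (\<lambda>\<gamma>. 0) = (\<lambda>\<gamma>. 0)"
  using Omega_scale[of "\<lambda>_. 0" 0] by (simp add: l2_0_carrier_iff functions_on_def)

text \<open>Off \<open>\<Sigma>\<close> the symbol is bounded because there \<open>\<mho> \<gamma> = 0\<close>. This makes the part of \<open>\<phi> f\<close> off
  \<open>\<Sigma>\<close> harmless, although \<open>L\<^sub>1\<close> need not admit a bounded projection onto the span of \<open>\<Sigma>\<close>.\<close>

lemma symbol_bounded_off_Sigma:
  assumes g: "\<gamma> \<in> dual_group" "\<gamma> \<notin> \<Sigma>" shows "cmod (symbol \<gamma>) \<le> 2 * K"
proof -
  have G: "finite {\<gamma>}" "{\<gamma>} \<subseteq> dual_group" using g by auto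
  have "coefficients (trig_poly {\<gamma>} (\<lambda>_. 1)) = (\<lambda>\<delta>. 0)"
  proof
    fix \<delta> show "coefficients (trig_poly {\<gamma>} (\<lambda>_. 1)) \<delta> = 0"
      using g Sigma_dual fourier_trig_poly[OF G, of \<delta> "\<lambda>_. 1"]
      by (auto simp: coefficients_def restrict_to_def)
  qed
  moreover have "(\<lambda>x. 0) \<in> series (\<lambda>\<gamma>. 0)"
    using summation_finite_support[of "{}" "\<lambda>_. 0"] by (simp add: trig_poly_def[abs_def])
  ultimately have F: "(\<lambda>x. 0) \<in> series (\<Omega> (coefficients (trig_poly {\<gamma>} (\<lambda>_. 1))))"
    by (simp add: Omega_zero)
  have "(LINT x|\<mu>. cmod (0 - trig_poly {\<gamma>} (\<lambda>\<gamma>. symbol \<gamma> * 1) x)) \<le> 2 * (K * 1)"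
    by (rule integral_mho_minus_phi_le[OF G _ F]) (simp add: trig_poly_def character_norm g)
  then show ?thesis using prob_space by (simp add: trig_poly_def norm_mult character_norm g)
qed

definition defect :: "(('g \<Rightarrow> complex) \<Rightarrow> complex) \<Rightarrow> ('g \<Rightarrow> complex) \<Rightarrow> complex" where
  "defect c \<gamma> = \<Omega> c \<gamma> - symbol \<gamma> * c \<gamma>"

lemma symbol_mult_l2:
  assumes "c \<in> carrier (l2_0 \<Sigma>)" shows "(\<lambda>\<gamma>. symbol \<gamma> * c \<gamma>) \<in> carrier (l2 \<Sigma>)"
proof (rule l2_finite_support(1))
  show "finite {\<gamma>. c \<gamma> \<noteq> 0}" "{\<gamma>. c \<gamma> \<noteq> 0} \<subseteq> \<Sigma>" using assms by (auto simp: l2_0_carrier_iff functions_on_def)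
qed simp

lemma defect_l2: "c \<in> carrier (l2_0 \<Sigma>) \<Longrightarrow> defect c \<in> carrier (l2 \<Sigma>)"
  unfolding defect_def[abs_def] by (intro l2_diff(1) Omega_carrier symbol_mult_l2)

text \<open>The sum of the defect series is F minus the \<Sigma>-part of \<phi> f, that is, (F -
  \<phi> f) plus the part of \<phi> f off \<Sigma>. The first has L_1 norm at most 2 K L by
  closeness, the second too, by the bound 2 K for the symbol off \<Sigma> and Bessel. The lower L_1
  estimate converts the total into an l_2 bound.\<close>

lemma l2_norm_defect_coefficients_le:
  obtains K' where "K' > 0" "\<And>f L. f \<in> polynomials \<Longrightarrow> 0 < L \<Longrightarrow> (\<And>x. cmod (f x) \<le> L) \<Longrightarrow>
    l2n (defect (coefficients f)) \<le> K' * L"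
proof -
  obtain M where M: "M > 0" "\<And>F c. c \<in> carrier (l2 \<Sigma>) \<Longrightarrow> F \<in> series c \<Longrightarrow> l2n c \<le> M * (LINT x|\<mu>. cmod (F x))"
    using summation_norm_ge by metis
  have "l2n (defect (coefficients f)) \<le> (4 * M * K) * L"
    if f: "f \<in> polynomials" and L0: "0 < L" and L: "\<And>x. cmod (f x) \<le> L" for f L
  proof -
    define c where "c = fourier \<mu> f"
    obtain E where E: "finite E" "E \<subseteq> dual_group" "f = trig_poly E c" "\<And>\<gamma>. \<gamma> \<in> dual_group - E \<Longrightarrow> c \<gamma> = 0"
      unfolding c_def using polynomial_expansion[OF f] by blast
    let ?d = "\<lambda>\<gamma>. symbol \<gamma> * c \<gamma>"
    define E1 where "E1 = E \<inter> \<Sigma>"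
    define E2 where "E2 = E - \<Sigma>"
    have E1: "finite E1" "E1 \<subseteq> \<Sigma>" and E2: "finite E2" "E2 \<subseteq> dual_group" using E by (auto simp: E1_def E2_def)
    obtain F where F: "F \<in> series (\<Omega> (coefficients f))" using mho_exists[OF f] by metis
    have "trig_poly E1 ?d = trig_poly E1 (\<lambda>\<gamma>. symbol \<gamma> * coefficients f \<gamma>)"
      using E1(2) by (intro trig_poly_cong) (auto simp: coefficients_eq c_def)
    also have "\<dots> \<in> series (\<lambda>\<gamma>. symbol \<gamma> * coefficients f \<gamma>)"
      using E(4) Sigma_dual by (intro summation_finite_support E1) (auto simp: E1_def coefficients_eq c_def)
    finally have G: "trig_poly E1 ?d \<in> series (\<lambda>\<gamma>. symbol \<gamma> * coefficients f \<gamma>)" .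
    have FG: "(\<lambda>x. F x - trig_poly E1 ?d x) \<in> series (defect (coefficients f))"
      unfolding defect_def[abs_def] by (rule summation_diff[OF F G])
    have split: "trig_poly E ?d x = trig_poly E1 ?d x + trig_poly E2 ?d x" for x
      unfolding trig_poly_def E1_def E2_def using E(1) by (rule sum.Int_Diff)
    have b1: "(LINT x|\<mu>. cmod (F x - trig_poly E ?d x)) \<le> 2 * (K * L)"
      by (rule integral_mho_minus_phi_le[OF E(1,2)]) (use L F in \<open>auto simp: E(3)[symmetric]\<close>)
    have "(\<Sum>\<gamma>\<in>E2. (cmod (?d \<gamma>))\<^sup>2) \<le> (\<Sum>\<gamma>\<in>E2. (2 * K)\<^sup>2 * (cmod (c \<gamma>))\<^sup>2)"
    proof (intro sum_mono)
      fix \<gamma> assume "\<gamma> \<in> E2"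
      then have "cmod (symbol \<gamma>) \<le> 2 * K" using E2 by (intro symbol_bounded_off_Sigma) (auto simp: E2_def)
      then have "(cmod (symbol \<gamma>))\<^sup>2 \<le> (2 * K)\<^sup>2" by (intro power_mono) auto
      then show "(cmod (?d \<gamma>))\<^sup>2 \<le> (2 * K)\<^sup>2 * (cmod (c \<gamma>))\<^sup>2"
        unfolding norm_mult power_mult_distrib[of "cmod (symbol \<gamma>)"] by (intro mult_right_mono) auto
    qed
    also have "\<dots> = (2 * K)\<^sup>2 * (\<Sum>\<gamma>\<in>E2. (cmod (c \<gamma>))\<^sup>2)" by (simp only: sum_distrib_left)
    also have "\<dots> \<le> (2 * K)\<^sup>2 * L\<^sup>2"
    proof (rule mult_left_mono)
      have "(\<Sum>\<gamma>\<in>E2. (cmod (c \<gamma>))\<^sup>2) \<le> (LINT x|\<mu>. (cmod (f x))\<^sup>2)"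
        unfolding c_def by (rule bessel_polynomial[OF f E2])
      also have "\<dots> \<le> (LINT x|\<mu>. L\<^sup>2)"
        by (intro integral_mono polynomials_power_integrable f power_mono L) auto
      also have "\<dots> = L\<^sup>2" using prob_space by simp
      finally show "(\<Sum>\<gamma>\<in>E2. (cmod (c \<gamma>))\<^sup>2) \<le> L\<^sup>2" .
    qed simp
    also have "\<dots> = (2 * (K * L))\<^sup>2" by (simp add: power_mult_distrib)
    finally have b2: "(LINT x|\<mu>. cmod (trig_poly E2 ?d x)) \<le> 2 * (K * L)"
      using K_pos L0 by (intro integral_norm_trig_poly_le E2) auto
    have int: "integrable \<mu> F" "integrable \<mu> (trig_poly E ?d)" "integrable \<mu> (trig_poly E1 ?d)" "integrable \<mu> (trig_poly E2 ?d)"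
      using Lq_integrable[OF summation_Lq[OF F]] Lq_integrable[OF summation_Lq[OF G]]
        polynomials_integrable[OF polynomials_trig_poly[OF E(1,2)]] polynomials_integrable[OF polynomials_trig_poly[OF E2]] by auto
    have "(LINT x|\<mu>. cmod (F x - trig_poly E1 ?d x)) \<le> (LINT x|\<mu>. cmod (F x - trig_poly E ?d x) + cmod (trig_poly E2 ?d x))"
    proof (intro integral_mono)
      show "cmod (F x - trig_poly E1 ?d x) \<le> cmod (F x - trig_poly E ?d x) + cmod (trig_poly E2 ?d x)" for x
        using norm_triangle_ineq[of "F x - trig_poly E ?d x" "trig_poly E2 ?d x"] by (simp add: split)
    qed (use int in auto)
    also have "\<dots> = (LINT x|\<mu>. cmod (F x - trig_poly E ?d x)) + (LINT x|\<mu>. cmod (trig_poly E2 ?d x))"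
      using int by (intro Bochner_Integration.integral_add) auto
    also have "\<dots> \<le> 4 * (K * L)" using b1 b2 by simp
    finally have b: "(LINT x|\<mu>. cmod (F x - trig_poly E1 ?d x)) \<le> 4 * (K * L)" .
    have "l2n (defect (coefficients f)) \<le> M * (LINT x|\<mu>. cmod (F x - trig_poly E1 ?d x))"
      by (rule M(2)[OF defect_l2[OF coefficients_l2_0[OF f]] FG])
    also have "\<dots> \<le> M * (4 * (K * L))" using b M(1) by (intro mult_left_mono) auto
    finally show ?thesis by (simp add: mult_ac)
  qed
  moreover have "4 * M * K > 0" using M(1) K_pos by simp
  ultimately show ?thesis using that by blast
qed

section \<open>From coefficients of bounded polynomials to all finitely supported sequences\<close>

text \<open>The multiplier is additive, so the defect is quasi-additive with the same Q as
  \<Omega>.\<close>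

lemma defect_add_le:
  assumes c: "c \<in> carrier (l2_0 \<Sigma>)" and d: "d \<in> carrier (l2_0 \<Sigma>)"
  shows "l2n (defect (\<lambda>\<gamma>. c \<gamma> + d \<gamma>)) \<le>
    l2n (defect c) + l2n (defect d) + Q * (l2n c + l2n d)"
proof -
  let ?s = "\<lambda>\<gamma>. c \<gamma> + d \<gamma>"
  let ?e = "\<lambda>\<gamma>. \<Omega> ?s \<gamma> - \<Omega> c \<gamma> - \<Omega> d \<gamma>"
  have "finite {\<gamma>. c \<gamma> + d \<gamma> \<noteq> 0}"
    by (rule finite_subset[of _ "{\<gamma>. c \<gamma> \<noteq> 0} \<union> {\<gamma>. d \<gamma> \<noteq> 0}"]) (use c d in \<open>auto simp: l2_0_carrier_iff\<close>)
  then have s: "?s \<in> carrier (l2_0 \<Sigma>)" using c d by (auto simp: l2_0_carrier_iff functions_on_def)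
  have e: "?e \<in> carrier (l2 \<Sigma>)" by (intro l2_diff(1) Omega_carrier s c d)
  have cd: "(\<lambda>\<gamma>. defect c \<gamma> + defect d \<gamma>) \<in> carrier (l2 \<Sigma>)" by (intro l2_add(1) defect_l2 c d)
  have "defect ?s = (\<lambda>\<gamma>. (defect c \<gamma> + defect d \<gamma>) + ?e \<gamma>)" by (simp add: defect_def fun_eq_iff algebra_simps)
  then have "l2n (defect ?s) \<le> l2n (\<lambda>\<gamma>. defect c \<gamma> + defect d \<gamma>) + l2n ?e"
    using l2_add(2)[OF cd e] by simp
  also have "\<dots> \<le> (l2n (defect c) + l2n (defect d)) + Q * (l2n c + l2n d)"
    by (intro add_mono l2_add(2) defect_l2 c d Omega_add)
  finally show ?thesis by simp
qed

lemma restrict_l2_0: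
  assumes "J \<subseteq> \<Sigma>" "c \<in> carrier (l2_0 \<Sigma>)"
  shows "restrict_to J c \<in> carrier (l2_0 \<Sigma>)" "l2n (restrict_to J c) \<le> l2n c"
proof -
  have "finite {\<gamma>. restrict_to J c \<gamma> \<noteq> 0}"
    by (rule finite_subset[of _ "{\<gamma>. c \<gamma> \<noteq> 0}"]) (use assms in \<open>auto simp: l2_0_carrier_iff restrict_to_def\<close>)
  then show "restrict_to J c \<in> carrier (l2_0 \<Sigma>)"
    using assms by (auto simp: l2_0_carrier_iff restrict_to_def functions_on_def)
  show "l2n (restrict_to J c) \<le> l2n c"
    using l2_dominated(2)[OF l2_0_carrier_l2[OF assms(2)], of 1 "restrict_to J c"] by (simp add: restrict_to_def)
qed

text \<open>Restriction to J is multiplication by an indicator of norm at most 1, with which the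
  multiplier commutes exactly and \<Omega> up to C. It is required because the truncated polynomial
  may have coefficients in \<Sigma> outside J.\<close>

lemma defect_restrict_le:
  assumes J: "J \<subseteq> \<Sigma>" and c: "c \<in> carrier (l2_0 \<Sigma>)"
  shows "l2n (defect (restrict_to J c)) \<le> l2n (defect c) + C * l2n c"
proof -
  define u :: "('g \<Rightarrow> complex) \<Rightarrow> complex" where "u \<gamma> = (if \<gamma> \<in> J then 1 else 0)" for \<gamma>
  have u1: "cmod (u \<gamma>) \<le> 1" for \<gamma> by (simp add: u_def)
  have u: "u \<in> carrier (linf \<Sigma>)"
    using J u1 by (auto simp: linf_def functions_on_def u_def intro!: boundedI[of _ 1])
  have uq: "qnorm (linf \<Sigma>) u \<le> 1" by (auto simp: linf_def intro!: cSUP_least u1)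
  have uc: "restrict_to J c = (\<lambda>\<gamma>. u \<gamma> * c \<gamma>)" by (auto simp: u_def restrict_to_def)
  let ?e = "\<lambda>\<gamma>. \<Omega> (\<lambda>\<gamma>. u \<gamma> * c \<gamma>) \<gamma> - u \<gamma> * \<Omega> c \<gamma>"
  have r: "(\<lambda>\<gamma>. u \<gamma> * c \<gamma>) \<in> carrier (l2_0 \<Sigma>)" using restrict_l2_0(1)[OF J c] by (simp only: uc)
  have dom: "cmod (u \<gamma> * z) \<le> 1 * cmod z" for \<gamma> z using u1 by (simp add: u_def)
  have e: "?e \<in> carrier (l2 \<Sigma>)"
    by (intro l2_diff(1) Omega_carrier r l2_dominated(1)[OF Omega_carrier[OF c] zero_le_one] dom)
  have ud: "(\<lambda>\<gamma>. u \<gamma> * defect c \<gamma>) \<in> carrier (l2 \<Sigma>)" "l2n (\<lambda>\<gamma>. u \<gamma> * defect c \<gamma>) \<le> 1 * l2n (defect c)"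
    by (intro l2_dominated[OF defect_l2[OF c] zero_le_one] dom)+
  have "defect (restrict_to J c) = (\<lambda>\<gamma>. u \<gamma> * defect c \<gamma> + ?e \<gamma>)"
    by (simp add: uc defect_def fun_eq_iff algebra_simps)
  then have "l2n (defect (restrict_to J c)) \<le> l2n (\<lambda>\<gamma>. u \<gamma> * defect c \<gamma>) + l2n ?e"
    using l2_add(2)[OF ud(1) e] by simp
  also have "\<dots> \<le> l2n (defect c) + C * qnorm (linf \<Sigma>) u * l2n c"
    using ud(2) Omega_mult[OF u c] by (intro add_mono) auto
  also have "\<dots> \<le> l2n (defect c) + C * 1 * l2n c"
    using uq C_nonneg by (intro add_left_mono mult_right_mono mult_left_mono) (auto simp: l2_norm_nonneg)
  finally show ?thesis by simp
qed

definition defect_bound :: "('g \<Rightarrow> complex) set \<Rightarrow> real \<Rightarrow> bool" where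
  "defect_bound J b \<longleftrightarrow> (\<forall>c\<in>functions_on J. l2n (defect c) \<le> b * l2n c)"

lemma functions_on_l2_0:
  assumes "finite J" "J \<subseteq> \<Sigma>" "c \<in> functions_on J" shows "c \<in> carrier (l2_0 \<Sigma>)"
proof -
  have "{\<gamma>. c \<gamma> \<noteq> 0} \<subseteq> J" using assms(3) by (auto simp: functions_on_def)
  then show ?thesis using assms finite_subset by (auto simp: l2_0_carrier_iff functions_on_def)
qed

text \<open>The starting value for the iteration, allowed to grow with J. Adding one character
  \<delta> splits off a one-dimensional part, where homogeneity gives a bound, and costs 2 Q for
  quasi-additivity.\<close>

lemma defect_bound_exists:
  assumes "finite J" "J \<subseteq> \<Sigma>" shows "\<exists>b\<ge>0. defect_bound J b"
  using assms
proof (induction J rule: finite_induct)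
  case empty
  have "defect c = (\<lambda>\<gamma>. 0)" if "c \<in> functions_on {}" for c
  proof -
    have c: "c = (\<lambda>\<gamma>. 0)" using that by (auto simp: functions_on_def)
    show ?thesis unfolding c by (rule ext) (simp add: defect_def Omega_zero)
  qed
  then have "defect_bound {} 0"
    using l2_finite_support(2)[of "{}" \<Sigma> "\<lambda>_. 0"] by (simp add: defect_bound_def)
  then show ?case by blast
next
  case (insert \<delta> J)
  then obtain b where b: "b \<ge> 0" "defect_bound J b" by auto
  have J: "J \<subseteq> \<Sigma>" "finite J" "insert \<delta> J \<subseteq> \<Sigma>" "finite (insert \<delta> J)" using insert by auto
  define e :: "('g \<Rightarrow> complex) \<Rightarrow> complex" where "e \<gamma> = (if \<gamma> = \<delta> then 1 else 0)" for \<gamma>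
  define a where "a = l2n (defect e)"
  have e: "e \<in> carrier (l2_0 \<Sigma>)" using J by (intro functions_on_l2_0[of "{\<delta>}"]) (auto simp: functions_on_def e_def)
  have "l2n (defect c) \<le> (b + a + 2 * Q) * l2n c" if c: "c \<in> functions_on (insert \<delta> J)" for c
  proof -
    have c0: "c \<in> carrier (l2_0 \<Sigma>)" by (rule functions_on_l2_0[OF J(4,3) c])
    let ?N = "l2n c"
    have r: "restrict_to J c \<in> functions_on J" by (simp add: restrict_to_functions_on)
    let ?d = "\<lambda>\<gamma>. c \<delta> * e \<gamma>"
    have d: "?d \<in> carrier (l2_0 \<Sigma>)" using J by (intro functions_on_l2_0[of "{\<delta>}"]) (auto simp: functions_on_def e_def)
    have N1: "l2n (restrict_to J c) \<le> ?N" by (rule restrict_l2_0(2)[OF J(1) c0])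
    have dN: "l2n ?d \<le> ?N"
      using l2_dominated(2)[OF l2_0_carrier_l2[OF c0], of 1 ?d] by (simp add: e_def)
    have cN: "cmod (c \<delta>) \<le> ?N" using l2_fin_le_l2_norm[OF l2_0_carrier_l2[OF c0], of "{\<delta>}"] J by simp
    have "defect ?d = (\<lambda>\<gamma>. c \<delta> * defect e \<gamma>)" by (simp add: defect_def Omega_scale[OF e] fun_eq_iff algebra_simps)
    then have "l2n (defect ?d) \<le> cmod (c \<delta>) * a"
      using l2_dominated(2)[OF defect_l2[OF e], of "cmod (c \<delta>)" "defect ?d"] by (simp add: a_def norm_mult)
    also have "\<dots> \<le> ?N * a" using cN by (intro mult_right_mono) (auto simp: a_def l2_norm_nonneg)
    finally have 1: "l2n (defect ?d) \<le> ?N * a" .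
    have "l2n (defect (restrict_to J c)) \<le> b * l2n (restrict_to J c)"
      using b(2) r by (simp add: defect_bound_def)
    also have "\<dots> \<le> b * ?N" using N1 b(1) by (rule mult_left_mono)
    finally have 2: "l2n (defect (restrict_to J c)) \<le> b * ?N" .
    have "Q * (l2n (restrict_to J c) + l2n ?d) \<le> Q * (?N + ?N)"
      using N1 dN Q_nonneg by (intro mult_left_mono add_mono)
    moreover have "c = (\<lambda>\<gamma>. restrict_to J c \<gamma> + ?d \<gamma>)"
    proof
      fix \<gamma> show "c \<gamma> = restrict_to J c \<gamma> + ?d \<gamma>"
        using c insert(2) by (auto simp: restrict_to_def e_def functions_on_def)
    qed
    ultimately have "l2n (defect c) \<le> b * ?N + ?N * a + Q * (?N + ?N)"
      using defect_add_le[OF restrict_l2_0(1)[OF J(1) c0] d] 1 2 by simp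
    then show ?thesis by (simp add: algebra_simps)
  qed
  then have "defect_bound (insert \<delta> J) (b + a + 2 * Q)" by (simp add: defect_bound_def)
  moreover have "0 \<le> b + a + 2 * Q" using b Q_nonneg by (simp add: a_def l2_norm_nonneg)
  ultimately show ?case by blast
qed

text \<open>The polynomial truncation of \<open>\<Sum> c\<^sub>\<gamma> \<gamma>\<close> recovers \<open>c\<close> on \<open>J\<close> up to an \<open>\<ell>\<^sub>2\<close>-error of half the
  norm, so a bound \<open>b\<close> on \<open>J\<close> improves to \<open>W + b/2\<close> with \<open>W\<close> independent of \<open>J\<close>.\<close>

lemma defect_bound_improve:
  obtains W where "\<And>J b. finite J \<Longrightarrow> J \<subseteq> \<Sigma> \<Longrightarrow> 0 \<le> b \<Longrightarrow> defect_bound J b \<Longrightarrow> defect_bound J (W + b / 2)" "0 \<le> W"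
proof -
  obtain K' where K': "K' > 0" "\<And>f L. f \<in> polynomials \<Longrightarrow> 0 < L \<Longrightarrow> (\<And>x. cmod (f x) \<le> L) \<Longrightarrow>
    l2n (defect (coefficients f)) \<le> K' * L"
    using l2_norm_defect_coefficients_le by metis
  obtain M where M0: "M > 0" and "\<forall>J c. finite J \<longrightarrow> J \<subseteq> \<Sigma> \<longrightarrow>
     (\<exists>f\<in>polynomials. (\<forall>x. cmod (f x) \<le> M * l2_fin c J) \<and>
       (LINT x|\<mu>. (cmod (trig_poly J c x - f x))\<^sup>2) \<le> (l2_fin c J / 2)\<^sup>2)"
    using sidon_truncation[OF sidon] by (elim exE conjE) (rule that)
  note M = this(2)[rule_format]
  \<comment> \<open>The three terms come from the defect of the truncated polynomial, from
    restricting its coefficients to J, and from recombining c = h + s with norms at most M N and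
    N/2.\<close>
  define W where "W = K' * M + C * M + Q * (M + 1 / 2)"
  have "defect_bound J (W + b / 2)" if J: "finite J" "J \<subseteq> \<Sigma>" and b: "0 \<le> b" "defect_bound J b" for J b
    unfolding defect_bound_def
  proof
    fix c assume c: "c \<in> functions_on J"
    have c0: "c \<in> carrier (l2_0 \<Sigma>)" by (rule functions_on_l2_0[OF J c])
    define N where "N = l2n c"
    have NJ: "N = l2_fin c J" unfolding N_def using J c by (intro l2_finite_support(2)) (auto simp: functions_on_def)
    have N0: "0 \<le> N" by (simp add: N_def l2_norm_nonneg)
    show "l2n (defect c) \<le> (W + b / 2) * l2n c"
    \<comment> \<open>The estimate for bounded polynomials asks for a positive sup bound M
      N.\<close>
    proof (cases "N = 0")
      case True
      have "l2n (defect c) \<le> b * l2n c" using b(2) c by (simp add: defect_bound_def)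
      then show ?thesis using True by (simp add: N_def)
    next
      case False
      then have N: "0 < N" using N0 by simp
      obtain f where f: "f \<in> polynomials" "\<forall>x. cmod (f x) \<le> M * N"
        "(LINT x|\<mu>. (cmod (trig_poly J c x - f x))\<^sup>2) \<le> (N / 2)\<^sup>2"
        using M[OF J, of c] unfolding NJ by blast
      let ?g = "coefficients f"
      define h where "h = restrict_to J ?g"
      define s where "s \<gamma> = c \<gamma> - h \<gamma>" for \<gamma>
      have g0: "?g \<in> carrier (l2_0 \<Sigma>)" by (rule coefficients_l2_0[OF f(1)])
      have gN: "l2n ?g \<le> M * N" using f(2) by (intro l2_norm_coefficients_le_bound f(1)) auto
      have h0: "h \<in> carrier (l2_0 \<Sigma>)" unfolding h_def by (rule restrict_l2_0(1)[OF J(2) g0])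
      have hN: "l2n h \<le> M * N" unfolding h_def using restrict_l2_0(2)[OF J(2) g0] gN by simp
      have sJ: "s \<in> functions_on J" using c by (auto simp: s_def h_def functions_on_def restrict_to_def)
      have s0: "s \<in> carrier (l2_0 \<Sigma>)" by (rule functions_on_l2_0[OF J sJ])
      have JG: "J \<subseteq> dual_group" using J Sigma_dual by auto
      have P: "trig_poly J c \<in> polynomials" by (rule trig_poly_Sigma[OF J])
      have R: "(\<lambda>x. trig_poly J c x - f x) \<in> polynomials"
        using polynomials_add[OF P polynomials_scale[OF f(1), of "- 1"]] by simp
      \<comment> \<open>On J the remainder s consists of Fourier coefficients of the truncation
        error, so Bessel bounds its norm by N/2. Being supported in J, it is subject to the old
        bound b.\<close>
      have "s \<gamma> = fourier \<mu> (\<lambda>x. trig_poly J c x - f x) \<gamma>" if "\<gamma> \<in> J" for \<gamma>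
      proof -
        have g: "\<gamma> \<in> dual_group" using that JG by auto
        have "fourier \<mu> (\<lambda>x. trig_poly J c x + (- 1) * f x) \<gamma> = c \<gamma> + (- 1) * fourier \<mu> f \<gamma>"
          using fourier_trig_poly[OF J(1) JG g, of c] that fourier_scale[of "- 1" f \<gamma>]
          by (subst fourier_add[OF polynomials_integrable[OF P] polynomials_integrable[OF polynomials_scale[OF f(1)]] g]) simp
        then show ?thesis using that J by (simp add: s_def h_def restrict_to_def coefficients_eq subset_iff)
      qed
      then have "(\<Sum>\<gamma>\<in>J. (cmod (s \<gamma>))\<^sup>2) = (\<Sum>\<gamma>\<in>J. (cmod (fourier \<mu> (\<lambda>x. trig_poly J c x - f x) \<gamma>))\<^sup>2)"
        by (intro sum.cong) auto
      also have "\<dots> \<le> (LINT x|\<mu>. (cmod (trig_poly J c x - f x))\<^sup>2)" by (rule bessel_polynomial[OF R J(1) JG])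
      also have "\<dots> \<le> (N / 2)\<^sup>2" by (rule f(3))
      finally have "l2_fin s J \<le> N / 2" unfolding L2_set_def using N0 by (intro real_le_lsqrt) auto
      moreover have "l2n s = l2_fin s J" using J sJ by (intro l2_finite_support(2)) (auto simp: functions_on_def)
      ultimately have sN: "l2n s \<le> N / 2" by simp
      have MN: "0 < M * N" using M0 N by simp
      have "l2n (defect h) \<le> l2n (defect ?g) + C * l2n ?g"
        unfolding h_def by (rule defect_restrict_le[OF J(2) g0])
      also have "\<dots> \<le> K' * (M * N) + C * (M * N)"
        using f(2) gN C_nonneg by (intro add_mono K'(2) f(1) MN mult_left_mono) auto
      finally have 1: "l2n (defect h) \<le> K' * (M * N) + C * (M * N)" .
      have "l2n (defect s) \<le> b * l2n s" using b(2) sJ by (simp add: defect_bound_def)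
      also have "\<dots> \<le> b * (N / 2)" using sN b(1) by (rule mult_left_mono)
      finally have 2: "l2n (defect s) \<le> b * (N / 2)" .
      have 3: "Q * (l2n h + l2n s) \<le> Q * (M * N + N / 2)"
        using hN sN Q_nonneg by (intro mult_left_mono add_mono)
      have "c = (\<lambda>\<gamma>. h \<gamma> + s \<gamma>)" by (simp add: s_def fun_eq_iff)
      then have "l2n (defect c) \<le> l2n (defect h) + l2n (defect s) + Q * (l2n h + l2n s)"
        using defect_add_le[OF h0 s0] by simp
      also have "\<dots> \<le> (K' * (M * N) + C * (M * N)) + b * (N / 2) + Q * (M * N + N / 2)"
        by (intro add_mono 1 2 3)
      also have "\<dots> = (W + b / 2) * l2n c" by (simp add: W_def N_def[symmetric] algebra_simps)
      finally show ?thesis .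
    qed
  qed
  moreover have "0 \<le> W" using K'(1) M0 C_nonneg Q_nonneg by (simp add: W_def)
  ultimately show ?thesis by (rule that)
qed

text \<open>The map b -> W + b/2 has fixed point 2 W, and its n-th iterate is at most 2 W + b/2^n.
  The starting value b depends on the support of c but disappears in the limit.\<close>

lemma defect_bounded:
  obtains W where "\<And>c. c \<in> carrier (l2_0 \<Sigma>) \<Longrightarrow> l2n (defect c) \<le> W * l2n c"
proof -
  obtain W where W: "\<And>J b. finite J \<Longrightarrow> J \<subseteq> \<Sigma> \<Longrightarrow> 0 \<le> b \<Longrightarrow> defect_bound J b \<Longrightarrow> defect_bound J (W + b / 2)" "0 \<le> W"
    using defect_bound_improve by metis
  have "l2n (defect c) \<le> (2 * W) * l2n c" if c: "c \<in> carrier (l2_0 \<Sigma>)" for c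
  proof -
    define J where "J = {\<gamma>. c \<gamma> \<noteq> 0}"
    have J: "finite J" "J \<subseteq> \<Sigma>" "c \<in> functions_on J"
      using c by (auto simp: J_def l2_0_carrier_iff functions_on_def)
    obtain b where b: "b \<ge> 0" "defect_bound J b" using defect_bound_exists[OF J(1,2)] by blast
    have "defect_bound J (2 * W + b / 2 ^ n)" for n
    proof (induction n)
      case 0
      have "b * l2n d \<le> (2 * W + b) * l2n d" for d
        using W(2) by (intro mult_right_mono) (auto simp: l2_norm_nonneg)
      then show ?case using b(2) unfolding defect_bound_def by (auto intro: order_trans)
    next
      case (Suc n)
      have "defect_bound J (W + (2 * W + b / 2 ^ n) / 2)"
        using W(2) b(1) by (intro W(1) J Suc) auto
      then show ?case by (simp add: field_simps)
    qed
    then have le: "l2n (defect c) \<le> (2 * W + b * (1 / 2) ^ n) * l2n c" for n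
      using J(3) by (simp add: defect_bound_def power_divide)
    have "(\<lambda>n. (2 * W + b * (1 / 2) ^ n) * l2n c) \<longlonglongrightarrow> (2 * W + b * 0) * l2n c"
      by (intro tendsto_intros LIMSEQ_realpow_zero) auto
    then have "l2n (defect c) \<le> (2 * W + b * 0) * l2n c"
      by (rule LIMSEQ_le_const) (use le in auto)
    then show ?thesis by simp
  qed
  then show ?thesis by (rule that)
qed

text \<open>Multiplication by the symbol commutes with pointwise products. No bound for the symbol
  on \<Sigma> is asserted: it maps into l_2 because the arguments are finitely supported, and a
  morphism need not be continuous.\<close>

lemma Omega_trivial: "trivial_map (linf \<Sigma>) (l2_0 \<Sigma>) (l2 \<Sigma>) \<Omega>"
proof -
  obtain W where W: "\<And>c. c \<in> carrier (l2_0 \<Sigma>) \<Longrightarrow> l2n (defect c) \<le> W * l2n c"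
    using defect_bounded by metis
  have "module_morphism (linf \<Sigma>) (l2_0 \<Sigma>) (l2 \<Sigma>) (\<lambda>c \<gamma>. symbol \<gamma> * c \<gamma>)"
    unfolding module_morphism_def homogeneous_map_def
    using symbol_mult_l2 by (auto simp: fun_eq_iff algebra_simps l2_0_def l2_def)
  moreover have "qnorm (l2 \<Sigma>) (vsub (l2 \<Sigma>) (\<Omega> c) (\<lambda>\<gamma>. symbol \<gamma> * c \<gamma>)) \<le> W * qnorm (l2_0 \<Sigma>) c"
    if "c \<in> carrier (l2_0 \<Sigma>)" for c
  proof -
    have "vsub (l2 \<Sigma>) (\<Omega> c) (\<lambda>\<gamma>. symbol \<gamma> * c \<gamma>) = defect c"
      by (simp add: vsub_def l2_def defect_def fun_eq_iff)
    moreover have "qnorm (l2_0 \<Sigma>) c = l2n c" by (simp add: l2_0_def)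
    ultimately show ?thesis using W[OF that] by simp
  qed
  ultimately show ?thesis unfolding trivial_map_def by blast
qed

end

theorem proposition3p6:
  fixes \<mu> :: "'g::{topological_ab_group_add, t2_space} measure"
    and \<Sigma> :: "('g \<Rightarrow> complex) set"
    and \<Omega> :: "(('g \<Rightarrow> complex) \<Rightarrow> complex) \<Rightarrow> (('g \<Rightarrow> complex) \<Rightarrow> complex)"
    and p q :: ennreal
  assumes "compact (UNIV :: 'g set)"
    and "normalized_haar \<mu>"
    and "sidon_set \<mu> \<Sigma>"
    and "nontrivial_centralizer (linf \<Sigma>) (l2_0 \<Sigma>) (l2 \<Sigma>) \<Omega>"
    and "1 < p" and "1 \<le> q" and "q < \<infinity>"
  shows "nontrivial_centralizer (Lp \<mu> 1) (Lp0 \<mu> p) (Lp \<mu> q) (mho \<mu> q \<Sigma> \<Omega>)"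
proof -
  interpret sidon_haar \<mu> q \<Sigma>
    by unfold_locales (use assms in auto)
  have hom: "homogeneous_map (l2_0 \<Sigma>) (l2 \<Sigma>) \<Omega>"
    using assms(4) by (simp add: nontrivial_centralizer_def centralizer_def)
  obtain Q0 C0 where
    Q0: "\<And>c d. c \<in> carrier (l2_0 \<Sigma>) \<Longrightarrow> d \<in> carrier (l2_0 \<Sigma>) \<Longrightarrow>
      qnorm (l2 \<Sigma>) (vsub (l2 \<Sigma>) (vsub (l2 \<Sigma>) (\<Omega> (vadd (l2_0 \<Sigma>) c d)) (\<Omega> c)) (\<Omega> d)) \<le> Q0 * (qnorm (l2_0 \<Sigma>) c + qnorm (l2_0 \<Sigma>) d)"
    and C0: "\<And>u c. u \<in> carrier (linf \<Sigma>) \<Longrightarrow> c \<in> carrier (l2_0 \<Sigma>) \<Longrightarrow>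
      qnorm (l2 \<Sigma>) (vsub (l2 \<Sigma>) (\<Omega> (act (l2_0 \<Sigma>) u c)) (act (l2 \<Sigma>) u (\<Omega> c))) \<le> C0 * qnorm (linf \<Sigma>) u * qnorm (l2_0 \<Sigma>) c"
    using assms(4) unfolding nontrivial_centralizer_def centralizer_def by metis
  have ops: "qnorm (l2_0 \<Sigma>) c = l2_norm \<Sigma> c" "vadd (l2_0 \<Sigma>) c d = (\<lambda>\<gamma>. c \<gamma> + d \<gamma>)"
    "act (l2_0 \<Sigma>) c d = (\<lambda>\<gamma>. c \<gamma> * d \<gamma>)" "act (l2 \<Sigma>) c d = (\<lambda>\<gamma>. c \<gamma> * d \<gamma>)"
    "vsub (l2 \<Sigma>) c d = (\<lambda>\<gamma>. c \<gamma> - d \<gamma>)" "vscale (l2_0 \<Sigma>) t c = (\<lambda>\<gamma>. t * c \<gamma>)" "vscale (l2 \<Sigma>) t c = (\<lambda>\<gamma>. t * c \<gamma>)" for c d t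
    by (simp_all add: l2_0_def l2_def vsub_def)
  have linf_nonneg: "0 \<le> qnorm (linf \<Sigma>) u" if "u \<in> carrier (linf \<Sigma>)" for u
  proof -
    have "\<exists>B. \<forall>\<gamma>. cmod (u \<gamma>) \<le> B" using that by (simp add: linf_def bounded_iff)
    then obtain B where "\<And>\<gamma>. cmod (u \<gamma>) \<le> B" by blast
    then have "bdd_above (range (\<lambda>\<gamma>. cmod (u \<gamma>)))" by (auto intro!: bdd_aboveI[of _ B])
    then have "cmod (u undefined) \<le> (SUP \<gamma>. cmod (u \<gamma>))" by (intro cSUP_upper) auto
    then show ?thesis using order_trans[OF norm_ge_zero] by (simp add: linf_def)
  qed
  \<comment> \<open>The constants in \<open>centralizer\<close> may be negative; since norms are
    nonnegative, passing to absolute values only weakens the estimates.\<close>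
  interpret sidon_centralizer \<mu> q \<Sigma> \<Omega> "\<bar>Q0\<bar>" "\<bar>C0\<bar>"
  proof
    fix c assume c: "c \<in> carrier (l2_0 \<Sigma>)"
    show "\<Omega> c \<in> carrier (l2 \<Sigma>)" using hom c by (auto simp: homogeneous_map_def)
    show "\<Omega> (\<lambda>\<gamma>. t * c \<gamma>) = (\<lambda>\<gamma>. t * \<Omega> c \<gamma>)" for t
      using hom c by (simp add: homogeneous_map_def ops)
    show "l2_norm \<Sigma> (\<lambda>\<gamma>. \<Omega> (\<lambda>\<gamma>. c \<gamma> + d \<gamma>) \<gamma> - \<Omega> c \<gamma> - \<Omega> d \<gamma>) \<le> \<bar>Q0\<bar> * (l2_norm \<Sigma> c + l2_norm \<Sigma> d)"
      if d: "d \<in> carrier (l2_0 \<Sigma>)" for d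
    proof -
      have "Q0 * (l2_norm \<Sigma> c + l2_norm \<Sigma> d) \<le> \<bar>Q0\<bar> * (l2_norm \<Sigma> c + l2_norm \<Sigma> d)"
        by (intro mult_right_mono) (auto simp: l2_norm_nonneg)
      then show ?thesis using Q0[OF c d] unfolding ops by linarith
    qed
    show "l2_norm \<Sigma> (\<lambda>\<gamma>. \<Omega> (\<lambda>\<gamma>. u \<gamma> * c \<gamma>) \<gamma> - u \<gamma> * \<Omega> c \<gamma>) \<le> \<bar>C0\<bar> * qnorm (linf \<Sigma>) u * l2_norm \<Sigma> c"
      if u: "u \<in> carrier (linf \<Sigma>)" for u
    proof -
      have "C0 * qnorm (linf \<Sigma>) u * l2_norm \<Sigma> c \<le> \<bar>C0\<bar> * qnorm (linf \<Sigma>) u * l2_norm \<Sigma> c"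
        using linf_nonneg[OF u] by (intro mult_right_mono) (auto simp: l2_norm_nonneg)
      then show ?thesis using C0[OF u c] unfolding ops by linarith
    qed
  qed auto
  have "\<not> trivial_map (Lp \<mu> 1) (Lp0 \<mu> p) (Lp \<mu> q) (mho \<mu> q \<Sigma> \<Omega>)"
  proof
    assume "trivial_map (Lp \<mu> 1) (Lp0 \<mu> p) (Lp \<mu> q) (mho \<mu> q \<Sigma> \<Omega>)"
    then obtain \<phi> K where phi: "module_morphism (Lp \<mu> 1) (Lp0 \<mu> p) (Lp \<mu> q) \<phi>"
      and K: "\<forall>f\<in>carrier (Lp0 \<mu> p). qnorm (Lp \<mu> q) (vsub (Lp \<mu> q) (mho \<mu> q \<Sigma> \<Omega> f) (\<phi> f)) \<le> K * qnorm (Lp0 \<mu> p) f"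
      unfolding trivial_map_def by blast
    interpret trivial_sidon_centralizer \<mu> q \<Sigma> \<Omega> "\<bar>Q0\<bar>" "\<bar>C0\<bar>" p \<phi> "\<bar>K\<bar> + 1"
    proof
      fix f :: "'g \<Rightarrow> complex" assume "f \<in> polynomials"
      then have "qnorm (Lp \<mu> q) (vsub (Lp \<mu> q) (mho \<mu> q \<Sigma> \<Omega> f) (\<phi> f)) \<le> K * Lp_norm \<mu> p f"
        using K by (simp add: Lp0_def)
      also have "\<dots> \<le> (\<bar>K\<bar> + 1) * Lp_norm \<mu> p f" by (intro mult_right_mono) (auto simp: Lp_norm_nonneg)
      finally show "qnorm (Lp \<mu> q) (vsub (Lp \<mu> q) (mho \<mu> q \<Sigma> \<Omega> f) (\<phi> f)) \<le> (\<bar>K\<bar> + 1) * Lp_norm \<mu> p f" .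
    qed (use assms phi in auto)
    show False using Omega_trivial assms(4) by (simp add: nontrivial_centralizer_def)
  qed
  then show ?thesis using centralizer_mho[OF assms(5)] by (simp add: nontrivial_centralizer_def)
qed

end
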